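(* Let $d>2$, let $\Omega\subset\mathbb R^d$ be open, and let $P_1(x,D)$ and $P_2(x,D)$ be two differential operators of order $2$ with $C^\infty$ coefficients on $\Omega$. Let $x_0\in\Omega$, let $S$ be a $C^\infty$ hypersurface locally defined near $x_0$ by $S=\{x\in\Omega:\psi(x)=\psi(x_0)\}$, and put $S_-=\{x\in\Omega:\psi(x)<\psi(x_0)\}$. Suppose that there exist $M\ge 1$, a constant $C>0$, a neighbourhood $\Omega_0$ of $x_0$ and a real function $\phi\in C^\infty$ with $$\{x\in\Omega_0:\ x\ne x_0,\ \phi(x)\le\phi(x_0)\}\subset S_-$$ such that the Carleman estimates $$\|e^{-\tau\phi}u\|_{L^{\frac{2d}{d-2}}}\le C\|e^{-\tau\phi}P_1(x,D)u\|_{L^{\frac{2d}{d+2}}},\qquad \|e^{-\tau\phi}v\|_{L^{\frac{2d}{d-2}}}\le C\|e^{-\tau\phi}P_2(x,D)v\|_{L^{\frac{2d}{d+2}}}$$ hold for all $u,v\in C_0^\infty(\Omega_0)$ and all $\tau\ge M$. Let $V_1,V_2,V_3\in L^{d/2}_{loc}(\Omega)$. Then the unique continuation property across $S$ holds for solutions of the coupled system $$\begin{cases}P_1(x,D)u+V_1u=V_3v,\\ P_2(x,D)v+V_2v=V_3u\end{cases}\qquad\text{in }\Omega,$$ that is: if $u,v\in H^1(\Omega)$ solve this system and $u$ and $v$ vanish on $S_-$, then $u$ and $v$ vanish on a neighbourhood of $x_0$.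
   Context: Unique continuation across $S$ means: a solution that vanishes on the side $S_-$ of $S$ vanishes on a whole neighbourhood of $x_0$. The system is understood in the sense of distributions. The function $\psi$ is a $C^\infty$ real defining function of the hypersurface $S$ near $x_0$. *)

theory Defs
  imports "HOL-Analysis.Analysis"
begin

text \<open>
  The derivatives below are taken at interior points, so both predicates are meant for open sets.
\<close>

primrec Ck_on :: "nat \<Rightarrow> 'a::real_normed_vector set \<Rightarrow> ('a \<Rightarrow> 'b::real_normed_vector) \<Rightarrow> bool" where
  "Ck_on 0 S f \<longleftrightarrow> continuous_on S f"
| "Ck_on (Suc k) S f \<longleftrightarrow> (\<forall>x\<in>S. f differentiable (at x)) \<and>
     (\<forall>v. Ck_on k S (\<lambda>x. frechet_derivative f (at x) v))"

definition smooth_on :: "'a::real_normed_vector set \<Rightarrow> ('a \<Rightarrow> 'b::real_normed_vector) \<Rightarrow> bool" where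
  "smooth_on S f \<longleftrightarrow> (\<forall>k. Ck_on k S f)"

text \<open>The elements of $C_0^\infty(\Omega)$ are extended by zero to the whole space.\<close>

definition test_functions :: "(real ^ 'n) set \<Rightarrow> (real ^ 'n \<Rightarrow> complex) set" where
  "test_functions \<Omega> = {\<eta>. smooth_on UNIV \<eta> \<and>
     compact (closure {x. \<eta> x \<noteq> 0}) \<and> closure {x. \<eta> x \<noteq> 0} \<subseteq> \<Omega>}"

definition D :: "'n \<Rightarrow> (real ^ 'n \<Rightarrow> complex) \<Rightarrow> real ^ 'n \<Rightarrow> complex" where
  "D j f x = - \<i> * frechet_derivative f (at x) (axis j 1)"

text \<open>The coefficients of $P(x,D) = \sum_{j,k} a_{jk}(x) D_j D_k + \sum_j b_j(x) D_j + c(x)$.\<close>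

record 'n diffop2 =
  coeff2 :: "'n \<Rightarrow> 'n \<Rightarrow> real ^ 'n \<Rightarrow> complex"
  coeff1 :: "'n \<Rightarrow> real ^ 'n \<Rightarrow> complex"
  coeff0 :: "real ^ 'n \<Rightarrow> complex"

definition smooth_coeffs :: "(real ^ 'n) set \<Rightarrow> 'n diffop2 \<Rightarrow> bool" where
  "smooth_coeffs \<Omega> P \<longleftrightarrow> (\<forall>j k. smooth_on \<Omega> (coeff2 P j k)) \<and>
     (\<forall>j. smooth_on \<Omega> (coeff1 P j)) \<and> smooth_on \<Omega> (coeff0 P)"

definition apply_op :: "'n::finite diffop2 \<Rightarrow> (real ^ 'n \<Rightarrow> complex) \<Rightarrow> real ^ 'n \<Rightarrow> complex" where
  "apply_op P u x =
     (\<Sum>j\<in>UNIV. \<Sum>k\<in>UNIV. coeff2 P j k x * D j (D k u) x) +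
     (\<Sum>j\<in>UNIV. coeff1 P j x * D j u x) + coeff0 P x * u x"

text \<open>
  A function on \<open>\<Omega>\<close> is represented by a total function whose values outside \<open>\<Omega>\<close> are irrelevant,
  and equality of functions is equality almost everywhere in \<open>\<Omega>\<close>.
\<close>

definition mem_Lp :: "real \<Rightarrow> (real ^ 'n) set \<Rightarrow> (real ^ 'n \<Rightarrow> complex) \<Rightarrow> bool" where
  "mem_Lp p \<Omega> f \<longleftrightarrow> set_borel_measurable lebesgue \<Omega> f \<and>
     set_integrable lebesgue \<Omega> (\<lambda>x. norm (f x) powr p)"

definition mem_Lp_loc :: "real \<Rightarrow> (real ^ 'n) set \<Rightarrow> (real ^ 'n \<Rightarrow> complex) \<Rightarrow> bool" where
  "mem_Lp_loc p \<Omega> f \<longleftrightarrow> (\<forall>K. compact K \<and> K \<subseteq> \<Omega> \<longrightarrow> mem_Lp p K f)"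

text \<open>
  As the Bochner integral of a non-integrable function is \<open>0\<close>, this is the norm for
  \<^term>\<open>f\<close> in $L^p(\Omega)$ only; below it is applied to continuous functions that
  vanish outside a compact subset of \<open>\<Omega>\<close>.
\<close>

definition Lp_norm :: "real \<Rightarrow> (real ^ 'n) set \<Rightarrow> (real ^ 'n \<Rightarrow> complex) \<Rightarrow> real" where
  "Lp_norm p \<Omega> f = (LINT x:\<Omega>|lebesgue. norm (f x) powr p) powr (1 / p)"

definition vanishes_on :: "(real ^ 'n) set \<Rightarrow> (real ^ 'n \<Rightarrow> complex) \<Rightarrow> bool" where
  "vanishes_on A f \<longleftrightarrow> (AE x in lebesgue. x \<in> A \<longrightarrow> f x = 0)"

text \<open>
  Distributions are represented by their values on test functions; two of them are equal on
  \<open>\<Omega>\<close> if they agree on \<^term>\<open>test_functions \<Omega>\<close>. The pairing is bilinear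
  (no complex conjugation).
\<close>

type_synonym 'n distribution = "(real ^ 'n \<Rightarrow> complex) \<Rightarrow> complex"

definition distr_of :: "(real ^ 'n) set \<Rightarrow> (real ^ 'n \<Rightarrow> complex) \<Rightarrow> 'n distribution" where
  "distr_of \<Omega> f \<eta> = (LINT x:\<Omega>|lebesgue. f x * \<eta> x)"

definition distr_D :: "'n::finite \<Rightarrow> 'n distribution \<Rightarrow> 'n distribution" where
  "distr_D j T \<eta> = - T (D j \<eta>)"

definition distr_mult :: "(real ^ 'n \<Rightarrow> complex) \<Rightarrow> 'n distribution \<Rightarrow> 'n distribution" where
  "distr_mult a T \<eta> = T (\<lambda>x. a x * \<eta> x)"

definition distr_apply_op :: "'n::finite diffop2 \<Rightarrow> 'n distribution \<Rightarrow> 'n distribution" where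
  "distr_apply_op P T \<eta> =
     (\<Sum>j\<in>UNIV. \<Sum>k\<in>UNIV. distr_mult (coeff2 P j k) (distr_D j (distr_D k T)) \<eta>) +
     (\<Sum>j\<in>UNIV. distr_mult (coeff1 P j) (distr_D j T) \<eta>) + distr_mult (coeff0 P) T \<eta>"

definition mem_H1 :: "(real ^ 'n) set \<Rightarrow> (real ^ 'n \<Rightarrow> complex) \<Rightarrow> bool" where
  "mem_H1 \<Omega> u \<longleftrightarrow> mem_Lp 2 \<Omega> u \<and>
     (\<forall>j. \<exists>g. mem_Lp 2 \<Omega> g \<and>
        (\<forall>\<eta>\<in>test_functions \<Omega>. distr_D j (distr_of \<Omega> u) \<eta> = distr_of \<Omega> g \<eta>))"

text \<open>
  $P(x,D)u + Vu = Ww$ in the sense of distributions on \<open>\<Omega>\<close>. For $u, w \in H^1(\Omega)$ and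
  $V, W \in L^{d/2}_{loc}(\Omega)$ the products are locally integrable by the Sobolev embedding.
\<close>

definition solves_on ::
  "(real ^ 'n) set \<Rightarrow> 'n::finite diffop2 \<Rightarrow> (real ^ 'n \<Rightarrow> complex) \<Rightarrow> (real ^ 'n \<Rightarrow> complex) \<Rightarrow>
   (real ^ 'n \<Rightarrow> complex) \<Rightarrow> (real ^ 'n \<Rightarrow> complex) \<Rightarrow> bool" where
  "solves_on \<Omega> P V u W w \<longleftrightarrow> (\<forall>\<eta>\<in>test_functions \<Omega>.
     distr_apply_op P (distr_of \<Omega> u) \<eta> + distr_of \<Omega> (\<lambda>x. V x * u x) \<eta> =
     distr_of \<Omega> (\<lambda>x. W x * w x) \<eta>)"

definition hypersurface_near ::
  "(real ^ 'n) set \<Rightarrow> real ^ 'n \<Rightarrow> (real ^ 'n) set \<Rightarrow> (real ^ 'n \<Rightarrow> real) \<Rightarrow> bool" where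
  "hypersurface_near \<Omega> x0 S \<psi> \<longleftrightarrow> (\<exists>U. open U \<and> x0 \<in> U \<and> U \<subseteq> \<Omega> \<and> smooth_on U \<psi> \<and>
     S \<inter> U = {x \<in> U. \<psi> x = \<psi> x0} \<and>
     (\<forall>x \<in> S \<inter> U. frechet_derivative \<psi> (at x) \<noteq> (\<lambda>v. 0)))"

definition carleman_estimate ::
  "'n::finite diffop2 \<Rightarrow> (real ^ 'n) set \<Rightarrow> (real ^ 'n \<Rightarrow> real) \<Rightarrow> real \<Rightarrow> real \<Rightarrow> bool" where
  "carleman_estimate P \<Omega>\<^sub>0 \<phi> M C \<longleftrightarrow> (let d = real CARD('n) in
     \<forall>u\<in>test_functions \<Omega>\<^sub>0. \<forall>\<tau>\<ge>M.
       Lp_norm (2 * d / (d - 2)) \<Omega>\<^sub>0 (\<lambda>x. of_real (exp (- \<tau> * \<phi> x)) * u x)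
       \<le> C * Lp_norm (2 * d / (d + 2)) \<Omega>\<^sub>0 (\<lambda>x. of_real (exp (- \<tau> * \<phi> x)) * apply_op P u x))"

end

theory Submission
  imports Defs "HOL-Computational_Algebra.Polynomial"
begin

text \<open>
  A Carleman estimate for test functions extends to compactly supported $H^1$ functions whose image
  under $P$ is in $L^q$, $q = 2d/(d+2)$: mollify, and use Friedrichs' lemma for the commutator of $P$
  with the mollifier. It is applied to $\xi u$ and $\xi v$ for a cutoff $\xi$ that is $1$ near $x_0$.
  By the Sobolev embedding $\xi u, \xi v \in L^{2d/(d-2)}$, so Hoelder's inequality bounds the
  potential terms by the $L^{d/2}$ norms of the $V_i$ times the left-hand sides, and these are absorbed
  if $\xi$ is supported in a small ball. What remains are the commutator terms $[P_i,\xi]$. They live where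
  $\xi$ is not locally constant and $\psi \ge \psi(x_0)$, and there $\phi \ge c > \phi(x_0)$ by the
  convexity hypothesis and compactness. Hence $e^{\tau(c-\phi)} \xi u$ is bounded in
  $L^{2d/(d-2)}$ as $\tau \to \infty$, which forces $u = 0$ where $\phi < c$ near $x_0$; likewise for $v$.
\<close>

section \<open>Smooth functions\<close>

text \<open>The hypothesis concerns smooth functions, while u and v are only in H^1; mollification
  does not commute with variable coefficients, and the weight e^{-\<tau>\<phi>} depends on \<tau>,
  whereas no constant may. Hence the mollification radius is allowed to depend on \<tau>, only the
  fixed factor 2^q * 2 is lost, and an additive error \<delta> is kept. It is finally set to
  e^{-\<tau>cq}, the size of the weighted commutator term. The commutator of P with the mollifier is
  null in L^2 and then, on a ball, in L^q because q < 2. Norms are replaced by integrals of p-th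
  powers with values in [0, \<infinity>]. With s = 2d/(d-2) one has 1/q = 2/d + 1/s, and raising the
  estimates to the power q/s makes them linear in the two unknown quantities, so that the two
  equations can be added. Absorption is legitimate only for finite left-hand sides, a second use of
  the Sobolev embedding. To work on the whole space, coefficients are multiplied by a cutoff, \<phi>
  is extended through the projection onto a ball, and all functions get Borel representatives
  vanishing off a ball.\<close>

lemma Ck_on_cong:
  assumes "open S" "\<And>x. x \<in> S \<Longrightarrow> f x = g x" "Ck_on k S f"
  shows "Ck_on k S g"
  using assms(2,3)
proof (induction k arbitrary: f g)
  case 0
  then show ?case by (simp cong: continuous_on_cong)
next
  case (Suc k)
  have d: "(g has_derivative frechet_derivative f (at x)) (at x)" if "x \<in> S" for x
  proof (rule has_derivative_transform_within_open[OF _ assms(1) that])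
    show "(f has_derivative frechet_derivative f (at x)) (at x)"
      using Suc.prems(2) that frechet_derivative_works by auto
  qed (use Suc.prems in auto)
  then have eq: "frechet_derivative g (at x) = frechet_derivative f (at x)" if "x \<in> S" for x
    using frechet_derivative_at that by metis
  show ?case
    using d eq Suc.prems Suc.IH[of "\<lambda>x. frechet_derivative f (at x) v" "\<lambda>x. frechet_derivative g (at x) v" for v]
    by (auto simp: differentiable_def)
qed

lemma Ck_on_SucD: "Ck_on (Suc k) S f \<Longrightarrow> Ck_on k S f"
proof (induction k arbitrary: f)
  case 0
  then show ?case
    by (auto intro!: continuous_at_imp_continuous_on differentiable_imp_continuous_within)
next
  case (Suc k)
  from Suc.prems have a: "\<forall>x\<in>S. f differentiable (at x)"
    and b: "\<And>v. Ck_on (Suc k) S (\<lambda>x. frechet_derivative f (at x) v)"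
    unfolding Ck_on.simps(2)[of "Suc k"] by blast+
  show ?case using a Suc.IH[OF b] by simp
qed

text \<open>Any exhibited family \<open>f'\<close> of derivatives may be used: uniqueness identifies
  it on the open set \<open>S\<close> with the one chosen by \<open>frechet_derivative\<close>, and
  \<open>Ck_on_cong\<close> carries the higher orders over.\<close>

lemma Ck_on_SucI:
  assumes "open S" "\<And>x. x \<in> S \<Longrightarrow> (f has_derivative f' x) (at x)"
    "\<And>v. Ck_on k S (\<lambda>x. f' x v)"
  shows "Ck_on (Suc k) S f"
proof -
  have "frechet_derivative f (at x) = f' x" if "x \<in> S" for x
    using frechet_derivative_at assms(2) that by metis
  then show ?thesis
    using assms Ck_on_cong[OF assms(1) _ assms(3)] by (auto simp: differentiable_def)
qed

lemma Ck_on_subset: "Ck_on k S f \<Longrightarrow> T \<subseteq> S \<Longrightarrow> Ck_on k T f"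
  by (induction k arbitrary: f) (auto intro: continuous_on_subset)

lemma Ck_on_Un:
  assumes "open S" "open T"
  shows "Ck_on k S f \<Longrightarrow> Ck_on k T f \<Longrightarrow> Ck_on k (S \<union> T) f"
  using assms by (induction k arbitrary: f) (auto intro: continuous_on_open_Un)

lemma Ck_on_const: "Ck_on k S (\<lambda>x. c)"
  by (induction k arbitrary: c) auto

lemma Ck_on_bounded_linear: "bounded_linear f \<Longrightarrow> open S \<Longrightarrow> Ck_on k S f"
proof (cases k)
  case 0
  assume "bounded_linear f"
  then show ?thesis using 0 by (simp add: linear_continuous_on)
next
  case (Suc m)
  assume "bounded_linear f" "open S"
  then show ?thesis unfolding Suc
    by (intro Ck_on_SucI[of _ _ "\<lambda>x. f"]) (auto intro: Ck_on_const bounded_linear_imp_has_derivative)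
qed

lemma Ck_on_SucE:
  assumes "Ck_on (Suc k) S f" "x \<in> S"
  shows "(f has_derivative frechet_derivative f (at x)) (at x)"
  using assms frechet_derivative_works by auto

lemma Ck_on_add:
  assumes "open S"
  shows "Ck_on k S f \<Longrightarrow> Ck_on k S g \<Longrightarrow> Ck_on k S (\<lambda>x. f x + g x)"
proof (induction k arbitrary: f g)
  case (Suc k)
  show ?case
  proof (rule Ck_on_SucI[OF assms])
    show "((\<lambda>x. f x + g x) has_derivative
        (\<lambda>v. frechet_derivative f (at x) v + frechet_derivative g (at x) v)) (at x)" if "x \<in> S" for x
      by (intro has_derivative_add Ck_on_SucE[OF Suc.prems(1) that] Ck_on_SucE[OF Suc.prems(2) that])
  qed (use Suc in auto)
qed (simp add: continuous_on_add)

lemma Ck_on_mult: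
  fixes f g :: "'a::real_normed_vector \<Rightarrow> 'b::real_normed_algebra"
  assumes "open S"
  shows "Ck_on k S f \<Longrightarrow> Ck_on k S g \<Longrightarrow> Ck_on k S (\<lambda>x. f x * g x)"
proof (induction k arbitrary: f g)
  case (Suc k)
  show ?case
  proof (rule Ck_on_SucI[OF assms])
    show "((\<lambda>x. f x * g x) has_derivative
        (\<lambda>v. f x * frechet_derivative g (at x) v + frechet_derivative f (at x) v * g x)) (at x)" if "x \<in> S" for x
      by (intro has_derivative_mult Ck_on_SucE[OF Suc.prems(1) that] Ck_on_SucE[OF Suc.prems(2) that])
  qed (use Suc.prems Suc.IH Ck_on_SucD[OF Suc.prems(1)] Ck_on_SucD[OF Suc.prems(2)] in \<open>auto intro!: Ck_on_add[OF assms] Suc.IH\<close>)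
qed (simp add: continuous_on_mult)

lemma Ck_on_linear_image:
  assumes L: "bounded_linear L" and "open S"
  shows "Ck_on k S f \<Longrightarrow> Ck_on k S (\<lambda>x. L (f x))"
proof (induction k arbitrary: f)
  case 0
  then show ?case using bounded_linear.continuous_on[OF L] by auto
next
  case (Suc k)
  show ?case
  proof (rule Ck_on_SucI[OF assms(2)])
    show "((\<lambda>x. L (f x)) has_derivative (\<lambda>v. L (frechet_derivative f (at x) v))) (at x)" if "x \<in> S" for x
      by (intro bounded_linear.has_derivative[OF L] Ck_on_SucE[OF Suc.prems(1) that])
  qed (use Suc in auto)
qed

lemma Ck_on_affine_compose:
  fixes f :: "'a::real_normed_vector \<Rightarrow> 'b::real_normed_vector"
  shows "Ck_on k UNIV f \<Longrightarrow> Ck_on k UNIV (\<lambda>x. f (a + c *\<^sub>R x))"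
proof (induction k arbitrary: f)
  case 0
  have "continuous_on UNIV (\<lambda>x::'a. a + c *\<^sub>R x)" by (intro continuous_intros)
  moreover have "continuous_on UNIV f" using 0 by simp
  ultimately show ?case unfolding Ck_on.simps(1) using continuous_on_compose2[of UNIV f] by blast
next
  case (Suc k)
  show ?case
  proof (rule Ck_on_SucI[of _ _ "\<lambda>x v. c *\<^sub>R frechet_derivative f (at (a + c *\<^sub>R x)) v"])
    show "((\<lambda>x. f (a + c *\<^sub>R x)) has_derivative (\<lambda>v. c *\<^sub>R frechet_derivative f (at (a + c *\<^sub>R x)) v)) (at x)" for x
    proof -
      note f = Ck_on_SucE[OF Suc.prems UNIV_I, of "a + c *\<^sub>R x"]
      have g: "((\<lambda>x. a + c *\<^sub>R x) has_derivative (\<lambda>v. c *\<^sub>R v)) (at x)"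
        by (auto intro!: derivative_eq_intros)
      have "((\<lambda>x. f (a + c *\<^sub>R x)) has_derivative (\<lambda>v. frechet_derivative f (at (a + c *\<^sub>R x)) (c *\<^sub>R v))) (at x)"
        by (rule has_derivative_compose[OF g f])
      moreover have "frechet_derivative f (at (a + c *\<^sub>R x)) (c *\<^sub>R v) = c *\<^sub>R frechet_derivative f (at (a + c *\<^sub>R x)) v" for v
        using f has_derivative_linear linear_cmul by blast
      ultimately show ?thesis by simp
    qed
    show "Ck_on k UNIV (\<lambda>x. c *\<^sub>R frechet_derivative f (at (a + c *\<^sub>R x)) v)" for v
    proof (rule Ck_on_linear_image[OF bounded_linear_scaleR_right open_UNIV])
      show "Ck_on k UNIV (\<lambda>x. frechet_derivative f (at (a + c *\<^sub>R x)) v)"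
        by (rule Suc.IH[of "\<lambda>y. frechet_derivative f (at y) v"]) (use Suc.prems in simp)
    qed
  qed simp
qed

text \<open>For a sequence \<open>H\<close> closed under differentiation the induction needs only
  the product rule, and no formula for higher derivatives of a composition. The index
  \<open>m\<close> is generalized because each derivative raises it.\<close>

lemma Ck_on_real_compose:
  fixes g :: "'a::real_normed_vector \<Rightarrow> real"
  assumes H: "\<And>m t. (H m has_real_derivative H (Suc m) t) (at t)" and g: "\<And>k. Ck_on k UNIV g"
  shows "Ck_on k UNIV (\<lambda>x. H m (g x))"
proof (induction k arbitrary: m)
  case 0
  have "continuous_on UNIV (H m)" using H DERIV_continuous_on[of UNIV "H m"] by (meson has_field_derivative_at_within)
  then show ?case using g[of 0] by (auto intro: continuous_on_compose2)
next
  case (Suc k)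
  show ?case
  proof (rule Ck_on_SucI[of _ _ "\<lambda>x v. H (Suc m) (g x) * frechet_derivative g (at x) v"])
    show "((\<lambda>x. H m (g x)) has_derivative (\<lambda>v. H (Suc m) (g x) * frechet_derivative g (at x) v)) (at x)" for x
      using has_derivative_compose[OF Ck_on_SucE[OF g UNIV_I, of x]] H[of m "g x"]
      unfolding has_field_derivative_def by blast
    show "Ck_on k UNIV (\<lambda>x. H (Suc m) (g x) * frechet_derivative g (at x) v)" for v
      using g[of "Suc k"] by (intro Ck_on_mult Suc) auto
  qed simp
qed

text \<open>The derivatives of $e^{-1/t}$ are of the form $p(1/t)\,e^{-1/t}$ with a polynomial \<open>p\<close>.\<close>

definition exp_recip :: "real poly \<Rightarrow> real \<Rightarrow> real" where
  "exp_recip p t = (if t > 0 then poly p (1 / t) * exp (- (1 / t)) else 0)"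

lemma tendsto_power_poly_exp: "((\<lambda>s. s ^ k * poly p s * exp (- s)) \<longlongrightarrow> (0::real)) at_top"
proof (induction p arbitrary: k)
  case (pCons a p)
  have "((\<lambda>s. a * (s ^ k / exp s) + s ^ Suc k * poly p s * exp (- s)) \<longlongrightarrow> a * 0 + 0) at_top"
    by (intro tendsto_add tendsto_mult_left tendsto_power_div_exp_0 pCons.IH)
  then show ?case by (simp add: algebra_simps exp_minus divide_inverse)
qed simp

text \<open>With s = 1/t the chain rule gives s^2 (p(s) - p'(s)) e^{-s} for t > 0, hence the factor
  \<open>monom 1 2\<close>. At t = 0 the right difference quotient is s p(s) e^{-s} with s tending
  to infinity, so the derivative is 0 there.\<close>

lemma exp_recip_deriv:
  "(exp_recip p has_real_derivative exp_recip (monom 1 2 * (p - pderiv p)) t) (at t)"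
proof -
  consider "t > 0" | "t < 0" | "t = 0" by linarith
  then show ?thesis
  proof cases
    case 1
    have "((\<lambda>t. poly p (1 / t) * exp (- (1 / t))) has_real_derivative
       exp_recip (monom 1 2 * (p - pderiv p)) t) (at t)"
      using 1 unfolding exp_recip_def
      by (auto intro!: derivative_eq_intros DERIV_chain2[OF poly_DERIV] simp: field_simps poly_monom power2_eq_square)
    then show ?thesis
      by (rule DERIV_cong_ev[THEN iffD1, rotated 3])
         (use 1 eventually_gt_at_top[of 0] in \<open>auto simp: exp_recip_def intro: eventually_mono[OF eventually_nhds_in_open[of "{0<..}"]]\<close>)
  next
    case 2
    have "((\<lambda>t. 0) has_real_derivative exp_recip (monom 1 2 * (p - pderiv p)) t) (at t)"
      using 2 unfolding exp_recip_def by auto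
    then show ?thesis
      by (rule DERIV_cong_ev[THEN iffD1, rotated 3])
         (use 2 in \<open>auto simp: exp_recip_def intro: eventually_mono[OF eventually_nhds_in_open[of "{..<0}"]]\<close>)
  next
    case 3
    have r: "((\<lambda>h. exp_recip p h / h) \<longlongrightarrow> 0) (at_right 0)"
    proof -
      have "((\<lambda>h. (inverse h) ^ 1 * poly p (inverse h) * exp (- inverse h)) \<longlongrightarrow> 0) (at_right (0::real))"
        by (rule filterlim_compose[OF tendsto_power_poly_exp filterlim_inverse_at_top_right])
      then show ?thesis
      proof (rule Lim_transform_eventually)
        show "\<forall>\<^sub>F x in at_right 0. inverse x ^ 1 * poly p (inverse x) * exp (- inverse x) = exp_recip p x / x"
          by (auto simp: exp_recip_def field_simps eventually_at_filter)
      qed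
    qed
    have l: "((\<lambda>h. exp_recip p h / h) \<longlongrightarrow> 0) (at_left 0)"
      by (rule Lim_transform_eventually[OF tendsto_const])
         (auto simp: exp_recip_def eventually_at_filter)
    show ?thesis
      using filterlim_split_at[OF l r] 3
      by (simp add: DERIV_def exp_recip_def)
  qed
qed

lemma Ck_on_exp_recip:
  fixes g :: "'a::real_normed_vector \<Rightarrow> real"
  assumes g: "\<And>k. Ck_on k UNIV g"
  shows "Ck_on k UNIV (\<lambda>x. exp_recip 1 (g x))"
proof -
  define H where "H m = exp_recip (((\<lambda>p. monom 1 2 * (p - pderiv p)) ^^ m) 1)" for m
  have "(H m has_real_derivative H (Suc m) t) (at t)" for m t
    unfolding H_def by (simp add: exp_recip_deriv)
  from Ck_on_real_compose[where H=H, OF this g, of k 0] show ?thesis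
    by (simp add: H_def)
qed

lemma Ck_on_inner_self: "Ck_on k UNIV (\<lambda>x::'a::real_inner. x \<bullet> x)"
proof (cases k)
  case (Suc m)
  show ?thesis unfolding Suc
  proof (rule Ck_on_SucI[of _ _ "\<lambda>x v. 2 * (x \<bullet> v)"])
    show "((\<lambda>x::'a. x \<bullet> x) has_derivative (\<lambda>v. 2 * (x \<bullet> v))) (at x)" for x
      by (auto intro!: derivative_eq_intros simp: inner_commute)
    show "Ck_on m UNIV (\<lambda>x. 2 * (x \<bullet> v))" for v :: 'a
      by (intro Ck_on_bounded_linear bounded_linear_const_mult bounded_linear_inner_left) auto
  qed simp
qed (auto intro!: continuous_intros)

lemma smooth_on_cong: "open S \<Longrightarrow> (\<And>x. x \<in> S \<Longrightarrow> f x = g x) \<Longrightarrow> smooth_on S f \<Longrightarrow> smooth_on S g"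
  unfolding smooth_on_def using Ck_on_cong by blast

lemma smooth_on_subset: "smooth_on S f \<Longrightarrow> T \<subseteq> S \<Longrightarrow> smooth_on T f"
  unfolding smooth_on_def using Ck_on_subset by blast

lemma smooth_on_Un: "open S \<Longrightarrow> open T \<Longrightarrow> smooth_on S f \<Longrightarrow> smooth_on T f \<Longrightarrow> smooth_on (S \<union> T) f"
  unfolding smooth_on_def using Ck_on_Un by blast

lemma smooth_on_const: "smooth_on S (\<lambda>x. c)"
  unfolding smooth_on_def using Ck_on_const by blast

lemma smooth_on_mult:
  fixes f g :: "'a::real_normed_vector \<Rightarrow> 'b::real_normed_algebra"
  shows "open S \<Longrightarrow> smooth_on S f \<Longrightarrow> smooth_on S g \<Longrightarrow> smooth_on S (\<lambda>x. f x * g x)"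
  unfolding smooth_on_def using Ck_on_mult by blast

lemma smooth_on_deriv: "smooth_on S f \<Longrightarrow> smooth_on S (\<lambda>x. frechet_derivative f (at x) v)"
  unfolding smooth_on_def using Ck_on.simps(2) by blast

lemma smooth_on_differentiable: "smooth_on S f \<Longrightarrow> x \<in> S \<Longrightarrow> f differentiable (at x)"
  unfolding smooth_on_def using Ck_on.simps(2)[of 0 S f] by blast

lemma smooth_on_continuous: "smooth_on S f \<Longrightarrow> continuous_on S f"
  unfolding smooth_on_def using Ck_on.simps(1)[of S f] by blast

section \<open>Test functions and convolution\<close>

text \<open>Vanishing off some compact subset of \<Omega> replaces the closure in the definition, so
  that for sums, products, reflections and convolutions it suffices to name a compact set.\<close>

lemma test_functions_iff:
  "\<eta> \<in> test_functions \<Omega> \<longleftrightarrow> smooth_on UNIV \<eta> \<and> (\<exists>K. compact K \<and> K \<subseteq> \<Omega> \<and> (\<forall>x. x \<notin> K \<longrightarrow> \<eta> x = 0))"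
proof
  assume "\<eta> \<in> test_functions \<Omega>"
  then show "smooth_on UNIV \<eta> \<and> (\<exists>K. compact K \<and> K \<subseteq> \<Omega> \<and> (\<forall>x. x \<notin> K \<longrightarrow> \<eta> x = 0))"
    unfolding test_functions_def using closure_subset[of "{x. \<eta> x \<noteq> 0}"] by blast
next
  assume "smooth_on UNIV \<eta> \<and> (\<exists>K. compact K \<and> K \<subseteq> \<Omega> \<and> (\<forall>x. x \<notin> K \<longrightarrow> \<eta> x = 0))"
  then obtain K where K: "smooth_on UNIV \<eta>" "compact K" "K \<subseteq> \<Omega>" "\<forall>x. x \<notin> K \<longrightarrow> \<eta> x = 0" by blast
  have "closure {x. \<eta> x \<noteq> 0} \<subseteq> K"
    by (rule closure_minimal) (use K compact_imp_closed in auto)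
  moreover from this have "compact (closure {x. \<eta> x \<noteq> 0})"
    using compact_Int_closed[OF K(2) closed_closure, of "{x. \<eta> x \<noteq> 0}"] by (simp add: Int_absorb1)
  ultimately show "\<eta> \<in> test_functions \<Omega>"
    unfolding test_functions_def using K by auto
qed

lemma test_functionsI:
  "smooth_on UNIV \<eta> \<Longrightarrow> compact K \<Longrightarrow> K \<subseteq> \<Omega> \<Longrightarrow> (\<And>x. x \<notin> K \<Longrightarrow> \<eta> x = 0) \<Longrightarrow> \<eta> \<in> test_functions \<Omega>"
  unfolding test_functions_iff by blast

lemma test_functionsE:
  assumes "\<eta> \<in> test_functions \<Omega>"
  obtains K where "compact K" "K \<subseteq> \<Omega>" "\<And>x. x \<notin> K \<Longrightarrow> \<eta> x = 0"
  using assms unfolding test_functions_iff by blast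

lemma test_smooth: "\<eta> \<in> test_functions \<Omega> \<Longrightarrow> smooth_on UNIV \<eta>"
  unfolding test_functions_iff by blast

lemma test_mono: "\<eta> \<in> test_functions \<Omega> \<Longrightarrow> \<Omega> \<subseteq> \<Omega>' \<Longrightarrow> \<eta> \<in> test_functions \<Omega>'"
  unfolding test_functions_iff by blast

lemma test_UNIV: "\<eta> \<in> test_functions \<Omega> \<Longrightarrow> \<eta> \<in> test_functions UNIV"
  by (rule test_mono) auto

lemma test_outside: "\<eta> \<in> test_functions \<Omega> \<Longrightarrow> x \<notin> \<Omega> \<Longrightarrow> \<eta> x = 0"
  unfolding test_functions_iff by blast

lemma test_differentiable: "\<eta> \<in> test_functions \<Omega> \<Longrightarrow> \<eta> differentiable (at x)"
  using test_smooth smooth_on_differentiable by blast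

lemma test_continuous: "\<eta> \<in> test_functions \<Omega> \<Longrightarrow> continuous_on UNIV \<eta>"
  using test_smooth smooth_on_continuous by blast

lemma test_borel: "\<eta> \<in> test_functions \<Omega> \<Longrightarrow> \<eta> \<in> borel_measurable borel"
  using test_continuous borel_measurable_continuous_onI by blast

lemma frechet_derivative_zero_on:
  assumes "open S" "x \<in> S" "\<And>y. y \<in> S \<Longrightarrow> f y = 0"
  shows "frechet_derivative f (at x) = (\<lambda>v. 0)"
proof -
  have "(f has_derivative (\<lambda>v. 0)) (at x)"
    by (rule has_derivative_transform_within_open[OF has_derivative_const assms(1,2)]) (use assms in auto)
  then show ?thesis using frechet_derivative_at by metis
qed

lemma test_deriv:
  assumes "\<eta> \<in> test_functions \<Omega>"
  shows "(\<lambda>x. frechet_derivative \<eta> (at x) v) \<in> test_functions \<Omega>"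
proof -
  from assms obtain K where K: "compact K" "K \<subseteq> \<Omega>" "\<And>x. x \<notin> K \<Longrightarrow> \<eta> x = 0" by (rule test_functionsE) auto
  show ?thesis
  proof (rule test_functionsI[OF smooth_on_deriv[OF test_smooth[OF assms]] K(1,2)])
    fix x assume "x \<notin> K"
    then show "frechet_derivative \<eta> (at x) v = 0"
      using frechet_derivative_zero_on[of "- K" x \<eta>] K compact_imp_closed[of K] by (simp add: open_Compl)
  qed
qed

lemma test_cmult: "\<eta> \<in> test_functions \<Omega> \<Longrightarrow> (\<lambda>x. c * \<eta> x) \<in> test_functions \<Omega>"
  unfolding test_functions_iff by (auto intro!: smooth_on_mult smooth_on_const)

lemma test_D: "\<eta> \<in> test_functions \<Omega> \<Longrightarrow> D j \<eta> \<in> test_functions \<Omega>"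
  unfolding D_def[abs_def] by (intro test_cmult test_deriv)

lemma test_add:
  assumes "\<eta> \<in> test_functions \<Omega>" "\<xi> \<in> test_functions \<Omega>"
  shows "(\<lambda>x. \<eta> x + \<xi> x) \<in> test_functions \<Omega>"
proof -
  from assms(1) obtain K where K: "compact K" "K \<subseteq> \<Omega>" "\<And>x. x \<notin> K \<Longrightarrow> \<eta> x = 0" by (rule test_functionsE) auto
  from assms(2) obtain L where L: "compact L" "L \<subseteq> \<Omega>" "\<And>x. x \<notin> L \<Longrightarrow> \<xi> x = 0" by (rule test_functionsE) auto
  show ?thesis
  proof (rule test_functionsI[where K="K \<union> L"])
    show "smooth_on UNIV (\<lambda>x. \<eta> x + \<xi> x)"
      using test_smooth[OF assms(1)] test_smooth[OF assms(2)] Ck_on_add unfolding smooth_on_def by blast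
  qed (use K L in auto)
qed

text \<open>Outside \<Omega> the values of \<open>a\<close> are arbitrary. The product is smooth on
  \<Omega> and identically zero on the complement of a compact set carrying \<eta>; these two open
  sets cover the space.\<close>

lemma test_mult_smooth:
  assumes "open \<Omega>" "smooth_on \<Omega> a" "\<eta> \<in> test_functions \<Omega>"
  shows "(\<lambda>x. a x * \<eta> x) \<in> test_functions \<Omega>"
proof -
  from assms(3) obtain K where K: "compact K" "K \<subseteq> \<Omega>" "\<And>x. x \<notin> K \<Longrightarrow> \<eta> x = 0" by (rule test_functionsE) auto
  have o: "open (- K)" using K(1) compact_imp_closed by auto
  have "smooth_on (\<Omega> \<union> (- K)) (\<lambda>x. a x * \<eta> x)"
  proof (rule smooth_on_Un[OF assms(1) o])
    show "smooth_on \<Omega> (\<lambda>x. a x * \<eta> x)"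
      using assms test_smooth smooth_on_subset by (intro smooth_on_mult) blast+
    show "smooth_on (- K) (\<lambda>x. a x * \<eta> x)"
      by (rule smooth_on_cong[OF o _ smooth_on_const[of _ 0]]) (use K in auto)
  qed
  moreover have "\<Omega> \<union> (- K) = UNIV" using K by auto
  ultimately show ?thesis by (intro test_functionsI[OF _ K(1,2)]) (use K in auto)
qed

lemma test_mult:
  assumes "\<eta> \<in> test_functions \<Omega>" "smooth_on UNIV a"
  shows "(\<lambda>x. a x * \<eta> x) \<in> test_functions \<Omega>" "(\<lambda>x. \<eta> x * a x) \<in> test_functions \<Omega>"
  using assms unfolding test_functions_iff by (auto intro!: smooth_on_mult)

lemma smooth_on_affine_compose:
  fixes f :: "'a::real_normed_vector \<Rightarrow> 'b::real_normed_vector"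
  shows "smooth_on UNIV f \<Longrightarrow> smooth_on UNIV (\<lambda>x. f (a + c *\<^sub>R x))"
  unfolding smooth_on_def using Ck_on_affine_compose by blast

lemma test_reflect:
  assumes "\<eta> \<in> test_functions UNIV" "\<And>z. z \<notin> K \<Longrightarrow> \<eta> z = 0" "compact ((\<lambda>z. x - z) ` K)" "(\<lambda>z. x - z) ` K \<subseteq> \<Omega>"
  shows "(\<lambda>y. \<eta> (x - y)) \<in> test_functions \<Omega>"
proof (rule test_functionsI[OF _ assms(3,4)])
  show "smooth_on UNIV (\<lambda>y. \<eta> (x - y))"
    using smooth_on_affine_compose[OF test_smooth[OF assms(1)], of x "-1"] by simp
  fix y assume "y \<notin> (\<lambda>z. x - z) ` K"
  then have "x - y \<notin> K" by (auto simp: image_iff)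
  then show "\<eta> (x - y) = 0" using assms(2) by auto
qed

lemma D_mult:
  assumes "f differentiable (at x)" "g differentiable (at x)"
  shows "D j (\<lambda>x. f x * g x) x = D j f x * g x + f x * D j g x"
proof -
  have "((\<lambda>x. f x * g x) has_derivative
        (\<lambda>v. f x * frechet_derivative g (at x) v + frechet_derivative f (at x) v * g x)) (at x)"
    using assms frechet_derivative_works by (intro has_derivative_mult) auto
  from frechet_derivative_at[OF this, symmetric] show ?thesis
    unfolding D_def by (simp add: algebra_simps)
qed

text \<open>No differentiability is assumed: near \<open>x\<close> the two functions satisfy
  \<open>has_derivative\<close> for the same linear maps, so \<open>frechet_derivative\<close> makes
  the same choice for both, even if there is no derivative.\<close>

lemma D_cong:
  assumes "open S" "x \<in> S" "\<And>y. y \<in> S \<Longrightarrow> f y = g y"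
  shows "D j f x = D j g x"
proof -
  have "(f has_derivative f') (at x) \<longleftrightarrow> (g has_derivative f') (at x)" for f'
    using has_derivative_transform_within_open[OF _ assms(1,2), of f f' UNIV g]
      has_derivative_transform_within_open[OF _ assms(1,2), of g f' UNIV f] assms(3) by auto
  then show ?thesis unfolding D_def frechet_derivative_def by simp
qed

lemma D_affine:
  fixes f :: "real^'n \<Rightarrow> complex"
  assumes "f differentiable (at (a + c *\<^sub>R x))"
  shows "D j (\<lambda>y. f (a + c *\<^sub>R y)) x = of_real c * D j f (a + c *\<^sub>R x)"
proof -
  have f: "(f has_derivative frechet_derivative f (at (a + c *\<^sub>R x))) (at (a + c *\<^sub>R x))"
    using assms frechet_derivative_works by blast
  have g: "((\<lambda>x. a + c *\<^sub>R x) has_derivative (\<lambda>v. c *\<^sub>R v)) (at x)"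
    by (auto intro!: derivative_eq_intros)
  have "((\<lambda>x. f (a + c *\<^sub>R x)) has_derivative (\<lambda>v. frechet_derivative f (at (a + c *\<^sub>R x)) (c *\<^sub>R v))) (at x)"
    by (rule has_derivative_compose[OF g f])
  from frechet_derivative_at[OF this, symmetric]
  show ?thesis unfolding D_def using f has_derivative_linear linear_cmul[of "frechet_derivative f (at (a + c *\<^sub>R x))" c]
    by (auto simp: scaleR_conv_of_real[where 'a=complex] mult_ac)
qed

lemma D_reflect:
  fixes f :: "real^'n \<Rightarrow> complex"
  assumes "f differentiable (at (x - y))"
  shows "D j (\<lambda>y. f (x - y)) y = - D j f (x - y)"
  using D_affine[of f x "-1" y j] assms by simp

lemma D_cmult:
  assumes "f differentiable (at x)"
  shows "D j (\<lambda>x. c * f x) x = c * D j f x"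
  using D_mult[of "\<lambda>_. c" x f j] assms by (simp add: D_def)

lemma test_bounded:
  assumes "\<eta> \<in> test_functions \<Omega>"
  obtains B where "B > 0" "\<And>x. norm (\<eta> x) \<le> B"
proof -
  from assms obtain K where K: "compact K" "K \<subseteq> \<Omega>" "\<And>x. x \<notin> K \<Longrightarrow> \<eta> x = 0" by (rule test_functionsE) auto
  have "bounded (\<eta> ` K)"
    using K(1) test_continuous[OF assms] by (intro compact_imp_bounded compact_continuous_image) (auto intro: continuous_on_subset)
  then obtain B where B: "B > 0" "\<And>x. x \<in> K \<Longrightarrow> norm (\<eta> x) \<le> B" unfolding bounded_pos by auto
  then have "norm (\<eta> x) \<le> B" for x using K(3) by (cases "x \<in> K") auto
  with B(1) that show ?thesis by blast
qed

lemma onorm_le_sum_Basis: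
  fixes f :: "'a::euclidean_space \<Rightarrow> 'b::real_normed_vector"
  assumes "linear f"
  shows "onorm f \<le> (\<Sum>b\<in>Basis. norm (f b))"
proof (rule onorm_le)
  fix x
  have "norm (f x) = norm (\<Sum>b\<in>Basis. (x \<bullet> b) *\<^sub>R f b)"
    by (subst euclidean_representation[of x, symmetric]) (simp add: linear_sum[OF assms] linear_scale[OF assms])
  also have "\<dots> \<le> (\<Sum>b\<in>Basis. norm ((x \<bullet> b) *\<^sub>R f b))" by (rule norm_sum)
  also have "\<dots> \<le> (\<Sum>b\<in>Basis. norm (f b) * norm x)"
    by (intro sum_mono) (simp add: mult.commute[of "norm (f _)"] mult_right_mono Basis_le_norm)
  finally show "norm (f x) \<le> (\<Sum>b\<in>Basis. norm (f b)) * norm x" by (simp add: sum_distrib_right)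
qed

text \<open>Mean value inequality. The operator norm of the derivative is bounded by the sum of the
  suprema of the partial derivatives, each of which is again a test function.\<close>

lemma test_lipschitz:
  fixes \<eta> :: "real^'n \<Rightarrow> complex"
  assumes "\<eta> \<in> test_functions \<Omega>"
  obtains L where "L > 0" "\<And>x y. norm (\<eta> x - \<eta> y) \<le> L * norm (x - y)"
proof -
  have "\<forall>b. \<exists>B>0. \<forall>x. norm (frechet_derivative \<eta> (at x) b) \<le> B"
    using test_bounded[OF test_deriv[OF assms]] by metis
  then obtain B where B: "\<And>b. B b > 0" "\<And>b x. norm (frechet_derivative \<eta> (at x) b) \<le> B b" by metis
  have d: "(\<eta> has_derivative frechet_derivative \<eta> (at x)) (at x)" for x
    using test_differentiable[OF assms] frechet_derivative_works by blast
  have "onorm (frechet_derivative \<eta> (at x)) \<le> (\<Sum>b\<in>Basis. B b)" for x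
    by (rule order_trans[OF onorm_le_sum_Basis[OF has_derivative_linear[OF d]] sum_mono[OF B(2)]])
  then have "norm (\<eta> x - \<eta> y) \<le> (\<Sum>b\<in>Basis. B b) * norm (x - y)" for x y
    by (intro differentiable_bound[of UNIV _ "\<lambda>x. frechet_derivative \<eta> (at x)"]) (auto intro: d)
  moreover have "(\<Sum>b\<in>Basis. B b) > 0" for x using B(1) by (intro sum_pos) auto
  ultimately show ?thesis using that by blast
qed

text \<open>The mean value inequality for \<eta> minus its linear part at \<open>z\<close>, whose
  derivative is Lipschitz and vanishes at \<open>z\<close>. A remainder bound uniform in
  \<open>z\<close> allows differentiation under a convolution integral.\<close>

lemma test_taylor:
  fixes \<eta> :: "real^'n \<Rightarrow> complex"
  assumes "\<eta> \<in> test_functions \<Omega>"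
  obtains L where "L > 0"
    "\<And>z h. norm (\<eta> (z + h) - \<eta> z - frechet_derivative \<eta> (at z) h) \<le> L * norm h * norm h"
proof -
  have "\<forall>b. \<exists>B>0. \<forall>x y. norm (frechet_derivative \<eta> (at x) b - frechet_derivative \<eta> (at y) b) \<le> B * norm (x - y)"
    using test_lipschitz[OF test_deriv[OF assms]] by metis
  then obtain B where B: "\<And>b. B b > 0"
    "\<And>b x y. norm (frechet_derivative \<eta> (at x) b - frechet_derivative \<eta> (at y) b) \<le> B b * norm (x - y)" by metis
  have d: "(\<eta> has_derivative frechet_derivative \<eta> (at x)) (at x)" for x
    using test_differentiable[OF assms] frechet_derivative_works by blast
  define L where "L = (\<Sum>b\<in>Basis. B b)"
  have o: "onorm (\<lambda>v. frechet_derivative \<eta> (at x) v - frechet_derivative \<eta> (at y) v) \<le> L * norm (x - y)" for x y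
  proof -
    have "linear (\<lambda>v. frechet_derivative \<eta> (at x) v - frechet_derivative \<eta> (at y) v)"
      by (intro linear_compose_sub has_derivative_linear[OF d])
    from onorm_le_sum_Basis[OF this]
    have "onorm (\<lambda>v. frechet_derivative \<eta> (at x) v - frechet_derivative \<eta> (at y) v) \<le>
      (\<Sum>b\<in>Basis. B b * norm (x - y))" by (rule order_trans[OF _ sum_mono[OF B(2)]])
    then show ?thesis by (simp add: L_def sum_distrib_right)
  qed
  have "norm (\<eta> (z + h) - \<eta> z - frechet_derivative \<eta> (at z) h) \<le> L * norm h * norm h" for z h
  proof -
    let ?g = "\<lambda>x. \<eta> x - frechet_derivative \<eta> (at z) x"
    have "norm (?g (z + h) - ?g z) \<le> (L * norm h) * norm ((z + h) - z)"
    proof (rule differentiable_bound[of "cball z (norm h)" _ "\<lambda>x v. frechet_derivative \<eta> (at x) v - frechet_derivative \<eta> (at z) v"])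
      fix x assume x: "x \<in> cball z (norm h)"
      have "bounded_linear (frechet_derivative \<eta> (at z))" using d has_derivative_bounded_linear by blast
      then show "(?g has_derivative (\<lambda>v. frechet_derivative \<eta> (at x) v - frechet_derivative \<eta> (at z) v)) (at x within cball z (norm h))"
        using d[of x] by (intro has_derivative_diff bounded_linear_imp_has_derivative) (auto intro: has_derivative_at_withinI)
      show "onorm (\<lambda>v. frechet_derivative \<eta> (at x) v - frechet_derivative \<eta> (at z) v) \<le> L * norm h"
      proof (rule order_trans[OF o mult_left_mono])
        show "norm (x - z) \<le> norm h" using x by (simp add: dist_norm norm_minus_commute)
        show "0 \<le> L" unfolding L_def using B(1) by (intro sum_nonneg) (auto intro: less_imp_le)
      qed
    qed (auto simp: dist_norm)
    moreover have "frechet_derivative \<eta> (at z) (z + h) = frechet_derivative \<eta> (at z) z + frechet_derivative \<eta> (at z) h"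
      using has_derivative_linear[OF d] linear_add by blast
    ultimately show ?thesis by (simp add: algebra_simps)
  qed
  moreover have "L > 0" unfolding L_def using B(1) by (intro sum_pos) auto
  ultimately show ?thesis using that by blast
qed

section \<open>Convolution with a test function\<close>

definition conv :: "(real^'n \<Rightarrow> complex) \<Rightarrow> (real^'n \<Rightarrow> complex) \<Rightarrow> real^'n \<Rightarrow> complex" where
  "conv \<rho> f x = (LINT y|lborel. \<rho> (x - y) * f y)"

lemma integrable_bounded_mult:
  fixes f g :: "'a \<Rightarrow> complex"
  assumes "integrable M f" "g \<in> borel_measurable M" "\<And>x. norm (g x) \<le> B"
  shows "integrable M (\<lambda>x. g x * f x)"
proof (rule Bochner_Integration.integrable_bound[of M "\<lambda>x. B * norm (f x)"])
  show "AE x in M. norm (g x * f x) \<le> norm (B * norm (f x))"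
    unfolding norm_mult real_norm_def
    by (intro always_eventually allI order_trans[OF mult_right_mono[OF assms(3)] abs_ge_self] norm_ge_zero)
qed (use assms in auto)

lemma integrable_test_mult:
  assumes "\<eta> \<in> test_functions \<Omega>" "integrable lborel f"
  shows "integrable lborel (\<lambda>y. \<eta> y * f y)"
proof -
  from test_bounded[OF assms(1)] obtain B where "\<And>x. norm (\<eta> x) \<le> B" by blast
  then show ?thesis using assms test_borel[OF assms(1)] by (intro integrable_bounded_mult) auto
qed

lemma integrable_conv:
  assumes "\<eta> \<in> test_functions \<Omega>" "integrable lborel f"
  shows "integrable lborel (\<lambda>y. \<eta> (x - y) * f y)"
proof -
  from test_bounded[OF assms(1)] obtain B where "\<And>x. norm (\<eta> x) \<le> B" by blast
  moreover have "(\<lambda>y. \<eta> (x - y)) \<in> borel_measurable borel" using test_borel[OF assms(1)] by measurable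
  ultimately show ?thesis using assms by (intro integrable_bounded_mult) auto
qed

lemma has_derivative_quadratic_bound:
  fixes F :: "'a::real_normed_vector \<Rightarrow> 'b::real_normed_vector"
  assumes "bounded_linear F'" "\<And>h. norm (F (x + h) - F x - F' h) \<le> C * norm h * norm h"
  shows "(F has_derivative F') (at x)"
proof (rule has_derivativeI[OF assms(1)])
  have "((\<lambda>y. C * norm (y - x)) \<longlongrightarrow> C * norm (x - x)) (at x)"
    by (intro tendsto_intros)
  then have l: "((\<lambda>y. C * norm (y - x)) \<longlongrightarrow> 0) (at x)" by simp
  show "((\<lambda>y. (F y - F x - F' (y - x)) /\<^sub>R norm (y - x)) \<longlongrightarrow> 0) (at x)"
  proof (rule Lim_null_comparison[OF _ l])
    have "norm ((F y - F x - F' (y - x)) /\<^sub>R norm (y - x)) \<le> C * norm (y - x)" if "y \<noteq> x" for y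
    proof -
      have "norm (F y - F x - F' (y - x)) / norm (y - x) \<le> C * norm (y - x)"
        using assms(2)[of "y - x"] that by (subst pos_divide_le_eq) auto
      then show ?thesis by (simp add: divide_inverse mult.commute)
    qed
    then show "\<forall>\<^sub>F y in at x. norm ((F y - F x - F' (y - x)) /\<^sub>R norm (y - x)) \<le> C * norm (y - x)"
      by (auto simp: eventually_at_filter)
  qed
qed

text \<open>The Taylor remainder of \<rho> is at most L |h|^2 uniformly in the base point;
  integrated against |f| it is a constant times |h|^2, so no limit theorem for integrals is
  needed.\<close>

lemma conv_has_derivative:
  fixes \<rho> f :: "real^'n \<Rightarrow> complex"
  assumes \<rho>: "\<rho> \<in> test_functions \<Omega>" and f: "integrable lborel f"
  shows "(conv \<rho> f has_derivative (\<lambda>v. conv (\<lambda>z. frechet_derivative \<rho> (at z) v) f x)) (at x)"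
proof -
  let ?d = "\<lambda>v z. frechet_derivative \<rho> (at z) v"
  from test_taylor[OF \<rho>] obtain L where L: "L > 0" "\<And>z h. norm (\<rho> (z + h) - \<rho> z - ?d h z) \<le> L * norm h * norm h" by blast
  have lin: "linear (frechet_derivative \<rho> (at z))" for z
    using test_differentiable[OF \<rho>] frechet_derivative_works has_derivative_linear by blast
  note int = integrable_conv[OF \<rho> f] integrable_conv[OF test_deriv[OF \<rho>] f]
  have "linear (\<lambda>v. conv (?d v) f x)"
  proof (rule linearI)
    show "conv (?d (v + w)) f x = conv (?d v) f x + conv (?d w) f x" for v w
      unfolding conv_def by (subst Bochner_Integration.integral_add[symmetric])
        (auto simp: linear_add[OF lin] distrib_right int)
    show "conv (?d (c *\<^sub>R v)) f x = c *\<^sub>R conv (?d v) f x" for c v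
      unfolding conv_def by (subst integral_scaleR_right[symmetric])
        (auto simp: linear_scale[OF lin] int)
  qed
  then have bl: "bounded_linear (\<lambda>v. conv (?d v) f x)" by (simp add: linear_conv_bounded_linear)
  show ?thesis
  proof (rule has_derivative_quadratic_bound[OF bl])
    fix h
    have "conv \<rho> f (x + h) - conv \<rho> f x - conv (?d h) f x =
      (LINT y|lborel. \<rho> (x + h - y) * f y - \<rho> (x - y) * f y - ?d h (x - y) * f y)"
      unfolding conv_def by (simp add: int Bochner_Integration.integral_diff)
    also have "\<dots> = (LINT y|lborel. (\<rho> ((x - y) + h) - \<rho> (x - y) - ?d h (x - y)) * f y)"
      by (intro Bochner_Integration.integral_cong) (auto simp: algebra_simps)
    also have "norm \<dots> \<le> (LINT y|lborel. (L * norm h * norm h) * norm (f y))"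
    proof (rule Bochner_Integration.integral_norm_bound_integral)
      have "integrable lborel (\<lambda>y. \<rho> (x + h - y) * f y - \<rho> (x - y) * f y - ?d h (x - y) * f y)"
        by (intro Bochner_Integration.integrable_diff int)
      then show "integrable lborel (\<lambda>y. (\<rho> ((x - y) + h) - \<rho> (x - y) - ?d h (x - y)) * f y)"
        by (simp add: algebra_simps)
      show "norm ((\<rho> (x - y + h) - \<rho> (x - y) - ?d h (x - y)) * f y) \<le> L * norm h * norm h * norm (f y)" for y
        unfolding norm_mult by (intro mult_right_mono L) auto
    qed (use f in auto)
    finally show "norm (conv \<rho> f (x + h) - conv \<rho> f x - conv (?d h) f x) \<le> (L * (LINT y|lborel. norm (f y))) * norm h * norm h"
      by (simp add: mult_ac)
  qed
qed

lemma conv_Ck_on: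
  fixes \<rho> f :: "real^'n \<Rightarrow> complex"
  assumes f: "integrable lborel f"
  shows "\<rho> \<in> test_functions \<Omega> \<Longrightarrow> Ck_on k UNIV (conv \<rho> f)"
proof (induction k arbitrary: \<rho>)
  case 0
  have "isCont (conv \<rho> f) x" for x
    using has_derivative_continuous[OF conv_has_derivative[OF 0 f]] .
  then show ?case by (simp add: continuous_at_imp_continuous_on)
next
  case (Suc k)
  show ?case
    by (rule Ck_on_SucI[OF _ conv_has_derivative[OF Suc.prems f]]) (auto intro: Suc test_deriv)
qed

lemma conv_smooth: "integrable lborel f \<Longrightarrow> \<rho> \<in> test_functions \<Omega> \<Longrightarrow> smooth_on UNIV (conv \<rho> f)"
  unfolding smooth_on_def using conv_Ck_on by blast

lemma D_conv:
  assumes "\<rho> \<in> test_functions \<Omega>" "integrable lborel f"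
  shows "D j (conv \<rho> f) x = conv (D j \<rho>) f x"
proof -
  have "D j (conv \<rho> f) x = - \<i> * (LINT y|lborel. frechet_derivative \<rho> (at (x - y)) (axis j 1) * f y)"
    unfolding D_def frechet_derivative_at[OF conv_has_derivative[OF assms], symmetric] by (simp add: conv_def)
  also have "\<dots> = conv (D j \<rho>) f x"
    unfolding conv_def D_def by (subst integral_mult_right_zero[symmetric]) (simp add: mult.assoc)
  finally show ?thesis .
qed

section \<open>Hoelder and grid-lines inequalities\<close>

text \<open>With \<open>epowr x 0 = 1\<close> also for \<open>x = 0\<close> and \<open>x = top\<close>, the laws of exponents hold without exception.\<close>

definition epowr :: "ennreal \<Rightarrow> real \<Rightarrow> ennreal" where
  "epowr x p = (if p = 0 then 1 else if x = top then top else ennreal (enn2real x powr p))"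

lemma epowr_0 [simp]: "epowr x 0 = 1"
  by (simp add: epowr_def)

lemma epowr_1 [simp]: "epowr x 1 = x"
  by (simp add: epowr_def less_top)

lemma epowr_zero [simp]: "p \<noteq> 0 \<Longrightarrow> epowr 0 p = 0"
  by (simp add: epowr_def)

lemma epowr_one [simp]: "epowr 1 p = 1"
  by (simp add: epowr_def)

lemma epowr_top [simp]: "p \<noteq> 0 \<Longrightarrow> epowr top p = top"
  by (simp add: epowr_def)

lemma epowr_ennreal: "0 \<le> r \<Longrightarrow> p \<noteq> 0 \<Longrightarrow> epowr (ennreal r) p = ennreal (r powr p)"
  by (simp add: epowr_def)

lemma epowr_eq_0_iff: "epowr x p = 0 \<longleftrightarrow> p \<noteq> 0 \<and> x = 0"
  by (auto simp: epowr_def enn2real_eq_0_iff)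

lemma epowr_eq_top_iff: "epowr x p = top \<longleftrightarrow> p \<noteq> 0 \<and> x = top"
  by (auto simp: epowr_def)

lemma epowr_mono: "x \<le> y \<Longrightarrow> 0 \<le> p \<Longrightarrow> epowr x p \<le> epowr y p"
  unfolding epowr_def by (auto simp: top_unique less_top intro!: ennreal_leI powr_mono2 enn2real_mono)

lemma epowr_add: "0 \<le> p \<Longrightarrow> 0 \<le> q \<Longrightarrow> epowr x (p + q) = epowr x p * epowr x q"
  by (cases x) (auto simp: epowr_def powr_add ennreal_mult)

lemma epowr_mult: "0 \<le> p \<Longrightarrow> epowr (x * y) p = epowr x p * epowr y p"
proof (cases "p = 0")
  case False
  assume "0 \<le> p"
  with False have p: "p > 0" by simp
  show ?thesis
  proof (cases "x = top \<or> y = top")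
    case True
    then show ?thesis using p
      by (cases "x = 0 \<or> y = 0") (auto simp: ennreal_top_mult ennreal_mult_top epowr_eq_0_iff)
  next
    case F: False
    then obtain r s where "x = ennreal r" "r \<ge> 0" "y = ennreal s" "s \<ge> 0" by (cases x; cases y) auto
    then show ?thesis using p by (simp add: ennreal_mult[symmetric] epowr_ennreal powr_mult)
  qed
qed simp

lemma epowr_epowr: "epowr (epowr x p) q = epowr x (p * q)"
  by (cases x) (auto simp: epowr_def powr_powr)

lemma epowr_measurable [measurable]:
  assumes [measurable]: "f \<in> borel_measurable M"
  shows "(\<lambda>x. epowr (f x) p) \<in> borel_measurable M"
  unfolding epowr_def by measurable

text \<open>Jensen's inequality for the exponential function at the points ln (a i). If some
  \<open>a i\<close> is 0 the logarithm is not usable, but then the product vanishes.\<close>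

lemma weighted_am_gm:
  fixes p a :: "'i \<Rightarrow> real"
  assumes "finite I" "\<And>i. i \<in> I \<Longrightarrow> 0 < p i" "(\<Sum>i\<in>I. p i) = 1" "\<And>i. i \<in> I \<Longrightarrow> 0 \<le> a i"
  shows "(\<Prod>i\<in>I. a i powr p i) \<le> (\<Sum>i\<in>I. p i * a i)"
proof (cases "\<exists>i\<in>I. a i = 0")
  case True
  then have "(\<Prod>i\<in>I. a i powr p i) = 0" using assms(1) by (auto simp: prod_zero_iff)
  also have "\<dots> \<le> (\<Sum>i\<in>I. p i * a i)" using assms by (intro sum_nonneg) (auto intro: less_imp_le mult_nonneg_nonneg)
  finally show ?thesis .
next
  case False
  then have a: "a i > 0" if "i \<in> I" for i using assms(4)[OF that] that by force
  have "I \<noteq> {}" using assms(3) by auto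
  have "(\<Prod>i\<in>I. a i powr p i) = exp (\<Sum>i\<in>I. p i * ln (a i))"
    unfolding exp_sum[OF assms(1)]
  proof (intro prod.cong refl)
    fix i assume "i \<in> I"
    from a[OF this] show "a i powr p i = exp (p i * ln (a i))" by (simp add: powr_def)
  qed
  also have "\<dots> \<le> (\<Sum>i\<in>I. p i * exp (ln (a i)))"
    using convex_on_sum[OF assms(1) \<open>I \<noteq> {}\<close> exp_convex assms(3), of "\<lambda>i. ln (a i)"] assms(2)
    by (auto intro: less_imp_le)
  also have "\<dots> = (\<Sum>i\<in>I. p i * a i)" by (intro sum.cong) (use a in auto)
  finally show ?thesis .
qed

lemma weighted_am_gm_ennreal:
  assumes "finite I" "\<And>i. i \<in> I \<Longrightarrow> 0 < p i" "(\<Sum>i\<in>I. p i) = 1"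
  shows "(\<Prod>i\<in>I. epowr (a i) (p i)) \<le> (\<Sum>i\<in>I. ennreal (p i) * a i)"
proof (cases "\<exists>i\<in>I. a i = top")
  case True
  then obtain i where "i \<in> I" "a i = top" by blast
  moreover from this have "ennreal (p i) * a i = top"
    using assms(2)[of i] by (simp add: ennreal_mult_top)
  ultimately have "(\<Sum>i\<in>I. ennreal (p i) * a i) = top"
    using assms(1) by (simp add: sum.remove[of I i])
  then show ?thesis by simp
next
  case False
  define r where "r i = enn2real (a i)" for i
  have r: "a i = ennreal (r i)" "r i \<ge> 0" if "i \<in> I" for i
    using False that by (auto simp: r_def less_top)
  have "(\<Prod>i\<in>I. epowr (a i) (p i)) = ennreal (\<Prod>i\<in>I. r i powr p i)"
    unfolding prod_ennreal[symmetric, OF powr_ge_zero]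
  proof (intro prod.cong refl)
    fix i assume i: "i \<in> I"
    show "epowr (a i) (p i) = ennreal (r i powr p i)"
      using assms(2)[OF i] r[OF i] by (simp add: epowr_ennreal)
  qed
  also have "\<dots> \<le> ennreal (\<Sum>i\<in>I. p i * r i)"
    by (intro ennreal_leI weighted_am_gm assms r)
  also have "\<dots> = (\<Sum>i\<in>I. ennreal (p i) * a i)"
    using assms(2) r by (subst sum_ennreal[symmetric]) (auto intro!: sum.cong mult_nonneg_nonneg simp: ennreal_mult less_imp_le)
  finally show ?thesis .
qed

text \<open>After division of each factor by its integral, the weighted arithmetic-geometric
  inequality holds pointwise and integrates to 1. Indices of exponent 0 contribute the factor 1 and
  are dropped first; a zero integral makes the left side vanish, and an infinite one, with none
  equal to 0, makes the right side infinite.\<close>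

lemma Hoelder_nn_integral:
  assumes fin: "finite I" and nn: "\<And>i. i \<in> I \<Longrightarrow> 0 \<le> p i" and sum1: "(\<Sum>i\<in>I. p i) = 1"
    and meas: "\<And>i. i \<in> I \<Longrightarrow> F i \<in> borel_measurable M"
  shows "(\<integral>\<^sup>+x. (\<Prod>i\<in>I. epowr (F i x) (p i)) \<partial>M) \<le> (\<Prod>i\<in>I. epowr (\<integral>\<^sup>+x. F i x \<partial>M) (p i))"
proof -
  define J where "J = {i \<in> I. p i > 0}"
  have J: "finite J" "J \<subseteq> I" "\<And>i. i \<in> J \<Longrightarrow> p i > 0" using fin by (auto simp: J_def)
  have out: "p i = 0" if "i \<in> I - J" for i using nn[of i] that by (auto simp: J_def)
  have PJ: "(\<Prod>i\<in>I. epowr (h i) (p i)) = (\<Prod>i\<in>J. epowr (h i) (p i))" for h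
    using out by (intro prod.mono_neutral_right[OF fin J(2)]) auto
  have sumJ: "(\<Sum>i\<in>J. p i) = 1"
    using sum.mono_neutral_right[OF fin J(2), of p] out sum1 by auto
  have mJ [measurable]: "\<And>i. i \<in> J \<Longrightarrow> F i \<in> borel_measurable M" using meas J by auto
  define c where "c i = (\<integral>\<^sup>+x. F i x \<partial>M)" for i
  show ?thesis
  proof (cases "\<exists>i\<in>J. c i = 0")
    case True
    then obtain i where i: "i \<in> J" "c i = 0" by blast
    then have "AE x in M. F i x = 0"
      using mJ[OF i(1)] by (simp add: c_def nn_integral_0_iff_AE)
    then have "AE x in M. (\<Prod>i\<in>J. epowr (F i x) (p i)) = 0"
    proof eventually_elim
      case (elim x)
      then have "epowr (F i x) (p i) = 0" using J(3)[OF i(1)] by simp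
      then show ?case using i J(1) by (intro prod_zero) auto
    qed
    then have "(\<integral>\<^sup>+x. (\<Prod>i\<in>J. epowr (F i x) (p i)) \<partial>M) = (\<integral>\<^sup>+x. 0 \<partial>M)"
      by (intro nn_integral_cong_AE) auto
    then show ?thesis unfolding PJ by simp
  next
    case pos: False
    show ?thesis
    proof (cases "\<exists>i\<in>J. c i = top")
      case True
      then obtain i where i: "i \<in> J" "c i = top" by blast
      have "(\<Prod>i\<in>J - {i}. epowr (c i) (p i)) \<noteq> 0"
        using pos J by (auto simp: prod_zero_iff epowr_eq_0_iff)
      moreover have "epowr (c i) (p i) = top" using i J(3)[of i] by simp
      ultimately have "(\<Prod>i\<in>J. epowr (c i) (p i)) = top"
        using i J(1) by (simp add: prod.remove[of J i] ennreal_top_mult)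
      then show ?thesis unfolding PJ c_def by simp
    next
      case False
      define r where "r i = enn2real (c i)" for i
      have r: "c i = ennreal (r i)" "r i > 0" if "i \<in> J" for i
        using False pos that by (auto simp: r_def less_top enn2real_positive_iff zero_less_iff_neq_zero)
      have inv: "c i * (F i x * ennreal (1 / r i)) = F i x" if "i \<in> J" for i x
      proof -
        have "c i * (F i x * ennreal (1 / r i)) = F i x * (ennreal (r i) * ennreal (1 / r i))"
          by (simp add: r(1)[OF that] mult_ac)
        also have "ennreal (r i) * ennreal (1 / r i) = 1"
          using r(2)[OF that] by (simp add: ennreal_mult[symmetric])
        finally show ?thesis by simp
      qed
      have "(\<integral>\<^sup>+x. (\<Prod>i\<in>J. epowr (F i x) (p i)) \<partial>M) =
        (\<integral>\<^sup>+x. (\<Prod>i\<in>J. epowr (c i) (p i)) * (\<Prod>i\<in>J. epowr (F i x * ennreal (1 / r i)) (p i)) \<partial>M)"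
        unfolding prod.distrib[symmetric]
        using J(3) by (intro nn_integral_cong prod.cong refl) (simp add: epowr_mult[symmetric] inv less_imp_le)
      also have "\<dots> = (\<Prod>i\<in>J. epowr (c i) (p i)) * (\<integral>\<^sup>+x. (\<Prod>i\<in>J. epowr (F i x * ennreal (1 / r i)) (p i)) \<partial>M)"
        by (intro nn_integral_cmult) measurable
      also have "(\<integral>\<^sup>+x. (\<Prod>i\<in>J. epowr (F i x * ennreal (1 / r i)) (p i)) \<partial>M) \<le>
        (\<integral>\<^sup>+x. (\<Sum>i\<in>J. ennreal (p i) * (F i x * ennreal (1 / r i))) \<partial>M)"
        by (intro nn_integral_mono weighted_am_gm_ennreal J sumJ)
      also have "\<dots> = (\<Sum>i\<in>J. ennreal (p i) * (c i * ennreal (1 / r i)))"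
        unfolding c_def by (subst nn_integral_sum) (auto simp: nn_integral_cmult nn_integral_multc)
      also have "\<dots> = (\<Sum>i\<in>J. ennreal (p i))"
      proof (intro sum.cong refl)
        fix i assume i: "i \<in> J"
        have "c i * ennreal (1 / r i) = 1"
          using r[OF i] by (simp add: ennreal_mult[symmetric])
        then show "ennreal (p i) * (c i * ennreal (1 / r i)) = ennreal (p i)" by simp
      qed
      also have "\<dots> = 1" using sumJ J(3) by (simp add: sum_ennreal less_imp_le)
      finally show ?thesis unfolding PJ c_def by (simp add: mult_left_mono)
    qed
  qed
qed

lemma Hoelder2:
  assumes "0 \<le> p" "0 \<le> q" "p + q = 1" "F \<in> borel_measurable M" "G \<in> borel_measurable M"
  shows "(\<integral>\<^sup>+x. epowr (F x) p * epowr (G x) q \<partial>M) \<le> epowr (\<integral>\<^sup>+x. F x \<partial>M) p * epowr (\<integral>\<^sup>+x. G x \<partial>M) q"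
  using Hoelder_nn_integral[of UNIV "\<lambda>b. if b then p else q" "\<lambda>b. if b then F else G" M] assms
  by (simp add: UNIV_bool mult.commute add.commute)

text \<open>The proof follows van Doorn and Macbeth: adding one coordinate at a time, Hoelder's inequality
  in the new variable replaces \<open>f\<close> by its integral over that variable.\<close>

lemma grid_lines_inequality:
  fixes f :: "('i \<Rightarrow> real) \<Rightarrow> ennreal"
  assumes "finite A" "0 \<le> p" "(real (card A) - 1) * p \<le> 1"
    "f \<in> borel_measurable (Pi\<^sub>M A (\<lambda>_. lborel))"
  shows "(\<integral>\<^sup>+x. epowr (f x) (1 - (real (card A) - 1) * p) *
      (\<Prod>j\<in>A. epowr (\<integral>\<^sup>+t. f (x(j := t)) \<partial>lborel) p) \<partial>Pi\<^sub>M A (\<lambda>_. lborel))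
    \<le> epowr (\<integral>\<^sup>+x. f x \<partial>Pi\<^sub>M A (\<lambda>_. lborel)) (1 + p)"
  using assms(1,3,4)
proof (induction A arbitrary: f rule: finite_induct)
  case empty
  interpret product_sigma_finite "\<lambda>_::'i. lborel :: real measure" ..
  show ?case by (simp add: nn_integral_empty)
next
  case (insert i A)
  interpret product_sigma_finite "\<lambda>_::'i. lborel :: real measure" ..
  let ?M = "Pi\<^sub>M A (\<lambda>_. lborel :: real measure)"
  note fin = insert.hyps(1) and nin = insert.hyps(2)
  define n where "n = real (card A)"
  have card: "real (card (insert i A)) - 1 = n" using fin nin by (simp add: n_def)
  have [measurable]: "f \<in> borel_measurable (Pi\<^sub>M (insert i A) (\<lambda>_. lborel))" by (rule insert.prems(2))
  have np: "n * p \<le> 1" using insert.prems(1) unfolding card .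
  define F where "F x = (\<integral>\<^sup>+t. f (x(i := t)) \<partial>lborel)" for x
  have upd [measurable]: "(\<lambda>(x, t). f (x(i := t))) \<in> borel_measurable (?M \<Otimes>\<^sub>M lborel)"
    using measurable_compose[OF measurable_add_dim[of i A "\<lambda>_. lborel"] insert.prems(2)]
    by (simp add: case_prod_unfold)
  have F [measurable]: "F \<in> borel_measurable ?M"
    unfolding F_def by measurable
  define G where "G j x y = (\<integral>\<^sup>+t. f (x(i := y, j := t)) \<partial>lborel)" for j x y
  have G [measurable]: "(\<lambda>(x, y). G j x y) \<in> borel_measurable (?M \<Otimes>\<^sub>M lborel)" if "j \<in> A" for j
  proof -
    have 1: "(\<lambda>z. (fst (fst z))(i := snd (fst z))) \<in> measurable ((?M \<Otimes>\<^sub>M lborel) \<Otimes>\<^sub>M lborel) (Pi\<^sub>M (insert i A) (\<lambda>_. lborel))"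
      by (rule measurable_fun_upd[where J=A]) auto
    have 2: "(\<lambda>z. (fst (fst z))(i := snd (fst z), j := snd z)) \<in> measurable ((?M \<Otimes>\<^sub>M lborel) \<Otimes>\<^sub>M lborel) (Pi\<^sub>M (insert i A) (\<lambda>_. lborel))"
      by (rule measurable_fun_upd[where J="insert i A"]) (use that 1 in auto)
    have 3: "(\<lambda>z. f ((fst (fst z))(i := snd (fst z), j := snd z))) \<in> borel_measurable ((?M \<Otimes>\<^sub>M lborel) \<Otimes>\<^sub>M lborel)"
      by (rule measurable_compose[OF 2]) measurable
    show ?thesis unfolding G_def case_prod_unfold
      by (rule lborel.borel_measurable_nn_integral) (use 3 in \<open>simp add: case_prod_unfold\<close>)
  qed
  \<comment> \<open>The exponent left for \<open>f\<close> itself: \<open>e\<close> plus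
    \<open>n\<close> times \<open>p\<close> is 1, which is the exponent condition for Hoelder's
    inequality in the new variable. The factor of the product with j = i is a power of
    \<open>F x\<close>, constant in that variable; with the power \<open>e\<close> that Hoelder's
    inequality produces, \<open>F x\<close> gets the exponent p + e required by the induction
    hypothesis on \<open>A\<close>.\<close>
  define e where "e = 1 - n * p"
  have e: "e \<ge> 0" using np by (simp add: e_def)
  have intG: "(\<integral>\<^sup>+y. G j x y \<partial>lborel) = (\<integral>\<^sup>+t. F (x(j := t)) \<partial>lborel)" if "j \<in> A" "x \<in> space ?M" for j x
  proof -
    have ij: "i \<noteq> j" using that nin by auto
    have 1: "(\<lambda>z. (x(j := snd z))(i := fst z)) \<in> measurable (lborel \<Otimes>\<^sub>M lborel) (Pi\<^sub>M (insert i A) (\<lambda>_. lborel))"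
      by (rule measurable_fun_upd[where J=A])
        (use that in \<open>auto intro!: measurable_fun_upd[where J=A]\<close>)
    have "(\<lambda>z. f ((x(j := snd z))(i := fst z))) \<in> borel_measurable (lborel \<Otimes>\<^sub>M lborel)"
      by (rule measurable_compose[OF 1]) measurable
    then have "(\<integral>\<^sup>+y. \<integral>\<^sup>+t. f (x(j := t, i := y)) \<partial>lborel \<partial>lborel) = (\<integral>\<^sup>+t. \<integral>\<^sup>+y. f (x(j := t, i := y)) \<partial>lborel \<partial>lborel)"
      by (intro lborel_pair.Fubini'[symmetric]) (simp add: case_prod_unfold)
    then show ?thesis unfolding G_def F_def using ij by (simp add: fun_upd_twist)
  qed
  have "(\<integral>\<^sup>+x. epowr (f x) (1 - (real (card (insert i A)) - 1) * p) *
      (\<Prod>j\<in>insert i A. epowr (\<integral>\<^sup>+t. f (x(j := t)) \<partial>lborel) p) \<partial>Pi\<^sub>M (insert i A) (\<lambda>_. lborel))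
    = (\<integral>\<^sup>+x. \<integral>\<^sup>+y. epowr (f (x(i := y))) e * (\<Prod>j\<in>insert i A. epowr (\<integral>\<^sup>+t. f (x(i := y, j := t)) \<partial>lborel) p) \<partial>lborel \<partial>?M)"
    unfolding card e_def[symmetric]
  proof (rule product_nn_integral_insert[OF fin nin])
    have "(\<lambda>x. \<integral>\<^sup>+t. f (x(j := t)) \<partial>lborel) \<in> borel_measurable (Pi\<^sub>M (insert i A) (\<lambda>_. lborel))" if "j \<in> insert i A" for j
    proof -
      have 1: "(\<lambda>z. (fst z)(j := snd z)) \<in> measurable (Pi\<^sub>M (insert i A) (\<lambda>_. lborel) \<Otimes>\<^sub>M lborel) (Pi\<^sub>M (insert i A) (\<lambda>_. lborel))"
        by (rule measurable_fun_upd[where J="insert i A"]) (use that in auto)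
      show ?thesis
        by (rule lborel.borel_measurable_nn_integral)
          (use measurable_compose[OF 1 insert.prems(2)] in \<open>simp add: case_prod_unfold fun_upd_def\<close>)
    qed
    then show "(\<lambda>x. epowr (f x) e * (\<Prod>j\<in>insert i A. epowr (\<integral>\<^sup>+t. f (x(j := t)) \<partial>lborel) p))
        \<in> borel_measurable (Pi\<^sub>M (insert i A) (\<lambda>_. lborel))"
      by (intro borel_measurable_times_ennreal borel_measurable_prod_ennreal epowr_measurable insert.prems(2)) auto
  qed
  also have "\<dots> = (\<integral>\<^sup>+x. \<integral>\<^sup>+y. epowr (F x) p * (epowr (f (x(i := y))) e * (\<Prod>j\<in>A. epowr (G j x y) p)) \<partial>lborel \<partial>?M)"
    using fin nin by (intro nn_integral_cong) (auto simp: F_def G_def mult_ac)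
  also have "\<dots> \<le> (\<integral>\<^sup>+x. epowr (F x) (1 - (real (card A) - 1) * p) * (\<Prod>j\<in>A. epowr (\<integral>\<^sup>+t. F (x(j := t)) \<partial>lborel) p) \<partial>?M)"
  proof (rule nn_integral_mono)
    fix x assume x: "x \<in> space ?M"
    have fx [measurable]: "(\<lambda>y. f (x(i := y))) \<in> borel_measurable lborel"
      using measurable_Pair2[OF upd x] by simp
    have Gx [measurable]: "G j x \<in> borel_measurable lborel" if "j \<in> A" for j
      using measurable_Pair2[OF G[OF that] x] by simp
    have Hx: "(\<integral>\<^sup>+y. epowr (f (x(i := y))) e * (\<Prod>j\<in>A. epowr (G j x y) p) \<partial>lborel) \<le>
      epowr (F x) e * (\<Prod>j\<in>A. epowr (\<integral>\<^sup>+t. F (x(j := t)) \<partial>lborel) p)"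
    proof -
      \<comment> \<open>Since \<open>i\<close> is not in \<open>A\<close>, it can serve as the index
        of the factor \<open>f\<close>, with exponent \<open>e\<close>, beside the factors
        \<open>G j\<close> with exponent \<open>p\<close>.\<close>
      have H: "(\<integral>\<^sup>+y. (\<Prod>j\<in>insert i A. epowr (if j = i then f (x(i := y)) else G j x y) (if j = i then e else p)) \<partial>lborel)
        \<le> (\<Prod>j\<in>insert i A. epowr (\<integral>\<^sup>+y. (if j = i then f (x(i := y)) else G j x y) \<partial>lborel) (if j = i then e else p))"
      proof (rule Hoelder_nn_integral)
        have "(\<Sum>j\<in>A. if j = i then e else p) = (\<Sum>j\<in>A. p)" using nin by (intro sum.cong) auto
        then show "(\<Sum>j\<in>insert i A. if j = i then e else p) = 1"
          using fin nin by (simp add: e_def n_def)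
      qed (use fin e assms(2) Gx in auto)
      have P: "(\<Prod>j\<in>A. epowr (if j = i then a else b j) (if j = i then e else p)) = (\<Prod>j\<in>A. epowr (b j) p)" for a b
        using nin by (intro prod.cong) auto
      have Q: "(\<Prod>j\<in>A. epowr (\<integral>\<^sup>+y. (if j = i then f (x(i := y)) else G j x y) \<partial>lborel) (if j = i then e else p))
        = (\<Prod>j\<in>A. epowr (\<integral>\<^sup>+t. F (x(j := t)) \<partial>lborel) p)"
        using nin intG[OF _ x] by (intro prod.cong) auto
      show ?thesis using H unfolding prod.insert[OF fin nin] P Q by (simp add: F_def)
    qed
    have "(\<integral>\<^sup>+y. epowr (F x) p * (epowr (f (x(i := y))) e * (\<Prod>j\<in>A. epowr (G j x y) p)) \<partial>lborel)
      = epowr (F x) p * (\<integral>\<^sup>+y. epowr (f (x(i := y))) e * (\<Prod>j\<in>A. epowr (G j x y) p) \<partial>lborel)"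
      by (rule nn_integral_cmult) measurable
    also have "\<dots> \<le> epowr (F x) p * (epowr (F x) e * (\<Prod>j\<in>A. epowr (\<integral>\<^sup>+t. F (x(j := t)) \<partial>lborel) p))"
      by (intro mult_left_mono Hx) auto
    also have "\<dots> = epowr (F x) (p + e) * (\<Prod>j\<in>A. epowr (\<integral>\<^sup>+t. F (x(j := t)) \<partial>lborel) p)"
      using assms(2) e by (simp add: epowr_add mult.assoc)
    also have "p + e = 1 - (real (card A) - 1) * p" by (simp add: e_def n_def algebra_simps)
    finally show "(\<integral>\<^sup>+y. epowr (F x) p * (epowr (f (x(i := y))) e * (\<Prod>j\<in>A. epowr (G j x y) p)) \<partial>lborel) \<le>
      epowr (F x) (1 - (real (card A) - 1) * p) * (\<Prod>j\<in>A. epowr (\<integral>\<^sup>+t. F (x(j := t)) \<partial>lborel) p)" .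
  qed
  also have "\<dots> \<le> epowr (\<integral>\<^sup>+x. F x \<partial>?M) (1 + p)"
  proof (rule insert.IH[OF _ F])
    show "(real (card A) - 1) * p \<le> 1" using np assms(2) by (simp add: n_def algebra_simps)
  qed
  also have "(\<integral>\<^sup>+x. F x \<partial>?M) = (\<integral>\<^sup>+x. f x \<partial>Pi\<^sub>M (insert i A) (\<lambda>_. lborel))"
    unfolding F_def by (rule product_nn_integral_insert[OF fin nin, symmetric]) measurable
  finally show ?case .
qed

section \<open>The Sobolev inequality\<close>

text \<open>An exponent larger than 1 makes |g|^\<gamma> differentiable also at the zeros of g. The
  formula stays correct there, since \<open>sgn 0 = 0\<close> and the difference quotient is
  O(|g|^(\<gamma>-1)).\<close>

lemma norm_powr_has_derivative:
  fixes g :: "real \<Rightarrow> complex"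
  assumes g: "(g has_vector_derivative g') (at t)" and \<gamma>: "\<gamma> > 1"
  shows "((\<lambda>s. norm (g s) powr \<gamma>) has_real_derivative \<gamma> * norm (g t) powr (\<gamma> - 1) * (g' \<bullet> sgn (g t))) (at t)"
proof (cases "g t = 0")
  case False
  have "((\<lambda>s. norm (g s)) has_derivative (\<lambda>h. (h *\<^sub>R g') \<bullet> sgn (g t))) (at t)"
    by (rule has_derivative_compose[OF g[unfolded has_vector_derivative_def] has_derivative_norm[OF False]])
  moreover have "(\<lambda>h. (h *\<^sub>R g') \<bullet> sgn (g t)) = (*) (g' \<bullet> sgn (g t))" by (auto simp: mult.commute)
  ultimately have n: "((\<lambda>s. norm (g s)) has_real_derivative (g' \<bullet> sgn (g t))) (at t)"
    unfolding has_field_derivative_def by simp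
  show ?thesis
    using DERIV_chain2[OF has_real_derivative_powr[of "norm (g t)" \<gamma>] n] False by simp
next
  case True
  have cont: "isCont g t" using g has_vector_derivative_continuous by blast
  have "((\<lambda>y. norm (g y)) \<longlongrightarrow> 0) (at t)"
    using cont True tendsto_norm[of g "g t" "at t"] by (simp add: isCont_def)
  then have "((\<lambda>y. norm (g y) powr (\<gamma> - 1)) \<longlongrightarrow> 0 powr (\<gamma> - 1)) (at t)"
    using \<gamma> by (intro tendsto_powr2 tendsto_const) auto
  then have "((\<lambda>y. norm (g y) powr (\<gamma> - 1) * (norm g' + 1)) \<longlongrightarrow> 0 powr (\<gamma> - 1) * (norm g' + 1)) (at t)"
    by (intro tendsto_mult tendsto_const)
  then have l: "((\<lambda>y. norm (g y) powr (\<gamma> - 1) * (norm g' + 1)) \<longlongrightarrow> 0) (at t)"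
    using \<gamma> by simp
  obtain e where e: "e > 0" "\<And>y. norm (y - t) < e \<Longrightarrow> norm (g y - g t - (y - t) *\<^sub>R g') \<le> 1 * norm (y - t)"
    using g unfolding has_vector_derivative_def has_derivative_at_alt by (meson zero_less_one)
  have "((\<lambda>y. (norm (g y) powr \<gamma> - norm (g t) powr \<gamma>) / (y - t)) \<longlongrightarrow> 0) (at t)"
  proof (rule Lim_null_comparison[OF _ l])
    have "norm ((norm (g y) powr \<gamma> - norm (g t) powr \<gamma>) / (y - t)) \<le> norm (g y) powr (\<gamma> - 1) * (norm g' + 1)"
      if y: "norm (y - t) < e" "y \<noteq> t" for y
    proof -
      have "norm (g y) \<le> norm (g y - g t - (y - t) *\<^sub>R g') + norm ((y - t) *\<^sub>R g')"
        using True norm_triangle_ineq[of "g y - g t - (y - t) *\<^sub>R g'" "(y - t) *\<^sub>R g'"] by simp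
      also have "\<dots> \<le> 1 * \<bar>y - t\<bar> + \<bar>y - t\<bar> * norm g'" using e(2)[OF y(1)] by simp
      also have "\<dots> = (norm g' + 1) * \<bar>y - t\<bar>" by (simp add: distrib_left mult.commute)
      finally have "norm (g y) / \<bar>y - t\<bar> \<le> norm g' + 1" using y by (simp add: divide_le_eq)
      then have "norm (g y) powr (\<gamma> - 1) * (norm (g y) / \<bar>y - t\<bar>) \<le> norm (g y) powr (\<gamma> - 1) * (norm g' + 1)"
        by (intro mult_left_mono) auto
      moreover have "norm (g y) powr \<gamma> = norm (g y) powr (\<gamma> - 1) * norm (g y)"
        using powr_add[of "norm (g y)" "\<gamma> - 1" 1] by simp
      ultimately show ?thesis using True by simp
    qed
    then show "\<forall>\<^sub>F y in at t. norm ((norm (g y) powr \<gamma> - norm (g t) powr \<gamma>) / (y - t)) \<le> norm (g y) powr (\<gamma> - 1) * (norm g' + 1)"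
      unfolding eventually_at using e(1) by (auto simp: dist_norm)
  qed
  then show ?thesis using True by (simp add: has_field_derivative_iff)
qed

text \<open>The fundamental theorem of calculus for |g|^\<gamma>, started at a zero of g; the
  integral over [a, s] is then enlarged to the whole line.\<close>

lemma line_power_estimate:
  fixes g :: "real \<Rightarrow> complex"
  assumes g: "\<And>t. (g has_vector_derivative g' t) (at t)" and g': "continuous_on UNIV g'"
    and \<gamma>: "\<gamma> > 1" and a: "g a = 0" "a \<le> s"
  shows "ennreal (norm (g s) powr \<gamma>) \<le> (\<integral>\<^sup>+t. ennreal (\<gamma> * norm (g t) powr (\<gamma> - 1) * norm (g' t)) \<partial>lborel)"
proof -
  let ?k = "\<lambda>t. \<gamma> * norm (g t) powr (\<gamma> - 1) * norm (g' t)"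
  have gc: "continuous_on UNIV g"
    using has_vector_derivative_continuous[OF g] by (simp add: continuous_at_imp_continuous_on)
  have "continuous_on UNIV ?k"
    using \<gamma> by (intro continuous_on_mult continuous_on_norm continuous_on_const continuous_on_powr' gc g') auto
  then have "?k integrable_on {a..s}"
    by (rule integrable_continuous_real[OF continuous_on_subset]) simp
  then obtain I where I: "(?k has_integral I) {a..s}" by blast
  have h: "((\<lambda>t. \<gamma> * norm (g t) powr (\<gamma> - 1) * (g' t \<bullet> sgn (g t))) has_integral
      norm (g s) powr \<gamma> - norm (g a) powr \<gamma>) {a..s}"
    by (rule fundamental_theorem_of_calculus[OF a(2)], rule has_vector_derivative_at_within,
      rule norm_powr_has_derivative[OF g \<gamma>, unfolded has_real_derivative_iff_has_vector_derivative])
  have "norm (g s) powr \<gamma> - norm (g a) powr \<gamma> \<le> I"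
  proof (rule has_integral_le[OF h I])
    fix t
    have "g' t \<bullet> sgn (g t) \<le> norm (g' t) * norm (sgn (g t))" by (rule norm_cauchy_schwarz)
    also have "\<dots> \<le> norm (g' t)" by (simp add: norm_sgn)
    finally show "\<gamma> * norm (g t) powr (\<gamma> - 1) * (g' t \<bullet> sgn (g t)) \<le> ?k t"
      using \<gamma> by (intro mult_left_mono) auto
  qed
  then have "ennreal (norm (g s) powr \<gamma>) \<le> ennreal I" using a \<gamma> by (intro ennreal_leI) auto
  also have "ennreal I = (\<integral>\<^sup>+t. ennreal (?k t) * indicator {a..s} t \<partial>lborel)"
    using I \<gamma> by (intro nn_integral_has_integral_lebesgue'[symmetric]) auto
  also have "\<dots> \<le> (\<integral>\<^sup>+t. ennreal (?k t) \<partial>lborel)"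
    by (intro nn_integral_mono) (auto simp: indicator_def)
  finally show ?thesis .
qed

definition grad_norm :: "(real^'n::finite \<Rightarrow> complex) \<Rightarrow> real^'n \<Rightarrow> real" where
  "grad_norm u x = (\<Sum>i\<in>UNIV. norm (D i u x))"

lemma grad_norm_nonneg: "grad_norm u x \<ge> 0"
  by (simp add: grad_norm_def sum_nonneg)

lemma grad_norm_borel:
  fixes u :: "real^'n::finite \<Rightarrow> complex"
  assumes u: "u \<in> test_functions \<Omega>"
  shows "grad_norm u \<in> borel_measurable borel"
proof -
  have [measurable]: "D i u \<in> borel_measurable borel" for i using test_borel[OF test_D[OF u]] .
  show ?thesis unfolding grad_norm_def by measurable
qed

lemma coordinate_line_estimate:
  fixes u :: "real^'n::finite \<Rightarrow> complex"
  assumes u: "u \<in> test_functions UNIV" and \<gamma>: "\<gamma> > 1" and b: "b \<in> Basis"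
  shows "ennreal (norm (u x) powr \<gamma>) \<le> (\<integral>\<^sup>+t. ennreal (\<gamma> * norm (u (x + (t - x \<bullet> b) *\<^sub>R b)) powr (\<gamma> - 1) *
     grad_norm u (x + (t - x \<bullet> b) *\<^sub>R b)) \<partial>lborel)"
proof -
  define l where "l t = x + (t - x \<bullet> b) *\<^sub>R b" for t
  from b obtain i where i: "b = axis i 1" by (auto simp: Basis_vec_def)
  from u obtain K where K: "compact K" "\<And>x. x \<notin> K \<Longrightarrow> u x = 0" by (rule test_functionsE) auto
  from compact_imp_bounded[OF K(1)] obtain R where R: "\<And>x. x \<in> K \<Longrightarrow> norm x \<le> R" unfolding bounded_iff by blast
  \<comment> \<open>The parameter of \<open>l\<close> is the coordinate along \<open>b\<close>. This
    value lies to the left of that of \<open>x\<close> and exceeds \<open>R\<close> in modulus, so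
    \<open>l a\<close> is off the support of \<open>u\<close>.\<close>
  define a where "a = - \<bar>R\<bar> - 1 - \<bar>x \<bullet> b\<bar>"
  have "l a \<bullet> b = a" using b by (simp add: l_def inner_add_left inner_diff_left)
  then have "norm (l a) \<ge> \<bar>a\<bar>" using Basis_le_norm[OF b, of "l a"] by simp
  then have la: "u (l a) = 0" using R[of "l a"] K(2)[of "l a"] by (force simp: a_def)
  define g' where "g' t = frechet_derivative u (at (l t)) b" for t
  have lc: "continuous_on UNIV l" unfolding l_def by (intro continuous_intros)
  have "(l has_derivative (\<lambda>h. h *\<^sub>R b)) (at t)" for t
    unfolding l_def by (auto intro!: derivative_eq_intros simp: scaleR_diff_left)
  from has_derivative_compose[OF this] 
  have d: "((\<lambda>t. u (l t)) has_derivative (\<lambda>h. frechet_derivative u (at (l t)) (h *\<^sub>R b))) (at t)" for t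
    using test_differentiable[OF u] frechet_derivative_works by blast
  have lin: "linear (frechet_derivative u (at z))" for z
    using test_differentiable[OF u] frechet_derivative_works has_derivative_linear by blast
  have dv: "((\<lambda>t. u (l t)) has_vector_derivative g' t) (at t)" for t
    using d[of t] unfolding has_vector_derivative_def g'_def by (simp add: linear_scale[OF lin])
  have "continuous_on UNIV g'" unfolding g'_def
    using continuous_on_compose2[OF test_continuous[OF test_deriv[OF u]] lc] by simp
  from line_power_estimate[OF dv this \<gamma> la, of "x \<bullet> b"]
  have "ennreal (norm (u x) powr \<gamma>) \<le> (\<integral>\<^sup>+t. ennreal (\<gamma> * norm (u (l t)) powr (\<gamma> - 1) * norm (g' t)) \<partial>lborel)"
    by (simp add: l_def a_def)
  also have "\<dots> \<le> (\<integral>\<^sup>+t. ennreal (\<gamma> * norm (u (l t)) powr (\<gamma> - 1) * grad_norm u (l t)) \<partial>lborel)"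
  proof (intro nn_integral_mono ennreal_leI mult_left_mono)
    fix t
    have "norm (g' t) = norm (D i u (l t))" by (simp add: g'_def D_def i norm_mult)
    also have "\<dots> \<le> grad_norm u (l t)" unfolding grad_norm_def by (rule member_le_sum) auto
    finally show "norm (g' t) \<le> grad_norm u (l t)" .
  qed (use \<gamma> in auto)
  finally show ?thesis unfolding l_def .
qed

lemma nn_integral_lborel_Basis:
  fixes f :: "'a::euclidean_space \<Rightarrow> ennreal"
  assumes "f \<in> borel_measurable borel"
  shows "(\<integral>\<^sup>+x. f x \<partial>lborel) = (\<integral>\<^sup>+y. f (\<Sum>b\<in>Basis. y b *\<^sub>R b) \<partial>Pi\<^sub>M Basis (\<lambda>_. lborel))"
  by (subst lborel_eq) (rule nn_integral_distr, use assms in measurable)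

text \<open>The case p = 1/(n-1) of the grid-lines inequality: the power of \<open>f\<close> becomes
  0, and each of the n line integrals dominates \<open>W\<close>, so their product dominates
  W^(n/(n-1)). With \<open>f\<close> a gradient this is the Gagliardo-Nirenberg inequality.\<close>

lemma sobolev_L1:
  fixes W f :: "'a::euclidean_space \<Rightarrow> ennreal"
  assumes dim: "DIM('a) \<ge> 2" and [measurable]: "W \<in> borel_measurable borel" "f \<in> borel_measurable borel"
    and le: "\<And>x b. b \<in> Basis \<Longrightarrow> W x \<le> (\<integral>\<^sup>+t. f (x + (t - x \<bullet> b) *\<^sub>R b) \<partial>lborel)"
  shows "(\<integral>\<^sup>+x. epowr (W x) (DIM('a) / (DIM('a) - 1)) \<partial>lborel) \<le> epowr (\<integral>\<^sup>+x. f x \<partial>lborel) (DIM('a) / (DIM('a) - 1))"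
proof -
  define \<Phi> where "\<Phi> y = (\<Sum>b\<in>Basis. y b *\<^sub>R b :: 'a)" for y
  define p where "p = 1 / (real DIM('a) - 1)"
  have p: "p > 0" "(real DIM('a) - 1) * p = 1" "1 + p = DIM('a) / (DIM('a) - 1)" "DIM('a) * p = DIM('a) / (DIM('a) - 1)"
    using dim by (auto simp: p_def field_simps of_nat_diff)
  have [measurable]: "\<Phi> \<in> measurable (Pi\<^sub>M Basis (\<lambda>_. lborel)) borel" unfolding \<Phi>_def by measurable
  have upd: "\<Phi> (y(b := t)) = \<Phi> y + (t - \<Phi> y \<bullet> b) *\<^sub>R b" if "b \<in> Basis" for y b t
  proof (rule euclidean_eqI)
    fix c :: 'a assume "c \<in> Basis"
    then show "\<Phi> (y(b := t)) \<bullet> c = (\<Phi> y + (t - \<Phi> y \<bullet> b) *\<^sub>R b) \<bullet> c"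
      using that by (simp add: \<Phi>_def inner_sum_left inner_Basis if_distrib[of "\<lambda>z. _ * z"] sum.If_cases inner_add_left)
  qed
  have "(\<integral>\<^sup>+x. epowr (W x) (DIM('a) / (DIM('a) - 1)) \<partial>lborel)
    = (\<integral>\<^sup>+y. epowr (W (\<Phi> y)) (DIM('a) * p) \<partial>Pi\<^sub>M Basis (\<lambda>_. lborel))"
    unfolding p(4) \<Phi>_def by (subst nn_integral_lborel_Basis) auto
  also have "\<dots> \<le> (\<integral>\<^sup>+y. epowr (f (\<Phi> y)) (1 - (real DIM('a) - 1) * p) *
      (\<Prod>b\<in>Basis. epowr (\<integral>\<^sup>+t. f (\<Phi> (y(b := t))) \<partial>lborel) p) \<partial>Pi\<^sub>M Basis (\<lambda>_. lborel))"
  proof (rule nn_integral_mono)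
    fix y
    have "epowr (W (\<Phi> y)) (DIM('a) * p) = epowr (W (\<Phi> y)) (p * of_nat (card (Basis :: 'a set)))" by (simp add: mult.commute)
    also have "\<dots> = (\<Prod>b\<in>(Basis::'a set). epowr (W (\<Phi> y)) p)"
    proof -
      have "epowr z (p * real n) = epowr z p ^ n" for z n
        using p(1) by (induction n) (auto simp: epowr_add distrib_left mult.commute)
      then show ?thesis by simp
    qed
    also have "\<dots> \<le> (\<Prod>b\<in>Basis. epowr (\<integral>\<^sup>+t. f (\<Phi> (y(b := t))) \<partial>lborel) p)"
      using p(1) le by (intro prod_mono_ennreal epowr_mono) (auto simp: upd)
    finally show "epowr (W (\<Phi> y)) (DIM('a) * p) \<le> epowr (f (\<Phi> y)) (1 - (real DIM('a) - 1) * p) *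
      (\<Prod>b\<in>Basis. epowr (\<integral>\<^sup>+t. f (\<Phi> (y(b := t))) \<partial>lborel) p)" by (simp add: p(2))
  qed
  also have "\<dots> \<le> epowr (\<integral>\<^sup>+y. f (\<Phi> y) \<partial>Pi\<^sub>M Basis (\<lambda>_. lborel)) (1 + p)"
    using grid_lines_inequality[of "Basis :: 'a set" p "\<lambda>y. f (\<Phi> y)"] p by simp
  also have "(\<integral>\<^sup>+y. f (\<Phi> y) \<partial>Pi\<^sub>M Basis (\<lambda>_. lborel)) = (\<integral>\<^sup>+x. f x \<partial>lborel)"
    unfolding \<Phi>_def by (subst nn_integral_lborel_Basis) auto
  finally show ?thesis unfolding p(3) .
qed

lemma nn_integral_test_powr_finite:
  fixes u :: "real^'n::finite \<Rightarrow> complex"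
  assumes u: "u \<in> test_functions \<Omega>" and p: "p > 0"
  shows "(\<integral>\<^sup>+x. ennreal (norm (u x) powr p) \<partial>lborel) < \<infinity>"
proof -
  from u obtain K where K: "compact K" "\<And>x. x \<notin> K \<Longrightarrow> u x = 0" by (rule test_functionsE) auto
  from test_bounded[OF u] obtain B where B: "B > 0" "\<And>x. norm (u x) \<le> B" by blast
  have "(\<integral>\<^sup>+x. ennreal (norm (u x) powr p) \<partial>lborel) \<le> (\<integral>\<^sup>+x. ennreal (B powr p) * indicator K x \<partial>lborel)"
    using K B p by (intro nn_integral_mono) (auto simp: indicator_def intro!: ennreal_leI powr_mono2)
  also have "\<dots> = ennreal (B powr p) * emeasure lborel K"
    using K(1) by (intro nn_integral_cmult_indicator) (auto simp: compact_imp_closed)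
  also have "\<dots> < \<infinity>"
    using emeasure_compact_finite[OF K(1)] by (simp add: ennreal_mult_less_top)
  finally show ?thesis .
qed

text \<open>The $L^1$ inequality is applied to $|u|^\gamma$ with $\gamma = 2(n-1)/(n-2)$, for which
  $\gamma n/(n-1) = 2(\gamma-1) = 2n/(n-2)$, so that half of the right-hand side can be absorbed.\<close>

lemma sobolev_test:
  fixes u :: "real^'n::finite \<Rightarrow> complex"
  assumes dim: "CARD('n) > 2" and u: "u \<in> test_functions \<Omega>"
  defines "d \<equiv> real CARD('n)"
  defines "s \<equiv> 2 * d / (d - 2)"
  defines "\<gamma> \<equiv> 2 * (d - 1) / (d - 2)"
  shows "(\<integral>\<^sup>+x. ennreal (norm (u x) powr s) \<partial>lborel) \<le>
    epowr (ennreal (\<gamma>\<^sup>2) * (\<integral>\<^sup>+x. ennreal ((grad_norm u x)\<^sup>2) \<partial>lborel)) (d / (d - 2))"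
proof -
  have d: "d > 2" using dim by (simp add: d_def)
  have \<gamma>: "\<gamma> > 1" using d by (simp add: \<gamma>_def field_simps)
  have "\<gamma> * (d / (d - 1)) = (d - 1) / (d - 1) * s"
    unfolding \<gamma>_def s_def by (simp only: times_divide_times_eq mult_ac)
  then have s: "s > 0" "\<gamma> * (d / (d - 1)) = s" "2 * (\<gamma> - 1) = s" using d by (auto simp: \<gamma>_def s_def field_simps)
  note u = test_UNIV[OF u]
  have [measurable]: "u \<in> borel_measurable borel" "grad_norm u \<in> borel_measurable borel"
    using test_borel[OF u] grad_norm_borel[OF u] by auto
  define A where "A = (\<integral>\<^sup>+x. ennreal (norm (u x) powr s) \<partial>lborel)"
  define B where "B = (\<integral>\<^sup>+x. ennreal ((grad_norm u x)\<^sup>2) \<partial>lborel)"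
  define I where "I = (\<integral>\<^sup>+x. ennreal (\<gamma> * norm (u x) powr (\<gamma> - 1) * grad_norm u x) \<partial>lborel)"
  define r where "r = d / (d - 1)"
  have r: "r > 0" "r / 2 \<ge> 0" "r / 2 < 1" using d by (auto simp: r_def field_simps)
  have "I = (\<integral>\<^sup>+x. ennreal \<gamma> * (epowr (ennreal (norm (u x) powr s)) (1/2) * epowr (ennreal ((grad_norm u x)\<^sup>2)) (1/2)) \<partial>lborel)"
    unfolding I_def
  proof (rule nn_integral_cong)
    fix x
    have "epowr (ennreal (norm (u x) powr s)) (1/2) = ennreal (norm (u x) powr (\<gamma> - 1))"
    proof -
      have "s * (1/2) = \<gamma> - 1" using s(3) by simp
      then show ?thesis by (simp only: epowr_ennreal powr_ge_zero powr_powr)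
    qed
    moreover have "epowr (ennreal ((grad_norm u x)\<^sup>2)) (1/2) = ennreal (grad_norm u x)"
      using grad_norm_nonneg[of u x] by (simp add: epowr_ennreal powr_half_sqrt)
    ultimately show "ennreal (\<gamma> * norm (u x) powr (\<gamma> - 1) * grad_norm u x) =
      ennreal \<gamma> * (epowr (ennreal (norm (u x) powr s)) (1/2) * epowr (ennreal ((grad_norm u x)\<^sup>2)) (1/2))"
      using \<gamma> grad_norm_nonneg[of u x] by (simp add: ennreal_mult[symmetric] mult.assoc)
  qed
  also have "\<dots> = ennreal \<gamma> * (\<integral>\<^sup>+x. epowr (ennreal (norm (u x) powr s)) (1/2) * epowr (ennreal ((grad_norm u x)\<^sup>2)) (1/2) \<partial>lborel)"
    by (rule nn_integral_cmult) measurable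
  also have "\<dots> \<le> ennreal \<gamma> * (epowr A (1/2) * epowr B (1/2))"
    unfolding A_def B_def by (intro mult_left_mono Hoelder2) auto
  finally have I: "I \<le> ennreal \<gamma> * (epowr A (1/2) * epowr B (1/2))" .
  have "A = (\<integral>\<^sup>+x. epowr (ennreal (norm (u x) powr \<gamma>)) (DIM(real^'n) / (DIM(real^'n) - 1)) \<partial>lborel)"
    unfolding A_def
  proof (rule nn_integral_cong)
    fix x
    have "DIM(real^'n) / (DIM(real^'n) - 1) = d / (d - 1)" using dim by (simp add: d_def of_nat_diff)
    then show "ennreal (norm (u x) powr s) = epowr (ennreal (norm (u x) powr \<gamma>)) (DIM(real^'n) / (DIM(real^'n) - 1))"
      using d s(2) by (simp add: epowr_ennreal powr_powr)
  qed
  also have "\<dots> \<le> epowr I (DIM(real^'n) / (DIM(real^'n) - 1))"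
    unfolding I_def
    by (rule sobolev_L1[OF _ _ _ coordinate_line_estimate[OF u \<gamma>]]) (use dim in auto)
  also have "DIM(real^'n) / (DIM(real^'n) - 1) = r" using dim by (simp add: d_def r_def of_nat_diff)
  also have "epowr I r \<le> epowr (ennreal \<gamma> * (epowr A (1/2) * epowr B (1/2))) r"
    using I r by (intro epowr_mono) auto
  also have "\<dots> = epowr A (r/2) * epowr (ennreal (\<gamma>\<^sup>2) * B) (r/2)"
  proof -
    have "ennreal (\<gamma>\<^sup>2) = epowr (ennreal \<gamma>) 2" using \<gamma> by (simp add: epowr_ennreal powr_numeral)
    then show ?thesis using r by (simp add: epowr_mult epowr_epowr mult_ac)
  qed
  finally have le: "A \<le> epowr A (r/2) * epowr (ennreal (\<gamma>\<^sup>2) * B) (r/2)" .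
  \<comment> \<open>In \<open>le\<close> the unknown \<open>A\<close> occurs on both sides, on the
    right to the power r/2 < 1 because d > 2. Division by this power needs \<open>A\<close> to be
    finite, which holds for a test function whatever the size of its gradient.\<close>
  have fin: "A < \<infinity>" unfolding A_def by (rule nn_integral_test_powr_finite[OF u s(1)])
  have "A \<le> epowr (ennreal (\<gamma>\<^sup>2) * B) (d / (d - 2))"
  proof (cases "A = 0")
    case False
    have A: "epowr A (r/2) \<noteq> 0" "epowr A (r/2) \<noteq> top" using False fin r by (auto simp: epowr_eq_0_iff epowr_eq_top_iff)
    have "A = epowr A (r/2 + (1 - r/2))" by simp
    also have "\<dots> = epowr A (r/2) * epowr A (1 - r/2)" using r by (intro epowr_add) auto
    finally have "epowr A (r/2) * epowr A (1 - r/2) \<le> epowr A (r/2) * epowr (ennreal (\<gamma>\<^sup>2) * B) (r/2)" using le by simp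
    then have "epowr A (1 - r/2) \<le> epowr (ennreal (\<gamma>\<^sup>2) * B) (r/2)"
      using A by (simp add: ennreal_mult_le_mult_iff)
    then have "epowr (epowr A (1 - r/2)) (1 / (1 - r/2)) \<le> epowr (epowr (ennreal (\<gamma>\<^sup>2) * B) (r/2)) (1 / (1 - r/2))"
      using r by (intro epowr_mono) auto
    moreover have "(r/2) * (1 / (1 - r/2)) = d / (d - 2)"
    proof -
      have 1: "1 - r/2 = (d - 2) / (2 * (d - 1))" "r/2 = d / (2 * (d - 1))"
        using d by (simp_all add: r_def field_simps)
      have 2: "x / y * (1 / (z / y)) = x / z" if "y \<noteq> 0" for x y z :: real using that by simp
      show ?thesis unfolding 1(1) unfolding 1(2) by (rule 2) (use d in simp)
    qed
    moreover have "(1 - r/2) * (1 / (1 - r/2)) = 1" using r by simp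
    ultimately show ?thesis unfolding epowr_epowr by simp
  qed simp
  then show ?thesis unfolding A_def B_def .
qed

section \<open>Mollifiers and approximation\<close>

text \<open>The p-th power of the L^p norm, without the root and with values in [0, \<infinity>]: no
  finiteness has to be known in order to state an estimate.\<close>

definition Lpow :: "real \<Rightarrow> (real^'n::finite \<Rightarrow> complex) \<Rightarrow> ennreal" where
  "Lpow p f = (\<integral>\<^sup>+x. ennreal (norm (f x) powr p) \<partial>lborel)"

text \<open>Crude, since a + b is at most twice the maximum, but valid for every p > 0 and free of
  roots. The powers of 2 in the later estimates come from here.\<close>

lemma powr_add_le:
  fixes a b p :: real
  assumes "0 \<le> a" "0 \<le> b" "0 < p"
  shows "(a + b) powr p \<le> 2 powr p * (a powr p + b powr p)"
proof -
  have "(a + b) powr p \<le> (2 * max a b) powr p" using assms by (intro powr_mono2) auto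
  also have "\<dots> = 2 powr p * (max a b powr p)" using assms by (simp add: powr_mult)
  also have "max a b powr p \<le> a powr p + b powr p" by (simp add: max_def)
  finally show ?thesis by simp
qed

lemma Lpow_mono: "0 < p \<Longrightarrow> (\<And>x. norm (f x) \<le> norm (g x)) \<Longrightarrow> Lpow p f \<le> Lpow p g"
  unfolding Lpow_def by (intro nn_integral_mono ennreal_leI powr_mono2) auto

lemma Lpow_add_le:
  assumes p: "0 < p" and [measurable]: "f \<in> borel_measurable borel" "g \<in> borel_measurable borel"
  shows "Lpow p (\<lambda>x. f x + g x) \<le> ennreal (2 powr p) * (Lpow p f + Lpow p g)"
proof -
  have "Lpow p (\<lambda>x. f x + g x) \<le> (\<integral>\<^sup>+x. ennreal (2 powr p) * (ennreal (norm (f x) powr p) + ennreal (norm (g x) powr p)) \<partial>lborel)"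
    unfolding Lpow_def
  proof (rule nn_integral_mono)
    fix x
    have "norm (f x + g x) powr p \<le> (norm (f x) + norm (g x)) powr p"
      using p by (intro powr_mono2 norm_triangle_ineq) auto
    also have "\<dots> \<le> 2 powr p * (norm (f x) powr p + norm (g x) powr p)" using p by (intro powr_add_le) auto
    finally show "ennreal (norm (f x + g x) powr p) \<le> ennreal (2 powr p) * (ennreal (norm (f x) powr p) + ennreal (norm (g x) powr p))"
      by (simp add: ennreal_plus[symmetric] ennreal_mult[symmetric] del: ennreal_plus)
  qed
  also have "\<dots> = ennreal (2 powr p) * (Lpow p f + Lpow p g)"
    unfolding Lpow_def by (simp add: nn_integral_cmult nn_integral_add)
  finally show ?thesis .
qed

lemma nn_integral_lborel_affine:
  fixes f :: "'a::euclidean_space \<Rightarrow> ennreal"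
  assumes [measurable]: "f \<in> borel_measurable borel" and c: "c \<noteq> 0"
  shows "(\<integral>\<^sup>+x. f x \<partial>lborel) = ennreal (\<bar>c\<bar> ^ DIM('a)) * (\<integral>\<^sup>+x. f (t + c *\<^sub>R x) \<partial>lborel)"
  by (subst lborel_affine[OF c, of t]) (simp add: nn_integral_density nn_integral_distr nn_integral_cmult)

lemma nn_integral_reflect:
  fixes f :: "'a::euclidean_space \<Rightarrow> ennreal"
  assumes "f \<in> borel_measurable borel"
  shows "(\<integral>\<^sup>+y. f (x - y) \<partial>lborel) = (\<integral>\<^sup>+x. f x \<partial>lborel)"
  using nn_integral_lborel_affine[OF assms, of "-1" x] by simp

lemma nn_integral_shift:
  fixes f :: "'a::euclidean_space \<Rightarrow> ennreal"
  assumes "f \<in> borel_measurable borel"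
  shows "(\<integral>\<^sup>+x. f (x - y) \<partial>lborel) = (\<integral>\<^sup>+x. f x \<partial>lborel)"
  using nn_integral_lborel_affine[OF assms, of 1 "- y"] by simp

lemma integral_reflect:
  fixes f :: "'a::euclidean_space \<Rightarrow> complex"
  assumes [measurable]: "f \<in> borel_measurable borel"
  shows "(LINT y|lborel. f (x - y)) = (LINT y|lborel. f y)"
  by (subst (2) lborel_affine[of "-1" x]) (auto simp: density_1 integral_distr)

lemma integrable_test:
  assumes "\<eta> \<in> test_functions \<Omega>"
  shows "integrable lborel \<eta>"
proof -
  have "Lpow 1 \<eta> < \<infinity>" unfolding Lpow_def by (rule nn_integral_test_powr_finite[OF assms]) simp
  then show ?thesis using test_borel[OF assms] by (simp add: integrable_iff_bounded Lpow_def)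
qed

text \<open>Convolution of \<eta> with the indicator of a large ball is constant near 0, equal to
  the integral of \<eta>. Its derivative at 0 is therefore 0, and it is also the integral of the
  derivative of \<eta>. This takes the place of an iterated integration.\<close>

lemma integral_D_test:
  fixes \<eta> :: "real^'n::finite \<Rightarrow> complex"
  assumes \<eta>: "\<eta> \<in> test_functions \<Omega>"
  shows "(LINT x|lborel. D j \<eta> x) = 0"
proof -
  from \<eta> obtain K where K: "compact K" "\<And>x. x \<notin> K \<Longrightarrow> \<eta> x = 0" by (rule test_functionsE) auto
  from compact_imp_bounded[OF K(1)] obtain R where R: "\<And>x. x \<in> K \<Longrightarrow> norm x \<le> R" unfolding bounded_iff by blast
  define f :: "real^'n \<Rightarrow> complex" where "f y = of_real (indicator (cball 0 (R + 1)) y)" for y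
  have f: "integrable lborel f" unfolding f_def
    using emeasure_lborel_cball_finite[of "0::real^'n" "R + 1"]
    by (intro integrable_of_real) (simp add: integrable_indicator_iff)
  have eq: "conv \<zeta> f x = (LINT y|lborel. \<zeta> y)" if "\<And>z. z \<notin> K \<Longrightarrow> \<zeta> z = 0" "x \<in> ball 0 1" "\<zeta> \<in> borel_measurable borel" for \<zeta> x
  proof -
    have "\<zeta> (x - y) * f y = \<zeta> (x - y)" for y
    proof (cases "x - y \<in> K")
      case True
      have "norm y \<le> norm x + norm (x - y)" using norm_triangle_ineq4[of x "x - y"] by simp
      also have "\<dots> \<le> R + 1" using that(2) R[OF True] by simp
      finally show ?thesis by (simp add: f_def)
    qed (use that in auto)
    then show ?thesis unfolding conv_def using integral_reflect[OF that(3), of x] by (simp only:)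
  qed
  have "(LINT x|lborel. D j \<eta> x) = conv (D j \<eta>) f 0"
  proof (rule eq[symmetric])
    fix z assume "z \<notin> K"
    then show "D j \<eta> z = 0" unfolding D_def
      using frechet_derivative_zero_on[of "- K" z \<eta>] K compact_imp_closed[of K] by (simp add: open_Compl)
  qed (use test_borel[OF test_D[OF \<eta>]] in auto)
  also have "\<dots> = D j (conv \<eta> f) 0" by (rule D_conv[OF \<eta> f, symmetric])
  also have "\<dots> = D j (\<lambda>_. LINT y|lborel. \<eta> y) 0"
    by (rule D_cong[of "ball 0 1"]) (use eq[OF K(2)] test_borel[OF \<eta>] in auto)
  also have "\<dots> = 0" by (simp add: D_def)
  finally show ?thesis .
qed

section \<open>Mollifiers\<close>

definition mollifier :: "real \<Rightarrow> real \<Rightarrow> (real^'n::finite \<Rightarrow> complex) \<Rightarrow> bool" where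
  "mollifier A \<epsilon> \<rho> \<longleftrightarrow> \<rho> \<in> test_functions UNIV \<and> (\<forall>x. \<rho> x = of_real (norm (\<rho> x))) \<and>
     (\<forall>x. \<epsilon> \<le> norm x \<longrightarrow> \<rho> x = 0) \<and> (\<integral>\<^sup>+x. ennreal (norm (\<rho> x)) \<partial>lborel) = 1 \<and>
     (\<forall>x. norm (\<rho> x) \<le> A / \<epsilon> ^ CARD('n)) \<and> (\<forall>x j. norm (D j \<rho> x) \<le> A / \<epsilon> ^ Suc CARD('n))"

lemma bump_exists:
  obtains \<beta> :: "real^'n::finite \<Rightarrow> complex" where "\<beta> \<in> test_functions UNIV" "\<And>x. \<beta> x = of_real (norm (\<beta> x))"
    "\<And>x. 1 \<le> norm x \<Longrightarrow> \<beta> x = 0" "(\<integral>\<^sup>+x. ennreal (norm (\<beta> x)) \<partial>lborel) = 1"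
proof -
  \<comment> \<open>The standard bump exp(-1/(1-|x|^2)), smooth across the unit sphere because
    \<open>exp_recip\<close> is smooth at 0 and vanishes on the negative half-line.\<close>
  define b :: "real^'n \<Rightarrow> complex" where "b x = of_real (exp_recip 1 (1 - x \<bullet> x))" for x
  have "Ck_on k UNIV (\<lambda>x::real^'n. 1 + (- 1) * (x \<bullet> x))" for k
    by (intro Ck_on_add Ck_on_const Ck_on_mult Ck_on_inner_self) auto
  then have g: "Ck_on k UNIV (\<lambda>x::real^'n. 1 - x \<bullet> x)" for k by simp
  have sm: "smooth_on UNIV b" unfolding smooth_on_def b_def
    by (intro allI Ck_on_linear_image[OF bounded_linear_of_real] Ck_on_exp_recip g) auto
  have z: "b x = 0" if "1 \<le> norm x" for x
  proof -
    have "1 \<le> x \<bullet> x" using that power_mono[of 1 "norm x" 2] by (simp add: power2_norm_eq_inner)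
    then show ?thesis by (simp add: b_def exp_recip_def)
  qed
  have nn: "exp_recip 1 t \<ge> 0" for t by (simp add: exp_recip_def)
  have t: "b \<in> test_functions UNIV"
    by (rule test_functionsI[OF sm compact_cball[of 0 1]]) (auto intro!: z)
  have re: "b x = of_real (norm (b x))" for x using nn by (simp add: b_def)
  have pos: "b x \<noteq> 0" if "x \<in> ball 0 1" for x
  proof -
    have "x \<bullet> x < 1" using that power_strict_mono[of "norm x" 1 2] by (simp add: power2_norm_eq_inner)
    then show ?thesis by (simp add: b_def exp_recip_def)
  qed
  define I where "I = (LINT x|lborel. norm (b x))"
  have int: "integrable lborel (\<lambda>x. norm (b x))" using integrable_test[OF t] by simp
  have nnI: "(\<integral>\<^sup>+x. ennreal (norm (b x)) \<partial>lborel) = ennreal I"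
    unfolding I_def by (rule nn_integral_eq_integral[OF int]) simp
  have "I \<noteq> 0"
  proof
    assume "I = 0"
    then have "AE x in lborel. b x = 0"
      unfolding I_def using integral_nonneg_eq_0_iff_AE[OF int] by simp
    then have "emeasure lborel {x \<in> space lborel. \<not> b x = 0} = 0"
      using test_borel[OF t] by (subst AE_iff_measurable[OF _ refl, symmetric]) auto
    moreover have "emeasure lborel (ball (0::real^'n) 1) \<le> emeasure lborel {x \<in> space lborel. \<not> b x = 0}"
      by (rule emeasure_mono) (use pos test_borel[OF t] in auto)
    ultimately have "emeasure lborel (ball (0::real^'n) 1) = 0" by simp
    then show False using unit_ball_vol_pos[of "real CARD('n)"] by (simp add: emeasure_ball)
  qed
  moreover have "I \<ge> 0" unfolding I_def by (rule integral_nonneg_AE) simp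
  ultimately have I: "I > 0" by simp
  define \<beta> where "\<beta> x = of_real (1 / I) * b x" for x
  show ?thesis
  proof (rule that[of \<beta>])
    show "\<beta> \<in> test_functions UNIV" unfolding \<beta>_def by (rule test_cmult[OF t])
    show "\<beta> x = of_real (norm (\<beta> x))" for x
      unfolding \<beta>_def norm_mult using I re[of x] by (simp add: norm_divide)
    show "\<beta> x = 0" if "1 \<le> norm x" for x using z[OF that] by (simp add: \<beta>_def)
    have "(\<integral>\<^sup>+x. ennreal (norm (\<beta> x)) \<partial>lborel) = (\<integral>\<^sup>+x. ennreal (1 / I) * ennreal (norm (b x)) \<partial>lborel)"
      unfolding \<beta>_def norm_mult using I by (intro nn_integral_cong) (simp add: norm_divide ennreal_mult[symmetric])
    also have "\<dots> = ennreal (1 / I) * ennreal I"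
      unfolding nnI[symmetric] using test_borel[OF t] by (intro nn_integral_cmult) measurable
    also have "\<dots> = 1" using I by (simp add: ennreal_mult[symmetric])
    finally show "(\<integral>\<^sup>+x. ennreal (norm (\<beta> x)) \<partial>lborel) = 1" .
  qed
qed

text \<open>The scaled bumps \<epsilon>^(-n) \<beta>(x/\<epsilon>). The single constant
  \<open>A\<close>, independent of \<epsilon>, bounds them and their derivatives with the natural
  powers of 1/\<epsilon>; on this uniformity the commutator bounds rest.\<close>

lemma mollifier_exists:
  obtains A where "A > 0" "\<And>\<epsilon>. \<epsilon> > 0 \<Longrightarrow> \<exists>\<rho> :: real^'n::finite \<Rightarrow> complex. mollifier A \<epsilon> \<rho>"
proof -
  obtain \<beta> :: "real^'n \<Rightarrow> complex" where \<beta>: "\<beta> \<in> test_functions UNIV" "\<And>x. \<beta> x = of_real (norm (\<beta> x))"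
    "\<And>x. 1 \<le> norm x \<Longrightarrow> \<beta> x = 0" "(\<integral>\<^sup>+x. ennreal (norm (\<beta> x)) \<partial>lborel) = 1" by (rule bump_exists) auto
  note [measurable] = test_borel[OF \<beta>(1)]
  obtain B where B: "B > 0" "\<And>x. norm (\<beta> x) \<le> B" using test_bounded[OF \<beta>(1)] by blast
  have "\<forall>j. \<exists>B>0. \<forall>x. norm (D j \<beta> x) \<le> B" using test_bounded[OF test_D[OF \<beta>(1)]] by metis
  then obtain C where C: "\<And>j. C j > 0" "\<And>j x. norm (D j \<beta> x) \<le> C j" by metis
  define A where "A = B + (\<Sum>j\<in>UNIV. C j)"
  have CA: "C j \<le> A" for j
    using member_le_sum[of j UNIV C] C(1) B(1) unfolding A_def by (smt (verit, best) UNIV_I finite less_imp_le)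
  have BA: "B \<le> A" unfolding A_def using C(1) by (simp add: sum_nonneg less_imp_le)
  show ?thesis
  proof (rule that)
    show "A > 0" using BA B by simp
    fix \<epsilon> :: real assume \<epsilon>: "\<epsilon> > 0"
    let ?n = "CARD('n)"
    define c :: complex where "c = of_real (1 / \<epsilon> ^ ?n)"
    have c: "norm c = 1 / \<epsilon> ^ ?n" using \<epsilon> by (simp add: c_def norm_divide norm_power)
    define \<rho> where "\<rho> x = c * \<beta> (0 + (1 / \<epsilon>) *\<^sub>R x)" for x
    have "mollifier A \<epsilon> \<rho>" unfolding mollifier_def
    proof (intro conjI allI impI)
      have sm: "smooth_on UNIV (\<lambda>x. \<beta> (0 + (1 / \<epsilon>) *\<^sub>R x))" by (rule smooth_on_affine_compose[OF test_smooth[OF \<beta>(1)]])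
      show z: "\<rho> x = 0" if "\<epsilon> \<le> norm x" for x
        unfolding \<rho>_def using \<beta>(3)[of "(1 / \<epsilon>) *\<^sub>R x"] that \<epsilon> by simp
      show "\<rho> \<in> test_functions UNIV"
      proof (rule test_functionsI[OF _ compact_cball[of 0 \<epsilon>]])
        show "smooth_on UNIV \<rho>" unfolding \<rho>_def by (intro smooth_on_mult smooth_on_const sm) auto
      qed (auto intro!: z)
      show "\<rho> x = of_real (norm (\<rho> x))" for x
        unfolding \<rho>_def norm_mult c using \<beta>(2)[of "0 + (1 / \<epsilon>) *\<^sub>R x"] by (simp add: c_def)
      show "norm (\<rho> x) \<le> A / \<epsilon> ^ ?n" for x
        unfolding \<rho>_def norm_mult c using B(2)[of "0 + (1 / \<epsilon>) *\<^sub>R x"] BA \<epsilon> by (simp add: divide_right_mono)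
      show "norm (D j \<rho> x) \<le> A / \<epsilon> ^ Suc ?n" for x j
      proof -
        have "D j \<rho> x = c * D j (\<lambda>x. \<beta> (0 + (1 / \<epsilon>) *\<^sub>R x)) x" unfolding \<rho>_def
          by (rule D_cmult) (use smooth_on_differentiable[OF sm] in auto)
        also have "D j (\<lambda>x. \<beta> (0 + (1 / \<epsilon>) *\<^sub>R x)) x = of_real (1 / \<epsilon>) * D j \<beta> (0 + (1 / \<epsilon>) *\<^sub>R x)"
          by (rule D_affine[OF test_differentiable[OF \<beta>(1)]])
        finally have "norm (D j \<rho> x) = norm (D j \<beta> (0 + (1 / \<epsilon>) *\<^sub>R x)) / \<epsilon> ^ Suc ?n"
          using \<epsilon> c by (simp add: norm_mult norm_divide)
        also have "\<dots> \<le> A / \<epsilon> ^ Suc ?n"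
          using order_trans[OF C(2) CA] \<epsilon> by (intro divide_right_mono) auto
        finally show ?thesis .
      qed
      have "(\<integral>\<^sup>+x. ennreal (norm (\<rho> x)) \<partial>lborel) = (\<integral>\<^sup>+x. ennreal (1 / \<epsilon> ^ ?n) * ennreal (norm (\<beta> (0 + (1 / \<epsilon>) *\<^sub>R x))) \<partial>lborel)"
        unfolding \<rho>_def norm_mult c using \<epsilon> by (intro nn_integral_cong) (simp add: ennreal_mult[symmetric])
      also have "\<dots> = ennreal (1 / \<epsilon> ^ ?n) * (\<integral>\<^sup>+x. ennreal (norm (\<beta> (0 + (1 / \<epsilon>) *\<^sub>R x))) \<partial>lborel)"
        by (intro nn_integral_cmult) measurable
      also have "\<dots> = (\<integral>\<^sup>+x. ennreal (norm (\<beta> x)) \<partial>lborel)"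
        using \<epsilon> by (subst (2) nn_integral_lborel_affine[of _ "1 / \<epsilon>" 0]) (auto simp: power_divide)
      finally show "(\<integral>\<^sup>+x. ennreal (norm (\<rho> x)) \<partial>lborel) = 1" using \<beta>(4) by simp
    qed
    then show "\<exists>\<rho> :: real^'n \<Rightarrow> complex. mollifier A \<epsilon> \<rho>" by blast
  qed
qed

lemma mollifier_sequence:
  obtains A and \<rho> :: "nat \<Rightarrow> real^'n::finite \<Rightarrow> complex" where "A > 0" "\<And>m. mollifier A (1 / real (Suc m)) (\<rho> m)"
proof -
  obtain A where A: "A > 0" "\<And>\<epsilon>. \<epsilon> > 0 \<Longrightarrow> \<exists>\<rho> :: real^'n \<Rightarrow> complex. mollifier A \<epsilon> \<rho>"
    by (rule mollifier_exists) blast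
  have "\<forall>m. \<exists>\<rho> :: real^'n \<Rightarrow> complex. mollifier A (1 / real (Suc m)) \<rho>" using A(2) by simp
  then obtain \<rho> :: "nat \<Rightarrow> real^'n \<Rightarrow> complex" where \<rho>: "\<And>m. mollifier A (1 / real (Suc m)) (\<rho> m)" by metis
  show ?thesis by (rule that[OF A(1) \<rho>])
qed

section \<open>Approximation by continuous functions and continuity of translations in L^2\<close>

lemma L2_bounded_approx:
  fixes g :: "real^'n::finite \<Rightarrow> complex"
  assumes [measurable]: "g \<in> borel_measurable borel" and b: "\<And>x. norm (g x) \<le> B" and B: "0 < B"
    and supp: "\<And>x. R < norm x \<Longrightarrow> g x = 0" and e: "e > 0"
  obtains c where "continuous_on UNIV c" "\<And>x. R + 1 < norm x \<Longrightarrow> c x = 0" "Lpow 2 (\<lambda>x. g x - c x) < e"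
proof -
  have "g \<in> borel_measurable lebesgue" using assms(1) by (simp add: measurable_completion)
  then have "g measurable_on UNIV" by (rule lebesgue_measurable_imp_measurable_on) auto
  then obtain N h where N: "negligible N" and h: "\<And>m. continuous_on UNIV (h m)"
    "\<And>x. x \<notin> N \<Longrightarrow> (\<lambda>m. h m x) \<longlonglongrightarrow> g x" unfolding measurable_on_def by auto
  \<comment> \<open>The continuous approximants \<open>h m\<close> converge off a null set but need
    not be dominated. Projecting their values to the disc of radius \<open>B\<close> and multiplying
    by a continuous cutoff leaves the limit \<open>g\<close> unchanged and supplies an integrable
    majorant.\<close>
  define cl where "cl = closest_point (cball (0::complex) B)"
  have clc: "continuous_on UNIV cl" unfolding cl_def using B by (intro continuous_on_closest_point) auto
  have clb: "norm (cl z) \<le> B" for z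
    using closest_point_in_set[of "cball (0::complex) B" z] B by (auto simp: cl_def)
  have cls: "cl z = z" if "norm z \<le> B" for z unfolding cl_def using that by (intro closest_point_self) auto
  define q :: "real^'n \<Rightarrow> real" where "q x = max 0 (min 1 (R + 1 - norm x))" for x
  have qc: "continuous_on UNIV q" unfolding q_def by (intro continuous_intros)
  have q: "0 \<le> q x" "q x \<le> 1" "norm x \<le> R \<Longrightarrow> q x = 1" "R + 1 < norm x \<Longrightarrow> q x = 0" for x by (auto simp: q_def)
  define c where "c m x = of_real (q x) * cl (h m x)" for m x
  have cc: "continuous_on UNIV (c m)" for m unfolding c_def
    using continuous_on_compose2[OF clc h(1)] by (intro continuous_intros qc) auto
  have cm: "c m \<in> borel_measurable borel" for m using cc by (rule borel_measurable_continuous_onI)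
  have cb: "norm (c m x) \<le> B" for m x
    unfolding c_def norm_mult using mult_mono[OF q(2)[of x] clb[of "h m x"]] q(1)[of x] by simp
  have mu: "(\<lambda>x. ennreal (norm (g x - c i x) powr 2)) \<in> borel_measurable lborel" for i
  proof -
    note [measurable] = cm[of i]
    show ?thesis by measurable
  qed
  have mw: "(\<lambda>x. ennreal ((2 * B) powr 2) * indicator (cball 0 (R + 1)) x) \<in> borel_measurable (lborel :: (real^'n) measure)"
    by (intro borel_measurable_times_ennreal borel_measurable_const borel_measurable_indicator) simp
  have lim: "(\<lambda>m. \<integral>\<^sup>+x. ennreal (norm (g x - c m x) powr 2) \<partial>lborel) \<longlonglongrightarrow> (\<integral>\<^sup>+(x::real^'n). 0 \<partial>lborel)"
  proof (rule nn_integral_dominated_convergence[OF mu _ mw])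
    show "AE x in lborel. ennreal (norm (g x - c j x) powr 2) \<le> ennreal ((2 * B) powr 2) * indicator (cball 0 (R + 1)) x" for j
    proof (intro AE_I2)
      fix x :: "real^'n"
      have "norm (g x - c j x) \<le> 2 * B" using norm_triangle_ineq4[of "g x" "c j x"] b[of x] cb[of j x] by simp
      then have "norm (g x - c j x) powr 2 \<le> (2 * B) powr 2" by (intro powr_mono2) auto
      moreover have "g x - c j x = 0" if "\<not> norm x \<le> R + 1" using that q(4)[of x] supp[of x] by (simp add: c_def)
      ultimately show "ennreal (norm (g x - c j x) powr 2) \<le> ennreal ((2 * B) powr 2) * indicator (cball 0 (R + 1)) x"
        by (cases "norm x \<le> R + 1") (auto intro: ennreal_leI)
    qed
    have "(\<integral>\<^sup>+x. ennreal ((2 * B) powr 2) * indicator (cball (0::real^'n) (R + 1)) x \<partial>lborel) = ennreal ((2 * B) powr 2) * emeasure lborel (cball (0::real^'n) (R + 1))"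
      by (intro nn_integral_cmult_indicator) auto
    also have "\<dots> < \<infinity>" using emeasure_lborel_cball_finite[of "0::real^'n" "R + 1"] by (simp add: ennreal_mult_less_top)
    finally show "(\<integral>\<^sup>+x. ennreal ((2 * B) powr 2) * indicator (cball (0::real^'n) (R + 1)) x \<partial>lborel) < \<infinity>" .
    have "AE x in lborel. x \<notin> N"
      using N by (metis AE_not_in negligible_iff_null_sets AE_completion_iff)
    then show "AE x in lborel. (\<lambda>i. ennreal (norm (g x - c i x) powr 2)) \<longlonglongrightarrow> 0"
    proof eventually_elim
      case (elim x)
      have "isCont cl (g x)" using clc by (simp add: continuous_on_eq_continuous_at)
      then have "(\<lambda>m. cl (h m x)) \<longlonglongrightarrow> cl (g x)" by (rule isCont_tendsto_compose[OF _ h(2)[OF elim]])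
      then have "(\<lambda>m. c m x) \<longlonglongrightarrow> of_real (q x) * g x"
        unfolding c_def cls[OF b] by (intro tendsto_mult tendsto_const)
      moreover have "of_real (q x) * g x = g x" using q(3)[of x] supp[of x] by (cases "norm x \<le> R") auto
      ultimately have "(\<lambda>m. norm (g x - c m x)) \<longlonglongrightarrow> norm (g x - g x)"
        by (intro tendsto_norm tendsto_diff tendsto_const) simp
      then have "(\<lambda>m. norm (g x - c m x) powr 2) \<longlonglongrightarrow> 0 powr 2"
        by (intro tendsto_powr2 tendsto_const) auto
      then have "(\<lambda>m. ennreal (norm (g x - c m x) powr 2)) \<longlonglongrightarrow> ennreal 0"
        by (intro tendsto_ennrealI) simp
      then show ?case by simp
    qed
  qed simp
  then have "(\<lambda>m. Lpow 2 (\<lambda>x. g x - c m x)) \<longlonglongrightarrow> 0" by (simp add: Lpow_def)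
  from order_tendstoD(2)[OF this e] obtain m where "Lpow 2 (\<lambda>x. g x - c m x) < e"
    by (auto simp: eventually_sequentially)
  with that[OF cc] q(4) show ?thesis by (simp add: c_def)
qed

lemma L2_approx:
  fixes g :: "real^'n::finite \<Rightarrow> complex"
  assumes [measurable]: "g \<in> borel_measurable borel" and fin: "Lpow 2 g < \<infinity>" and e: "e > 0"
  obtains c R where "continuous_on UNIV c" "\<And>x. R < norm x \<Longrightarrow> c x = 0" "Lpow 2 (\<lambda>x. g x - c x) \<le> e"
proof -
  \<comment> \<open>Truncation in space and in size at once, so that the bounded, compactly
    supported case applies; the error is dominated by |g|^2.\<close>
  define g' where "g' m x = (if norm x \<le> real m \<and> norm (g x) \<le> real m then g x else 0)" for m x
  have [measurable]: "g' m \<in> borel_measurable borel" for m unfolding g'_def by measurable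
  have "(\<lambda>m. \<integral>\<^sup>+x. ennreal (norm (g x - g' m x) powr 2) \<partial>lborel) \<longlonglongrightarrow> (\<integral>\<^sup>+(x::real^'n). 0 \<partial>lborel)"
  proof (rule nn_integral_dominated_convergence[where w="\<lambda>x. ennreal (norm (g x) powr 2)"])
    show "AE x in lborel. ennreal (norm (g x - g' j x) powr 2) \<le> ennreal (norm (g x) powr 2)" for j
      by (auto simp: g'_def)
    show "AE x in lborel. (\<lambda>i. ennreal (norm (g x - g' i x) powr 2)) \<longlonglongrightarrow> 0"
    proof (intro AE_I2)
      fix x
      obtain k where k: "norm x \<le> real k" "norm (g x) \<le> real k"
        using real_arch_simple[of "max (norm x) (norm (g x))"] by auto
      show "(\<lambda>i. ennreal (norm (g x - g' i x) powr 2)) \<longlonglongrightarrow> 0"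
      proof (rule tendsto_eventually)
        have "ennreal (norm (g x - g' i x) powr 2) = 0" if "i \<ge> k" for i
          using k that by (auto simp: g'_def)
        then show "\<forall>\<^sub>F i in sequentially. ennreal (norm (g x - g' i x) powr 2) = 0"
          unfolding eventually_sequentially by blast
      qed
    qed
  qed (use fin in \<open>auto simp: Lpow_def\<close>)
  then have "(\<lambda>m. Lpow 2 (\<lambda>x. g x - g' m x)) \<longlonglongrightarrow> 0" by (simp add: Lpow_def)
  \<comment> \<open>The triangle inequality for \<open>Lpow 2\<close> costs the factor 4, and there
    are two errors: 4 (e/8 + e/8) = e.\<close>
  moreover have e8: "e / 8 > 0" using e by (simp add: ennreal_divide_eq_0_iff zero_less_iff_neq_zero)
  ultimately obtain m where m: "Lpow 2 (\<lambda>x. g x - g' m x) < e / 8"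
    using order_tendstoD(2)[of _ 0 sequentially "e / 8"] by (auto simp: eventually_sequentially)
  obtain c where c: "continuous_on UNIV c" "\<And>x. real m + 1 < norm x \<Longrightarrow> c x = 0" "Lpow 2 (\<lambda>x. g' m x - c x) < e / 8"
    by (rule L2_bounded_approx[of "g' m" "real m + 1" "real m" "e / 8"]) (use e8 in \<open>auto simp: g'_def\<close>)
  have [measurable]: "c \<in> borel_measurable borel" using c(1) by (rule borel_measurable_continuous_onI)
  have "Lpow 2 (\<lambda>x. g x - c x) = Lpow 2 (\<lambda>x. (g x - g' m x) + (g' m x - c x))" by simp
  also have "\<dots> \<le> ennreal (2 powr 2) * (Lpow 2 (\<lambda>x. g x - g' m x) + Lpow 2 (\<lambda>x. g' m x - c x))"
    by (rule Lpow_add_le) auto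
  also have "\<dots> \<le> ennreal (2 powr 2) * (e / 8 + e / 8)"
    using m c(3) by (intro mult_left_mono add_mono) auto
  also have "\<dots> = e"
  proof -
    have "ennreal (2 powr 2) = 4" by (simp add: powr_numeral)
    moreover have "4 * (e / 8 + e / 8) = e"
    proof (cases e)
      case (real r)
      have "e / 8 = ennreal (r / 8)" using real by (simp add: divide_ennreal[symmetric])
      then have "4 * (e / 8 + e / 8) = ennreal 4 * (ennreal (r/8) + ennreal (r/8))" by simp
      also have "\<dots> = ennreal 4 * ennreal (r / 4)"
        using real by (subst ennreal_plus[symmetric]) auto
      also have "\<dots> = ennreal r" using real by (subst ennreal_mult[symmetric]) auto
      finally show ?thesis using real by simp
    next
      case top
      then show ?thesis by (simp add: ennreal_top_divide ennreal_mult_top)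
    qed
    ultimately show ?thesis by simp
  qed
  finally have "Lpow 2 (\<lambda>x. g x - c x) \<le> e" .
  with that[OF c(1,2)] show ?thesis by blast
qed


text \<open>A compactly supported continuous approximant \<open>c\<close> is uniformly continuous,
  so a small translation changes it little and on a fixed ball only; the errors g - c before and
  after translation have the same norm.\<close>

lemma L2_translation:
  fixes g :: "real^'n::finite \<Rightarrow> complex"
  assumes [measurable]: "g \<in> borel_measurable borel" and fin: "Lpow 2 g < \<infinity>" and r: "r > 0"
  obtains \<delta> where "\<delta> > 0" "\<And>h. norm h < \<delta> \<Longrightarrow> Lpow 2 (\<lambda>x. g (x - h) - g x) \<le> ennreal r"
proof -
  \<comment> \<open>The constants 40 and 32 are adapted to two uses of the triangle inequality with
    factor 4: 4 (r/40 + 4 (r/32 + r/40)) = r.\<close>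
  obtain c R where c: "continuous_on UNIV c" "\<And>x. R < norm x \<Longrightarrow> c x = 0" "Lpow 2 (\<lambda>x. g x - c x) \<le> ennreal (r / 40)"
    by (rule L2_approx[OF assms(1) fin, of "ennreal (r / 40)"]) (use r in auto)
  have [measurable]: "c \<in> borel_measurable borel" using c(1) by (rule borel_measurable_continuous_onI)
  let ?B = "cball (0::real^'n) (R + 1)"
  define V where "V = measure lborel ?B"
  have V: "emeasure lborel ?B = ennreal V" unfolding V_def
    using emeasure_lborel_cball_finite[of "0::real^'n" "R + 1"] by (simp add: emeasure_eq_ennreal_measure top.not_eq_extremum)
  \<comment> \<open>Chosen so that \<eta>^2 times the volume \<open>V\<close> is at most r/32;
    adding 1 to \<open>V\<close> excludes a zero denominator.\<close>
  define \<eta> where "\<eta> = sqrt (r / (32 * (V + 1)))"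
  have V0: "V \<ge> 0" by (simp add: V_def)
  have \<eta>: "\<eta> > 0" using r V0 by (simp add: \<eta>_def)
  have \<eta>2: "\<eta> powr 2 * V \<le> r / 32"
  proof -
    have "\<eta> powr 2 * V = r / 32 * (V / (V + 1))" using \<eta> r V0 by (simp add: \<eta>_def powr_numeral)
    also have "\<dots> \<le> r / 32 * 1" using r V0 by (intro mult_left_mono) auto
    finally show ?thesis by simp
  qed
  have "uniformly_continuous_on (cball 0 (R + 2)) c"
    by (rule compact_uniformly_continuous[OF continuous_on_subset[OF c(1)]]) auto
  then obtain d where d: "d > 0" "\<And>x y. x \<in> cball 0 (R + 2) \<Longrightarrow> y \<in> cball 0 (R + 2) \<Longrightarrow> dist y x < d \<Longrightarrow> dist (c y) (c x) < \<eta>"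
    using \<eta> unfolding uniformly_continuous_on_def by metis
  show ?thesis
  proof (rule that[of "min d 1"])
    fix h :: "real^'n" assume h: "norm h < min d 1"
    have cb: "ennreal (norm (c (x - h) - c x) powr 2) \<le> ennreal (\<eta> powr 2) * indicator ?B x" for x
    proof (cases "norm x \<le> R + 1")
      case True
      have "norm (x - h) \<le> R + 2" using norm_triangle_ineq4[of x h] True h by simp
      then have "dist (c (x - h)) (c x) < \<eta>" using True h by (intro d(2)) (auto simp: dist_norm norm_minus_commute)
      then have "norm (c (x - h) - c x) powr 2 \<le> \<eta> powr 2" by (intro powr_mono2) (auto simp: dist_norm)
      then show ?thesis using True by (simp add: ennreal_leI)
    next
      case False
      have "norm x \<le> norm (x - h) + norm h" using norm_triangle_ineq[of "x - h" h] by simp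
      then have "c (x - h) = 0" "c x = 0" using False h by (auto intro!: c(2))
      then show ?thesis by simp
    qed
    have B: "Lpow 2 (\<lambda>x. c (x - h) - c x) \<le> ennreal (r / 32)"
    proof -
      have "Lpow 2 (\<lambda>x. c (x - h) - c x) \<le> (\<integral>\<^sup>+x. ennreal (\<eta> powr 2) * indicator ?B x \<partial>lborel)"
        unfolding Lpow_def by (intro nn_integral_mono cb)
      also have "\<dots> = ennreal (\<eta> powr 2) * ennreal V" unfolding V[symmetric]
        by (intro nn_integral_cmult_indicator) auto
      also have "\<dots> \<le> ennreal (r / 32)" using V0 \<eta>2 by (simp add: ennreal_mult[symmetric] ennreal_leI)
      finally show ?thesis .
    qed
    have sh: "Lpow 2 (\<lambda>x. g (x - h) - c (x - h)) = Lpow 2 (\<lambda>x. g x - c x)"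
      unfolding Lpow_def by (rule nn_integral_shift[where f="\<lambda>x. ennreal (norm (g x - c x) powr 2)"]) measurable
    have sw: "Lpow 2 (\<lambda>x. c x - g x) = Lpow 2 (\<lambda>x. g x - c x)" unfolding Lpow_def by (simp add: norm_minus_commute)
    have p2: "ennreal (2 powr 2) = ennreal 4" by (simp add: powr_numeral)
    have "Lpow 2 (\<lambda>x. g (x - h) - g x) = Lpow 2 (\<lambda>x. (g (x - h) - c (x - h)) + ((c (x - h) - c x) + (c x - g x)))" by simp
    also have "\<dots> \<le> ennreal 4 * (Lpow 2 (\<lambda>x. g (x - h) - c (x - h)) + Lpow 2 (\<lambda>x. (c (x - h) - c x) + (c x - g x)))"
      unfolding p2[symmetric] by (rule Lpow_add_le) auto
    also have "\<dots> \<le> ennreal 4 * (Lpow 2 (\<lambda>x. g (x - h) - c (x - h)) + ennreal 4 * (Lpow 2 (\<lambda>x. c (x - h) - c x) + Lpow 2 (\<lambda>x. c x - g x)))"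
      unfolding p2[symmetric] by (intro mult_left_mono add_left_mono Lpow_add_le) auto
    also have "\<dots> \<le> ennreal 4 * (ennreal (r / 40) + ennreal 4 * (ennreal (r / 32) + ennreal (r / 40)))"
      unfolding sh sw using c(3) B by (intro mult_left_mono add_mono) auto
    also have "\<dots> = ennreal (4 * (r / 40 + 4 * (r / 32 + r / 40)))"
    proof -
      have "ennreal (r / 32) + ennreal (r / 40) = ennreal (r / 32 + r / 40)" using r by (subst ennreal_plus) auto
      moreover have "ennreal 4 * ennreal (r / 32 + r / 40) = ennreal (4 * (r / 32 + r / 40))" using r by (subst ennreal_mult) auto
      moreover have "ennreal (r / 40) + ennreal (4 * (r / 32 + r / 40)) = ennreal (r / 40 + 4 * (r / 32 + r / 40))" using r by (subst ennreal_plus) auto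
      moreover have "ennreal 4 * ennreal (r / 40 + 4 * (r / 32 + r / 40)) = ennreal (4 * (r / 40 + 4 * (r / 32 + r / 40)))" using r by (subst ennreal_mult) auto
      ultimately show ?thesis by simp
    qed
    also have "\<dots> \<le> ennreal r" using r by (intro ennreal_leI) (simp add: field_simps)
    finally show "Lpow 2 (\<lambda>x. g (x - h) - g x) \<le> ennreal r" .
  qed (use d in auto)
qed

text \<open>Friedrichs' lemma reduces to the fact that this mean oscillation tends to $0$ in $L^2$.\<close>

definition osc :: "real \<Rightarrow> (real^'n::finite \<Rightarrow> complex) \<Rightarrow> real^'n \<Rightarrow> ennreal" where
  "osc \<epsilon> g x = ennreal (1 / \<epsilon> ^ CARD('n)) * (\<integral>\<^sup>+y. indicator (ball x \<epsilon>) y * ennreal (norm (g y - g x)) \<partial>lborel)"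

lemma indicator_ball_borel [measurable]:
  "(\<lambda>z. indicator (ball (0::'a::euclidean_space) \<epsilon>) z) \<in> borel_measurable borel"
  by (intro borel_measurable_indicator) simp

text \<open>The substitution y = x - z moves the dependence on \<open>x\<close> from the ball to
  \<open>g\<close>. The oscillation becomes an average of translation differences over a fixed ball,
  which gives both its measurability and its L^2 bound.\<close>

lemma osc_reflect:
  fixes g :: "real^'n::finite \<Rightarrow> complex"
  assumes [measurable]: "g \<in> borel_measurable borel"
  shows "osc \<epsilon> g x = ennreal (1 / \<epsilon> ^ CARD('n)) * (\<integral>\<^sup>+z. indicator (ball 0 \<epsilon>) z * ennreal (norm (g (x - z) - g x)) \<partial>lborel)"
proof -
  have m: "(\<lambda>y. indicator (ball x \<epsilon>) y * ennreal (norm (g y - g x))) \<in> borel_measurable borel"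
    by (intro borel_measurable_times_ennreal borel_measurable_indicator) auto
  have "indicator (ball x \<epsilon>) (x - z) = (indicator (ball 0 \<epsilon>) z :: ennreal)" for z
    by (simp add: indicator_def dist_norm)
  then show ?thesis unfolding osc_def
    using nn_integral_reflect[OF m, of x] by simp
qed

lemma osc_measurable:
  fixes g :: "real^'n::finite \<Rightarrow> complex"
  assumes [measurable]: "g \<in> borel_measurable borel"
  shows "osc \<epsilon> g \<in> borel_measurable borel"
proof -
  have "(\<lambda>x. ennreal (1 / \<epsilon> ^ CARD('n)) * (\<integral>\<^sup>+z. indicator (ball 0 \<epsilon>) z * ennreal (norm (g (x - z) - g x)) \<partial>lborel)) \<in> borel_measurable borel"
    by measurable
  moreover have "osc \<epsilon> g = (\<lambda>x. ennreal (1 / \<epsilon> ^ CARD('n)) * (\<integral>\<^sup>+z. indicator (ball 0 \<epsilon>) z * ennreal (norm (g (x - z) - g x)) \<partial>lborel))"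
    by (rule ext) (rule osc_reflect[OF assms])
  ultimately show ?thesis by simp
qed

text \<open>The Cauchy-Schwarz inequality on the ball gives one factor of its volume, and Tonelli's
  theorem followed by integration of the translation bound gives the second. After the normalization
  by \<epsilon>^(-n), squared, the powers of \<epsilon> cancel.\<close>

lemma osc_L2_bound:
  fixes g :: "real^'n::finite \<Rightarrow> complex"
  assumes [measurable]: "g \<in> borel_measurable borel" and \<epsilon>: "\<epsilon> > 0"
    and T: "\<And>h. norm h < \<epsilon> \<Longrightarrow> Lpow 2 (\<lambda>x. g (x - h) - g x) \<le> T"
  shows "(\<integral>\<^sup>+x. (osc \<epsilon> g x)\<^sup>2 \<partial>lborel) \<le> ennreal ((unit_ball_vol CARD('n))\<^sup>2) * T"
proof -
  let ?b = "\<lambda>z. indicator (ball (0::real^'n) \<epsilon>) z :: ennreal"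
  let ?\<Delta> = "\<lambda>x z. ennreal (norm (g (x - z) - g x))"
  define c where "c = 1 / \<epsilon> ^ CARD('n)"
  define v where "v = unit_ball_vol (real CARD('n)) * \<epsilon> ^ CARD('n)"
  have cv: "c \<ge> 0" "v \<ge> 0" "c * v = unit_ball_vol CARD('n)" using \<epsilon> by (auto simp: c_def v_def)
  have bv: "(\<integral>\<^sup>+z. ?b z \<partial>lborel) = ennreal v" unfolding v_def
    using \<epsilon> by (simp add: emeasure_ball)
  have b2: "(?b z)\<^sup>2 = ?b z" for z by (simp add: indicator_def)
  have sq: "(?\<Delta> x z)\<^sup>2 = ennreal (norm (g (x - z) - g x) powr 2)" for x z
    by (simp add: ennreal_power powr_numeral)
  have "(\<integral>\<^sup>+x. (osc \<epsilon> g x)\<^sup>2 \<partial>lborel) \<le> (\<integral>\<^sup>+x. ennreal (c\<^sup>2 * v) * (\<integral>\<^sup>+z. ?b z * ennreal (norm (g (x - z) - g x) powr 2) \<partial>lborel) \<partial>lborel)"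
  proof (rule nn_integral_mono)
    fix x
    have "(\<integral>\<^sup>+z. ?b z * ?\<Delta> x z \<partial>lborel) = (\<integral>\<^sup>+z. ?b z * (?b z * ?\<Delta> x z) \<partial>lborel)"
      by (intro nn_integral_cong) (simp add: indicator_def)
    then have "(\<integral>\<^sup>+z. ?b z * ?\<Delta> x z \<partial>lborel)\<^sup>2 \<le> (\<integral>\<^sup>+z. (?b z)\<^sup>2 \<partial>lborel) * (\<integral>\<^sup>+z. (?b z * ?\<Delta> x z)\<^sup>2 \<partial>lborel)"
      using Cauchy_Schwarz_nn_integral[of ?b lborel "\<lambda>z. ?b z * ?\<Delta> x z"] by simp
    also have "\<dots> = ennreal v * (\<integral>\<^sup>+z. ?b z * ennreal (norm (g (x - z) - g x) powr 2) \<partial>lborel)"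
      unfolding power_mult_distrib b2 sq bv ..
    finally have "(ennreal c)\<^sup>2 * (\<integral>\<^sup>+z. ?b z * ?\<Delta> x z \<partial>lborel)\<^sup>2 \<le> (ennreal c)\<^sup>2 * (ennreal v * (\<integral>\<^sup>+z. ?b z * ennreal (norm (g (x - z) - g x) powr 2) \<partial>lborel))"
      by (rule mult_left_mono) simp
    also have "\<dots> = ennreal (c\<^sup>2 * v) * (\<integral>\<^sup>+z. ?b z * ennreal (norm (g (x - z) - g x) powr 2) \<partial>lborel)"
      using cv by (simp add: ennreal_power ennreal_mult mult.assoc)
    finally show "(osc \<epsilon> g x)\<^sup>2 \<le> ennreal (c\<^sup>2 * v) * (\<integral>\<^sup>+z. ?b z * ennreal (norm (g (x - z) - g x) powr 2) \<partial>lborel)"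
      unfolding osc_reflect[OF assms(1)] c_def[symmetric] power_mult_distrib .
  qed
  also have "\<dots> = ennreal (c\<^sup>2 * v) * (\<integral>\<^sup>+x. \<integral>\<^sup>+z. ?b z * ennreal (norm (g (x - z) - g x) powr 2) \<partial>lborel \<partial>lborel)"
    by (intro nn_integral_cmult) measurable
  also have "(\<integral>\<^sup>+x. \<integral>\<^sup>+z. ?b z * ennreal (norm (g (x - z) - g x) powr 2) \<partial>lborel \<partial>lborel)
    = (\<integral>\<^sup>+z. \<integral>\<^sup>+x. ?b z * ennreal (norm (g (x - z) - g x) powr 2) \<partial>lborel \<partial>lborel)"
    by (rule lborel_pair.Fubini'[symmetric]) measurable
  also have "\<dots> = (\<integral>\<^sup>+z. ?b z * Lpow 2 (\<lambda>x. g (x - z) - g x) \<partial>lborel)"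
    unfolding Lpow_def by (intro nn_integral_cong nn_integral_cmult) measurable
  also have "\<dots> \<le> (\<integral>\<^sup>+z. ?b z * T \<partial>lborel)"
    using T by (intro nn_integral_mono) (auto simp: indicator_def)
  also have "\<dots> = ennreal v * T" using bv by (simp add: nn_integral_multc)
  finally have "(\<integral>\<^sup>+x. (osc \<epsilon> g x)\<^sup>2 \<partial>lborel) \<le> ennreal (c\<^sup>2 * v) * (ennreal v * T)" by (simp add: mult_left_mono)
  also have "\<dots> = ennreal ((c * v)\<^sup>2) * T"
    using cv by (simp add: ennreal_mult[symmetric] mult.assoc[symmetric] power2_eq_square mult_ac)
  finally show ?thesis unfolding cv(3) .
qed

lemma osc_tendsto:
  fixes g :: "real^'n::finite \<Rightarrow> complex"
  assumes g: "g \<in> borel_measurable borel" "Lpow 2 g < \<infinity>"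
  shows "(\<lambda>m. \<integral>\<^sup>+x. (osc (1 / real (Suc m)) g x)\<^sup>2 \<partial>lborel) \<longlonglongrightarrow> 0"
proof (rule order_tendstoI)
  fix e :: ennreal assume e: "0 < e"
  define V where "V = (unit_ball_vol CARD('n))\<^sup>2"
  have V: "V > 0" unfolding V_def by (rule zero_less_power) simp
  obtain y where y: "0 < y" "y < e" using dense[OF e] by blast
  then obtain r where r: "r > 0" "ennreal r < e"
    by (cases y) auto
  obtain \<delta> where \<delta>: "\<delta> > 0" "\<And>h. norm h < \<delta> \<Longrightarrow> Lpow 2 (\<lambda>x. g (x - h) - g x) \<le> ennreal (r / V)"
    using L2_translation[OF g, of "r / V"] r V by auto
  obtain M where M: "1 / real (Suc M) < \<delta>" using \<delta>(1) nat_approx_posE by metis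
  have "(\<integral>\<^sup>+x. (osc (1 / real (Suc m)) g x)\<^sup>2 \<partial>lborel) < e" if "m \<ge> M" for m
  proof -
    have "1 / real (Suc m) \<le> 1 / real (Suc M)" using that by (simp add: frac_le)
    with M have "1 / real (Suc m) < \<delta>" by simp
    then have "(\<integral>\<^sup>+x. (osc (1 / real (Suc m)) g x)\<^sup>2 \<partial>lborel) \<le> ennreal V * ennreal (r / V)"
      unfolding V_def by (intro osc_L2_bound[OF g(1)]) (use \<delta>(2) V_def in auto)
    also have "\<dots> = ennreal r" using V r by (simp add: ennreal_mult[symmetric])
    also have "\<dots> < e" by (rule r(2))
    finally show ?thesis .
  qed
  then show "\<forall>\<^sub>F m in sequentially. (\<integral>\<^sup>+x. (osc (1 / real (Suc m)) g x)\<^sup>2 \<partial>lborel) < e"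
    unfolding eventually_sequentially by blast
qed simp

text \<open>Bound the kernel by its supremum on the ball that carries it: what remains is the
  oscillation. Integrability need not be assumed, since the Bochner integral of a non-integrable
  function is 0.\<close>

lemma kernel_osc_bound:
  fixes g k :: "real^'n::finite \<Rightarrow> complex"
  assumes [measurable]: "g \<in> borel_measurable borel" "k \<in> borel_measurable borel" and C: "C \<ge> 0"
    and k: "\<And>y. norm (k y) \<le> C / \<epsilon> ^ CARD('n)" "\<And>y. y \<notin> ball x \<epsilon> \<Longrightarrow> k y = 0" and \<epsilon>: "\<epsilon> > 0"
  shows "ennreal (norm (LINT y|lborel. k y * (g y - g x))) \<le> ennreal C * osc \<epsilon> g x"
proof (cases "integrable lborel (\<lambda>y. k y * (g y - g x))")
  case True
  from integral_norm_bound_ennreal[OF this]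
  have "ennreal (norm (LINT y|lborel. k y * (g y - g x))) \<le> (\<integral>\<^sup>+y. ennreal (norm (k y * (g y - g x))) \<partial>lborel)" .
  also have "\<dots> \<le> (\<integral>\<^sup>+y. ennreal (C / \<epsilon> ^ CARD('n)) * (indicator (ball x \<epsilon>) y * ennreal (norm (g y - g x))) \<partial>lborel)"
  proof (rule nn_integral_mono)
    fix y
    show "ennreal (norm (k y * (g y - g x))) \<le> ennreal (C / \<epsilon> ^ CARD('n)) * (indicator (ball x \<epsilon>) y * ennreal (norm (g y - g x)))"
    proof (cases "y \<in> ball x \<epsilon>")
      case True
      have "norm (k y * (g y - g x)) \<le> C / \<epsilon> ^ CARD('n) * norm (g y - g x)"
        unfolding norm_mult by (intro mult_right_mono k) auto
      then show ?thesis using True C \<epsilon> by (simp add: ennreal_mult[symmetric] ennreal_leI)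
    qed (simp add: k(2))
  qed
  also have "\<dots> = ennreal (C / \<epsilon> ^ CARD('n)) * (\<integral>\<^sup>+y. indicator (ball x \<epsilon>) y * ennreal (norm (g y - g x)) \<partial>lborel)"
    by (intro nn_integral_cmult borel_measurable_times_ennreal) (auto intro!: borel_measurable_indicator)
  also have "ennreal (C / \<epsilon> ^ CARD('n)) = ennreal C * ennreal (1 / \<epsilon> ^ CARD('n))"
    using C \<epsilon> by (simp add: ennreal_mult[symmetric])
  finally show ?thesis by (simp add: osc_def mult.assoc)
qed (simp add: not_integrable_integral_eq)

section \<open>Bounds for mollified functions and convergence along subsequences\<close>

lemma mollifierD:
  fixes \<rho> :: "real^'n::finite \<Rightarrow> complex"
  assumes "mollifier A \<epsilon> \<rho>"
  shows "\<rho> \<in> test_functions UNIV" "\<And>x. \<rho> x = of_real (norm (\<rho> x))" "\<And>x. \<epsilon> \<le> norm x \<Longrightarrow> \<rho> x = 0"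
    "(\<integral>\<^sup>+x. ennreal (norm (\<rho> x)) \<partial>lborel) = 1" "\<And>x. norm (\<rho> x) \<le> A / \<epsilon> ^ CARD('n)"
    "\<And>x j. norm (D j \<rho> x) \<le> A / \<epsilon> ^ Suc CARD('n)" "\<rho> \<in> borel_measurable borel"
  using assms test_borel unfolding mollifier_def by auto

lemma mollifier_integral:
  fixes \<rho> :: "real^'n::finite \<Rightarrow> complex"
  assumes \<rho>: "mollifier A \<epsilon> \<rho>"
  shows "(LINT y|lborel. \<rho> (x - y)) = 1"
proof -
  note [measurable] = mollifierD(7)[OF \<rho>]
  have "(LINT y|lborel. norm (\<rho> y)) = 1"
    by (subst integral_eq_nn_integral) (auto simp: mollifierD(4)[OF \<rho>])
  moreover have "(LINT y|lborel. \<rho> y) = (LINT y|lborel. of_real (norm (\<rho> y)))"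
    by (intro Bochner_Integration.integral_cong refl mollifierD(2)[OF \<rho>])
  ultimately show ?thesis by (subst integral_reflect) auto
qed

lemma conv_diff_osc:
  fixes \<rho> g :: "real^'n::finite \<Rightarrow> complex"
  assumes \<rho>: "mollifier A \<epsilon> \<rho>" and g: "integrable lborel g" and A: "A > 0" "\<epsilon> > 0"
  shows "ennreal (norm (conv \<rho> g x - g x)) \<le> ennreal A * osc \<epsilon> g x"
proof -
  note [measurable] = mollifierD(7)[OF \<rho>]
  have gm [measurable]: "g \<in> borel_measurable borel" using g by auto
  have i: "integrable lborel (\<lambda>y. \<rho> (x - y))"
    using mollifier_integral[OF \<rho>, of x] not_integrable_integral_eq by fastforce
  have "conv \<rho> g x - g x = (LINT y|lborel. \<rho> (x - y) * g y) - (LINT y|lborel. \<rho> (x - y) * g x)"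
    unfolding conv_def using mollifier_integral[OF \<rho>, of x] by simp
  also have "\<dots> = (LINT y|lborel. \<rho> (x - y) * (g y - g x))"
    by (subst Bochner_Integration.integral_diff[symmetric])
      (use i integrable_conv[OF mollifierD(1)[OF \<rho>] g] in \<open>auto simp: algebra_simps\<close>)
  finally show ?thesis
    using kernel_osc_bound[of g "\<lambda>y. \<rho> (x - y)" A \<epsilon> x] A mollifierD(3,5)[OF \<rho>] by (auto simp: dist_norm)
qed

text \<open>Write \<rho> = \<rho>^(1-1/p) \<rho>^(1/p), apply Hoelder's inequality with total mass
  1, then Tonelli's theorem. The weight may be moved from \<open>x\<close> to \<open>y\<close> since
  the two are closer than \<epsilon>; so the constant is \<open>K\<close> however strongly the
  weight varies globally.\<close>

lemma conv_weighted_young: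
  fixes \<rho> f :: "real^'n::finite \<Rightarrow> complex" and W :: "real^'n \<Rightarrow> ennreal"
  assumes \<rho>: "mollifier A \<epsilon> \<rho>" and f: "integrable lborel f" and p: "p \<ge> 1"
    and W [measurable]: "W \<in> borel_measurable borel"
    and K: "\<And>x y. norm (x - y) < \<epsilon> \<Longrightarrow> f y \<noteq> 0 \<Longrightarrow> W x \<le> K * W y"
  shows "(\<integral>\<^sup>+x. W x * ennreal (norm (conv \<rho> f x) powr p) \<partial>lborel) \<le> K * (\<integral>\<^sup>+y. W y * ennreal (norm (f y) powr p) \<partial>lborel)"
proof -
  note [measurable] = mollifierD(7)[OF \<rho>]
  have [measurable]: "f \<in> borel_measurable borel" using f by auto
  have one: "(\<integral>\<^sup>+y. ennreal (norm (\<rho> (x - y))) \<partial>lborel) = 1" "(\<integral>\<^sup>+y. ennreal (norm (\<rho> (y - x))) \<partial>lborel) = 1" for x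
    using nn_integral_reflect[of "\<lambda>y. ennreal (norm (\<rho> y))" x] nn_integral_shift[of "\<lambda>y. ennreal (norm (\<rho> y))" x]
      mollifierD(4)[OF \<rho>] by auto
  let ?J = "\<lambda>x. \<integral>\<^sup>+y. ennreal (norm (\<rho> (x - y))) * ennreal (norm (f y) powr p) \<partial>lborel"
  have pt: "ennreal (norm (conv \<rho> f x) powr p) \<le> ?J x" for x
  proof -
    have "ennreal (norm (conv \<rho> f x)) \<le> (\<integral>\<^sup>+y. ennreal (norm (\<rho> (x - y) * f y)) \<partial>lborel)"
      unfolding conv_def by (rule integral_norm_bound_ennreal[OF integrable_conv[OF mollifierD(1)[OF \<rho>] f]])
    also have "\<dots> = (\<integral>\<^sup>+y. epowr (ennreal (norm (\<rho> (x - y)))) (1 - 1/p) * epowr (ennreal (norm (\<rho> (x - y))) * ennreal (norm (f y) powr p)) (1/p) \<partial>lborel)"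
    proof (rule nn_integral_cong)
      fix y
      let ?a = "ennreal (norm (\<rho> (x - y)))"
      have "epowr ?a (1 - 1/p) * epowr (?a * ennreal (norm (f y) powr p)) (1/p) = epowr ?a (1 - 1/p) * epowr ?a (1/p) * epowr (ennreal (norm (f y) powr p)) (1/p)"
        using p by (simp add: epowr_mult mult.assoc)
      also have "epowr ?a (1 - 1/p) * epowr ?a (1/p) = epowr ?a ((1 - 1/p) + 1/p)"
        using p by (intro epowr_add[symmetric]) auto
      also have "epowr (ennreal (norm (f y) powr p)) (1/p) = ennreal (norm (f y))"
        using p by (subst epowr_ennreal) (auto simp: powr_powr)
      finally show "ennreal (norm (\<rho> (x - y) * f y)) = epowr ?a (1 - 1/p) * epowr (?a * ennreal (norm (f y) powr p)) (1/p)"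
        by (simp add: norm_mult ennreal_mult)
    qed
    also have "\<dots> \<le> epowr (\<integral>\<^sup>+y. ennreal (norm (\<rho> (x - y))) \<partial>lborel) (1 - 1/p) * epowr (?J x) (1/p)"
      using p by (intro Hoelder2) auto
    also have "\<dots> = epowr (?J x) (1/p)" unfolding one by simp
    finally have "epowr (ennreal (norm (conv \<rho> f x))) p \<le> epowr (epowr (?J x) (1/p)) p"
      using p by (intro epowr_mono) auto
    then show ?thesis using p by (simp add: epowr_epowr epowr_ennreal)
  qed
  have "(\<integral>\<^sup>+x. W x * ennreal (norm (conv \<rho> f x) powr p) \<partial>lborel) \<le> (\<integral>\<^sup>+x. W x * ?J x \<partial>lborel)"
    by (intro nn_integral_mono mult_left_mono pt) auto
  also have "\<dots> = (\<integral>\<^sup>+x. \<integral>\<^sup>+y. W x * (ennreal (norm (\<rho> (x - y))) * ennreal (norm (f y) powr p)) \<partial>lborel \<partial>lborel)"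
    by (intro nn_integral_cong nn_integral_cmult[symmetric]) measurable
  also have "\<dots> \<le> (\<integral>\<^sup>+x. \<integral>\<^sup>+y. ennreal (norm (\<rho> (x - y))) * (K * (W y * ennreal (norm (f y) powr p))) \<partial>lborel \<partial>lborel)"
  proof (intro nn_integral_mono)
    fix x y
    show "W x * (ennreal (norm (\<rho> (x - y))) * ennreal (norm (f y) powr p)) \<le> ennreal (norm (\<rho> (x - y))) * (K * (W y * ennreal (norm (f y) powr p)))"
    proof (cases "norm (x - y) < \<epsilon> \<and> f y \<noteq> 0")
      case True
      then have "W x * (ennreal (norm (\<rho> (x - y))) * ennreal (norm (f y) powr p)) \<le> (K * W y) * (ennreal (norm (\<rho> (x - y))) * ennreal (norm (f y) powr p))"
        by (intro mult_right_mono K) auto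
      then show ?thesis by (simp add: mult_ac)
    next
      case False
      then show ?thesis using mollifierD(3)[OF \<rho>, of "x - y"] by auto
    qed
  qed
  also have "\<dots> = (\<integral>\<^sup>+y. \<integral>\<^sup>+x. ennreal (norm (\<rho> (x - y))) * (K * (W y * ennreal (norm (f y) powr p))) \<partial>lborel \<partial>lborel)"
    by (rule lborel_pair.Fubini'[symmetric]) measurable
  also have "\<dots> = (\<integral>\<^sup>+y. K * (W y * ennreal (norm (f y) powr p)) \<partial>lborel)"
    by (intro nn_integral_cong) (subst nn_integral_multc, auto simp: one)
  also have "\<dots> = K * (\<integral>\<^sup>+y. W y * ennreal (norm (f y) powr p) \<partial>lborel)"
    by (rule nn_integral_cmult) measurable
  finally show ?thesis .
qed

lemma Lpow_conv_le:
  fixes \<rho> f :: "real^'n::finite \<Rightarrow> complex"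
  assumes "mollifier A \<epsilon> \<rho>" "integrable lborel f" "p \<ge> 1"
  shows "Lpow p (conv \<rho> f) \<le> Lpow p f"
  using conv_weighted_young[OF assms, of "\<lambda>_. 1" 1] by (simp add: Lpow_def)

lemma conv_support:
  assumes \<rho>: "mollifier A \<epsilon> \<rho>" and f: "\<And>y. y \<notin> cball x0 r \<Longrightarrow> f y = 0" and x: "x \<notin> cball x0 (r + \<epsilon>)"
  shows "conv \<rho> f x = 0"
proof -
  have z: "\<rho> (x - y) * f y = 0" for y
  proof (cases "y \<in> cball x0 r")
    case True
    have "dist x0 x \<le> dist x0 y + dist y x" by (rule dist_triangle)
    then have "\<epsilon> \<le> norm (x - y)" using True x by (auto simp: dist_norm norm_minus_commute)
    then show ?thesis using mollifierD(3)[OF \<rho>] by simp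
  qed (simp add: f)
  show ?thesis unfolding conv_def z by simp
qed

lemma conv_test:
  fixes \<rho> f :: "real^'n::finite \<Rightarrow> complex"
  assumes \<rho>: "mollifier A \<epsilon> \<rho>" and f: "integrable lborel f" "\<And>y. y \<notin> cball x0 r \<Longrightarrow> f y = 0" and r: "r + \<epsilon> < R"
  shows "conv \<rho> f \<in> test_functions (ball x0 R)"
  by (rule test_functionsI[OF conv_smooth[OF f(1) mollifierD(1)[OF \<rho>]] compact_cball[of x0 "r + \<epsilon>"]])
    (use r conv_support[OF \<rho> f(2)] in auto)

text \<open>|f| is at most the indicator of the ball plus |f|^p. Integrability is what makes the
  convolutions with \<open>f\<close> well behaved.\<close>

lemma integrable_bounded_support:
  fixes f :: "real^'n::finite \<Rightarrow> complex"
  assumes [measurable]: "f \<in> borel_measurable borel" and fin: "Lpow p f < \<infinity>" and p: "p \<ge> 1"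
    and supp: "\<And>y. y \<notin> cball x0 r \<Longrightarrow> f y = 0"
  shows "integrable lborel f"
proof -
  have "(\<integral>\<^sup>+x. ennreal (norm (f x)) \<partial>lborel) \<le> (\<integral>\<^sup>+x. indicator (cball x0 r) x + ennreal (norm (f x) powr p) \<partial>lborel)"
  proof (rule nn_integral_mono)
    fix x
    have "norm (f x) \<le> indicator (cball x0 r) x + norm (f x) powr p"
    proof (cases "norm (f x) \<le> 1")
      case True
      then show ?thesis using supp[of x] by (cases "x \<in> cball x0 r") (auto intro: add_increasing2)
    next
      case False
      then have "norm (f x) powr 1 \<le> norm (f x) powr p" using p by (intro powr_mono) auto
      then have "norm (f x) \<le> norm (f x) powr p" by simp
      then show ?thesis by (simp add: indicator_def)
    qed
    then have "ennreal (norm (f x)) \<le> ennreal (indicator (cball x0 r) x + norm (f x) powr p)" by (rule ennreal_leI)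
    then show "ennreal (norm (f x)) \<le> indicator (cball x0 r) x + ennreal (norm (f x) powr p)"
      by (simp add: ennreal_indicator)
  qed
  also have "\<dots> = emeasure lborel (cball x0 r) + Lpow p f"
    unfolding Lpow_def by (subst nn_integral_add) (auto intro!: borel_measurable_indicator)
  also have "\<dots> < \<infinity>" using fin emeasure_lborel_cball_finite[of x0 r] by simp
  finally show ?thesis by (simp add: integrable_iff_bounded)
qed

lemma nn_integral_fatou_bound:
  fixes F :: "nat \<Rightarrow> 'a \<Rightarrow> ennreal"
  assumes [measurable]: "\<And>m. F m \<in> borel_measurable M" and lim: "AE x in M. (\<lambda>m. F m x) \<longlonglongrightarrow> f x"
    and B: "\<And>m. (\<integral>\<^sup>+x. F m x \<partial>M) \<le> B"
  shows "(\<integral>\<^sup>+x. f x \<partial>M) \<le> B"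
proof -
  have "(\<integral>\<^sup>+x. f x \<partial>M) \<le> (\<integral>\<^sup>+x. liminf (\<lambda>m. F m x) \<partial>M)"
    using lim by (intro nn_integral_mono_AE) (auto elim!: eventually_mono dest!: lim_imp_Liminf[rotated])
  also have "\<dots> \<le> liminf (\<lambda>m. \<integral>\<^sup>+x. F m x \<partial>M)" by (rule nn_integral_liminf) measurable
  also have "\<dots> \<le> B" using B by (intro Liminf_le) auto
  finally show ?thesis .
qed

lemma L2_tendsto_AE_subseq:
  fixes w :: "nat \<Rightarrow> real^'n::finite \<Rightarrow> complex"
  assumes [measurable]: "\<And>m. w m \<in> borel_measurable borel" "u \<in> borel_measurable borel"
    and lim: "(\<lambda>m. Lpow 2 (\<lambda>x. w m x - u x)) \<longlonglongrightarrow> 0"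
  obtains s :: "nat \<Rightarrow> nat" where "strict_mono s" "AE x in lborel. (\<lambda>m. w (s m) x) \<longlonglongrightarrow> u x"
proof -
  \<comment> \<open>A sequence in [0, \<infinity>] tending to 0 is finite only from some index on.
    The subsequence theorem for L^1 needs integrable functions, so the first \<open>M\<close> terms
    are discarded.\<close>
  obtain M where M: "Lpow 2 (\<lambda>x. w m x - u x) < 1" if "m \<ge> M" for m
    using order_tendstoD(2)[OF lim, of 1] by (auto simp: eventually_sequentially)
  define F where "F m x = norm (w (m + M) x - u x) powr 2" for m x
  have [measurable]: "F m \<in> borel_measurable borel" for m unfolding F_def by measurable
  have int: "integrable lborel (F m)" for m
  proof (rule integrableI_bounded)
    have "Lpow 2 (\<lambda>x. w (m + M) x - u x) < \<infinity>" using M[of "m + M"] by (simp add: less_trans[OF _ ennreal_one_less_top])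
    then show "(\<integral>\<^sup>+x. ennreal (norm (F m x)) \<partial>lborel) < \<infinity>" by (simp add: Lpow_def F_def)
  qed simp
  have "(\<lambda>m. ennreal (LINT x|lborel. norm (F m x))) \<longlonglongrightarrow> 0"
  proof -
    have "ennreal (LINT x|lborel. norm (F m x)) = Lpow 2 (\<lambda>x. w (m + M) x - u x)" for m
      using nn_integral_eq_integral[OF integrable_norm[OF int[of m]]] by (simp add: Lpow_def F_def)
    then show ?thesis using LIMSEQ_ignore_initial_segment[OF lim, of M] by simp
  qed
  then have "(\<lambda>m. LINT x|lborel. norm (F m x)) \<longlonglongrightarrow> 0"
    by (subst (asm) ennreal_0[symmetric], subst (asm) tendsto_ennreal_iff) auto
  from tendsto_L1_AE_subseq[OF int this] obtain r where r: "strict_mono r" "AE x in lborel. (\<lambda>m. F (r m) x) \<longlonglongrightarrow> 0" by blast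
  show ?thesis
  proof (rule that[of "\<lambda>m. r m + M"])
    show "strict_mono (\<lambda>m. r m + M)" using r(1) by (simp add: strict_mono_def)
    show "AE x in lborel. (\<lambda>m. w (r m + M) x) \<longlonglongrightarrow> u x" using r(2)
    proof eventually_elim
      case (elim x)
      then have "(\<lambda>m. F (r m) x powr (1/2)) \<longlonglongrightarrow> 0 powr (1/2)"
        by (intro tendsto_powr2 tendsto_const) (auto simp: F_def)
      then have "(\<lambda>m. norm (w (r m + M) x - u x)) \<longlonglongrightarrow> 0" by (simp add: F_def powr_powr)
      then show ?case by (subst LIM_zero_iff[symmetric]) (simp add: tendsto_norm_zero_iff)
    qed
  qed
qed

section \<open>The Sobolev embedding and commutator estimates\<close>

text \<open>For D = -i d/dx the transpose is -D under a pairing without conjugation, hence the sign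
  and the absence of i.\<close>

definition weak_D :: "(real^'n::finite) set \<Rightarrow> 'n \<Rightarrow> (real^'n \<Rightarrow> complex) \<Rightarrow> (real^'n \<Rightarrow> complex) \<Rightarrow> bool" where
  "weak_D B k u g \<longleftrightarrow> (\<forall>\<eta>\<in>test_functions B.
     - (LINT x|lborel. u x * D k \<eta> x) = (LINT x|lborel. g x * \<eta> x))"

lemma mollifier_reflect_test:
  fixes \<rho> :: "real^'n::finite \<Rightarrow> complex"
  assumes \<rho>: "mollifier A \<epsilon> \<rho>" and x: "cball x \<epsilon> \<subseteq> B"
  shows "(\<lambda>y. \<rho> (x - y)) \<in> test_functions B"
proof (rule test_reflect[OF mollifierD(1)[OF \<rho>]])
  show "\<rho> z = 0" if "z \<notin> cball 0 \<epsilon>" for z using that mollifierD(3)[OF \<rho>] by simp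
  show "compact ((\<lambda>z. x - z) ` cball 0 \<epsilon>)" by (intro compact_continuous_image continuous_intros) simp
  show "(\<lambda>z. x - z) ` cball 0 \<epsilon> \<subseteq> B" using x by (force simp: dist_norm)
qed

lemma D_mollifier_reflect:
  assumes \<rho>: "mollifier A \<epsilon> \<rho>"
  shows "D k (\<lambda>y. \<rho> (x - y)) y = - D k \<rho> (x - y)"
  by (rule D_reflect[OF test_differentiable[OF mollifierD(1)[OF \<rho>]]])

lemma D_conv_weak:
  fixes \<rho> w :: "real^'n::finite \<Rightarrow> complex"
  assumes \<rho>: "mollifier A \<epsilon> \<rho>" and w: "integrable lborel w" and wk: "weak_D UNIV k w g"
  shows "D k (conv \<rho> w) = conv \<rho> g"
proof
  fix x
  have "D k (conv \<rho> w) x = conv (D k \<rho>) w x" by (rule D_conv[OF mollifierD(1)[OF \<rho>] w])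
  also have "\<dots> = - (LINT y|lborel. w y * D k (\<lambda>y. \<rho> (x - y)) y)"
    unfolding conv_def D_mollifier_reflect[OF \<rho>] by (simp add: mult.commute)
  also have "\<dots> = (LINT y|lborel. g y * \<rho> (x - y))"
    using wk mollifier_reflect_test[OF \<rho>, of x UNIV] unfolding weak_D_def by blast
  also have "\<dots> = conv \<rho> g x" unfolding conv_def by (simp add: mult.commute)
  finally show "D k (conv \<rho> w) x = conv \<rho> g x" .
qed

text \<open>Outside the closed ball the mollifier vanishes on a neighbourhood. The sphere |z| =
  \<epsilon> is included through continuity of the derivative along the dilates of z with factors
  decreasing to 1.\<close>

lemma mollifier_D_outside:
  fixes \<rho> :: "real^'n::finite \<Rightarrow> complex"
  assumes \<rho>: "mollifier A \<epsilon> \<rho>" and \<epsilon>: "\<epsilon> > 0" and z: "\<epsilon> \<le> norm z"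
  shows "D j \<rho> z = 0"
proof -
  have out: "D j \<rho> y = 0" if "\<epsilon> < norm y" for y unfolding D_def
    by (subst frechet_derivative_zero_on[of "- cball 0 \<epsilon>"])
      (use that mollifierD(3)[OF \<rho>] in \<open>auto simp: open_Compl\<close>)
  have cont: "continuous_on UNIV (D j \<rho>)" by (rule test_continuous[OF test_D[OF mollifierD(1)[OF \<rho>]]])
  have "(\<lambda>n. (1 + 1 / real (Suc n)) *\<^sub>R z) \<longlonglongrightarrow> (1 + 0) *\<^sub>R z"
    by (intro tendsto_intros LIMSEQ_Suc[OF lim_1_over_n])
  then have "(\<lambda>n. D j \<rho> ((1 + 1 / real (Suc n)) *\<^sub>R z)) \<longlonglongrightarrow> D j \<rho> ((1 + 0) *\<^sub>R z)"
    by (rule continuous_on_tendsto_compose[OF cont]) auto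
  moreover have "D j \<rho> ((1 + 1 / real (Suc n)) *\<^sub>R z) = 0" for n
  proof (rule out)
    have "1 * \<epsilon> < (1 + 1 / real (Suc n)) * norm z"
      using \<epsilon> z by (intro mult_less_le_imp_less) auto
    then show "\<epsilon> < norm ((1 + 1 / real (Suc n)) *\<^sub>R z)" by (simp del: of_nat_Suc)
  qed
  ultimately show ?thesis by (simp add: LIMSEQ_const_iff)
qed

lemma conv_borel:
  fixes \<rho> w :: "real^'n::finite \<Rightarrow> complex"
  assumes "mollifier A \<epsilon> \<rho>" "integrable lborel w"
  shows "conv \<rho> w \<in> borel_measurable borel"
  by (rule borel_measurable_continuous_onI[OF smooth_on_continuous[OF conv_smooth[OF assms(2) mollifierD(1)[OF assms(1)]]]])

lemma Lpow_conv_tendsto: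
  fixes \<rho> :: "nat \<Rightarrow> real^'n::finite \<Rightarrow> complex"
  assumes \<rho>: "\<And>m. mollifier A (1 / real (Suc m)) (\<rho> m)" and A: "A > 0"
    and w: "integrable lborel w" "Lpow 2 w < \<infinity>"
  shows "(\<lambda>m. Lpow 2 (\<lambda>x. conv (\<rho> m) w x - w x)) \<longlonglongrightarrow> 0"
proof -
  have wm: "w \<in> borel_measurable borel" using w by auto
  have "(\<lambda>m. ennreal (A\<^sup>2) * (\<integral>\<^sup>+x. (osc (1 / real (Suc m)) w x)\<^sup>2 \<partial>lborel)) \<longlonglongrightarrow> ennreal (A\<^sup>2) * 0"
    by (intro ennreal_tendsto_cmult osc_tendsto wm w) auto
  then have l: "(\<lambda>m. ennreal (A\<^sup>2) * (\<integral>\<^sup>+x. (osc (1 / real (Suc m)) w x)\<^sup>2 \<partial>lborel)) \<longlonglongrightarrow> 0" by simp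
  show ?thesis
  proof (rule tendsto_sandwich[OF _ _ tendsto_const l])
    have "Lpow 2 (\<lambda>x. conv (\<rho> m) w x - w x) \<le> ennreal (A\<^sup>2) * (\<integral>\<^sup>+x. (osc (1 / real (Suc m)) w x)\<^sup>2 \<partial>lborel)" for m
    proof -
      have "Lpow 2 (\<lambda>x. conv (\<rho> m) w x - w x) \<le> (\<integral>\<^sup>+x. ennreal (A\<^sup>2) * (osc (1 / real (Suc m)) w x)\<^sup>2 \<partial>lborel)"
        unfolding Lpow_def
      proof (rule nn_integral_mono)
        fix x
        have "ennreal (norm (conv (\<rho> m) w x - w x) powr 2) = (ennreal (norm (conv (\<rho> m) w x - w x)))\<^sup>2"
          by (simp add: ennreal_power powr_numeral)
        also have "\<dots> \<le> (ennreal A * osc (1 / real (Suc m)) w x)\<^sup>2"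
          by (intro power_mono conv_diff_osc[OF \<rho> w(1) A]) auto
        finally show "ennreal (norm (conv (\<rho> m) w x - w x) powr 2) \<le> ennreal (A\<^sup>2) * (osc (1 / real (Suc m)) w x)\<^sup>2"
          using A by (simp add: power_mult_distrib ennreal_power)
      qed
      also have "\<dots> = ennreal (A\<^sup>2) * (\<integral>\<^sup>+x. (osc (1 / real (Suc m)) w x)\<^sup>2 \<partial>lborel)"
        by (intro nn_integral_cmult borel_measurable_power_ennreal) (use osc_measurable[OF wm] in auto)
      finally show ?thesis .
    qed
    then show "\<forall>\<^sub>F m in sequentially. Lpow 2 (\<lambda>x. conv (\<rho> m) w x - w x) \<le> ennreal (A\<^sup>2) * (\<integral>\<^sup>+x. (osc (1 / real (Suc m)) w x)\<^sup>2 \<partial>lborel)"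
      by simp
  qed simp
qed

lemma sum_squares_le:
  fixes a :: "'i \<Rightarrow> real"
  shows "(\<Sum>i\<in>I. a i)\<^sup>2 \<le> real (card I) * (\<Sum>i\<in>I. (a i)\<^sup>2)"
  using Cauchy_Schwarz_ineq_sum[of "\<lambda>_. 1" a I] by simp

text \<open>Mollify and apply the inequality for test functions. The gradients of the mollified
  functions are mollified weak gradients, so the bound \<open>B\<close> is uniform, and Fatou's
  lemma along an almost everywhere convergent subsequence passes it to \<open>w\<close>.\<close>

lemma sobolev_H1:
  fixes w :: "real^'n::finite \<Rightarrow> complex"
  assumes dim: "CARD('n) > 2" and w: "w \<in> borel_measurable borel" "Lpow 2 w < \<infinity>"
    and g: "\<And>k. g k \<in> borel_measurable borel" "\<And>k. Lpow 2 (g k) < \<infinity>"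
    and supp: "\<And>y. y \<notin> cball x0 r \<Longrightarrow> w y = 0" "\<And>k y. y \<notin> cball x0 r \<Longrightarrow> g k y = 0"
    and wk: "\<And>k. weak_D UNIV k w (g k)"
  shows "Lpow (2 * real CARD('n) / (real CARD('n) - 2)) w < \<infinity>"
proof -
  define d where "d = real CARD('n)"
  have d: "d > 2" using dim by (simp add: d_def)
  define \<gamma> where "\<gamma> = 2 * (d - 1) / (d - 2)"
  obtain A and \<rho> :: "nat \<Rightarrow> real^'n \<Rightarrow> complex" where A: "A > 0" and \<rho>: "\<And>m. mollifier A (1 / real (Suc m)) (\<rho> m)"
    by (rule mollifier_sequence) blast
  have iw: "integrable lborel w" by (rule integrable_bounded_support[OF w _ supp(1)]) simp
  have ig: "integrable lborel (g k)" for k by (rule integrable_bounded_support[OF g _ supp(2)]) simp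
  have wm: "conv (\<rho> m) w \<in> borel_measurable borel" for m by (rule conv_borel[OF \<rho> iw])
  obtain s :: "nat \<Rightarrow> nat" where s: "strict_mono s" "AE x in lborel. (\<lambda>m. conv (\<rho> (s m)) w x) \<longlonglongrightarrow> w x"
    by (rule L2_tendsto_AE_subseq[OF wm w(1) Lpow_conv_tendsto[OF \<rho> A(1) iw w(2)]])
  define B where "B = epowr (ennreal (\<gamma>\<^sup>2) * (ennreal d * (\<Sum>k\<in>UNIV. Lpow 2 (g k)))) (d / (d - 2))"
  have B: "B < \<infinity>"
  proof -
    have "ennreal (\<gamma>\<^sup>2) * (ennreal d * (\<Sum>k\<in>UNIV. Lpow 2 (g k))) < top"
      using g(2) by (simp add: ennreal_mult_less_top)
    then show ?thesis using epowr_eq_top_iff unfolding B_def by (metis infinity_ennreal_def less_top)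
  qed
  have bd: "Lpow (2 * d / (d - 2)) (conv (\<rho> m) w) \<le> B" for m
  proof -
    have t: "conv (\<rho> m) w \<in> test_functions (ball x0 (r + 1 / real (Suc m) + 1))"
      by (rule conv_test[OF \<rho> iw supp(1)]) auto
    have "Lpow (2 * d / (d - 2)) (conv (\<rho> m) w) \<le>
      epowr (ennreal (\<gamma>\<^sup>2) * (\<integral>\<^sup>+x. ennreal ((grad_norm (conv (\<rho> m) w) x)\<^sup>2) \<partial>lborel)) (d / (d - 2))"
      using sobolev_test[OF dim t] unfolding Lpow_def d_def \<gamma>_def .
    also have "\<dots> \<le> B" unfolding B_def
    proof (intro epowr_mono mult_left_mono)
      have "(\<integral>\<^sup>+x. ennreal ((grad_norm (conv (\<rho> m) w) x)\<^sup>2) \<partial>lborel) \<le>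
        (\<integral>\<^sup>+x. ennreal d * (\<Sum>k\<in>UNIV. ennreal (norm (conv (\<rho> m) (g k) x) powr 2)) \<partial>lborel)"
      proof (rule nn_integral_mono)
        fix x
        have "(grad_norm (conv (\<rho> m) w) x)\<^sup>2 \<le> d * (\<Sum>k\<in>UNIV. (norm (conv (\<rho> m) (g k) x))\<^sup>2)"
          unfolding grad_norm_def D_conv_weak[OF \<rho> iw wk] d_def by (rule sum_squares_le)
        then have "ennreal ((grad_norm (conv (\<rho> m) w) x)\<^sup>2) \<le> ennreal (d * (\<Sum>k\<in>UNIV. norm (conv (\<rho> m) (g k) x) powr 2))"
          by (intro ennreal_leI) (simp add: powr_numeral)
        also have "\<dots> = ennreal d * (\<Sum>k\<in>UNIV. ennreal (norm (conv (\<rho> m) (g k) x) powr 2))"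
          using d by (subst ennreal_mult) (auto simp: sum_nonneg)
        finally show "ennreal ((grad_norm (conv (\<rho> m) w) x)\<^sup>2) \<le> ennreal d * (\<Sum>k\<in>UNIV. ennreal (norm (conv (\<rho> m) (g k) x) powr 2))" .
      qed
      also have "\<dots> = ennreal d * (\<Sum>k\<in>UNIV. Lpow 2 (conv (\<rho> m) (g k)))"
      proof -
        have [measurable]: "conv (\<rho> m) (g k) \<in> borel_measurable borel" for k by (rule conv_borel[OF \<rho> ig])
        show ?thesis unfolding Lpow_def by (subst nn_integral_cmult, measurable) (simp add: nn_integral_sum del: sum_ennreal)
      qed
      also have "\<dots> \<le> ennreal d * (\<Sum>k\<in>UNIV. Lpow 2 (g k))"
        by (intro mult_left_mono sum_mono Lpow_conv_le[OF \<rho> ig]) auto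
      finally show "(\<integral>\<^sup>+x. ennreal ((grad_norm (conv (\<rho> m) w) x)\<^sup>2) \<partial>lborel) \<le> ennreal d * (\<Sum>k\<in>UNIV. Lpow 2 (g k))" .
    qed (use d in auto)
    finally show ?thesis .
  qed
  have "Lpow (2 * d / (d - 2)) w \<le> B" unfolding Lpow_def
  proof (rule nn_integral_fatou_bound)
    show "(\<lambda>x. ennreal (norm (conv (\<rho> (s m)) w x) powr (2 * d / (d - 2)))) \<in> borel_measurable lborel" for m
    proof -
      note [measurable] = wm[of "s m"]
      show ?thesis by measurable
    qed
    show "(\<integral>\<^sup>+x. ennreal (norm (conv (\<rho> (s m)) w x) powr (2 * d / (d - 2))) \<partial>lborel) \<le> B" for m
      using bd[of "s m"] unfolding Lpow_def .
    show "AE x in lborel. (\<lambda>m. ennreal (norm (conv (\<rho> (s m)) w x) powr (2 * d / (d - 2)))) \<longlonglongrightarrow> ennreal (norm (w x) powr (2 * d / (d - 2)))"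
      using s(2)
    proof eventually_elim
      case (elim x)
      then show ?case using d by (intro tendsto_ennrealI tendsto_powr2 tendsto_norm tendsto_const) auto
    qed
  qed
  with B show ?thesis unfolding d_def by simp
qed

text \<open>The sum is the integral of \<open>g\<close> against the kernel $-D_{y_j}[(a(x)-a(y))\rho(x-y)]$, whose total mass
  is $0$.\<close>

lemma commutator2_bound:
  fixes a :: "real^'n::finite \<Rightarrow> complex"
  assumes a: "a \<in> test_functions UNIV" and A: "A > 0"
  obtains C where "C \<ge> 0" "\<And>\<epsilon> \<rho> g x. mollifier A \<epsilon> \<rho> \<Longrightarrow> \<epsilon> > 0 \<Longrightarrow> integrable lborel g \<Longrightarrow>
    ennreal (norm (a x * conv (D j \<rho>) g x + (LINT y|lborel. g y * D j (\<lambda>y. a y * \<rho> (x - y)) y))) \<le> ennreal C * osc \<epsilon> g x"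
proof -
  obtain L where L: "L > 0" "\<And>x y. norm (a x - a y) \<le> L * norm (x - y)" by (rule test_lipschitz[OF a]) blast
  obtain B where B: "B > 0" "\<And>x. norm (D j a x) \<le> B" by (rule test_bounded[OF test_D[OF a]]) blast
  show ?thesis
  proof (rule that[of "(L + B) * A"])
    show "(L + B) * A \<ge> 0" using L B A by simp
    fix \<epsilon> :: real and \<rho> g :: "real^'n \<Rightarrow> complex" and x
    assume \<rho>: "mollifier A \<epsilon> \<rho>" and \<epsilon>: "\<epsilon> > 0" and g: "integrable lborel g"
    have gm: "g \<in> borel_measurable borel" using g by auto
    note m [measurable] = mollifierD(7)[OF \<rho>] test_borel[OF test_D[OF mollifierD(1)[OF \<rho>]], of j] test_borel[OF a] test_borel[OF test_D[OF a], of j] gm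
    define k where "k y = (a x - a y) * D j \<rho> (x - y) + D j a y * \<rho> (x - y)" for y
    have km [measurable]: "k \<in> borel_measurable borel" unfolding k_def by measurable
    have \<eta>: "(\<lambda>y. \<rho> (x - y)) \<in> test_functions UNIV" by (rule mollifier_reflect_test[OF \<rho>]) simp
    have Dprod: "D j (\<lambda>y. a y * \<rho> (x - y)) y = D j a y * \<rho> (x - y) - a y * D j \<rho> (x - y)" for y
      by (subst D_mult) (auto simp: test_differentiable[OF a] test_differentiable[OF \<eta>] D_mollifier_reflect[OF \<rho>])
    have kD: "k y = - D j (\<lambda>y. (a x + (- 1) * a y) * \<rho> (x - y)) y" for y
    proof -
      have s: "smooth_on UNIV (\<lambda>y. a x + (- 1) * a y)"
        unfolding smooth_on_def using test_smooth[OF a] unfolding smooth_on_def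
        by (intro allI Ck_on_add Ck_on_const Ck_on_mult) auto
      have "D j (\<lambda>y. a x + (- 1) * a y) y = - D j a y"
      proof -
        have "((\<lambda>y. a x + (- 1) * a y) has_derivative (\<lambda>v. 0 + ((- 1) * frechet_derivative a (at y) v))) (at y)"
          using test_differentiable[OF a, of y] unfolding frechet_derivative_works
          by (intro has_derivative_add has_derivative_const has_derivative_mult_right)
        from frechet_derivative_at[OF this, symmetric] show ?thesis unfolding D_def by simp
      qed
      then show ?thesis unfolding k_def
        using smooth_on_differentiable[OF s, of y]
        by (subst D_mult) (auto simp: test_differentiable[OF \<eta>] D_mollifier_reflect[OF \<rho>] algebra_simps)
    qed
    have kt: "(\<lambda>y. (a x + (- 1) * a y) * \<rho> (x - y)) \<in> test_functions UNIV"
    proof (rule test_mult(1)[OF \<eta>])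
      show "smooth_on UNIV (\<lambda>y. a x + (- 1) * a y)"
        unfolding smooth_on_def using test_smooth[OF a] unfolding smooth_on_def
        by (intro allI Ck_on_add Ck_on_const Ck_on_mult) auto
    qed
    have ki: "integrable lborel k"
      using integrable_test[OF test_D[OF kt, of j]] unfolding kD[abs_def] by simp
    have k0: "(LINT y|lborel. k y) = 0"
      using integral_D_test[OF kt, of j] unfolding kD by simp
    have kz: "k y = 0" if "y \<notin> ball x \<epsilon>" for y
      using that mollifierD(3)[OF \<rho>, of "x - y"] mollifier_D_outside[OF \<rho> \<epsilon>, of "x - y" j] by (simp add: k_def dist_norm)
    have kb: "norm (k y) \<le> (L + B) * A / \<epsilon> ^ CARD('n)" for y
    proof (cases "norm (x - y) < \<epsilon>")
      case True
      have "norm (k y) \<le> norm (a x - a y) * norm (D j \<rho> (x - y)) + norm (D j a y) * norm (\<rho> (x - y))"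
        unfolding k_def using norm_triangle_ineq[of "(a x - a y) * D j \<rho> (x - y)" "D j a y * \<rho> (x - y)"] by (simp add: norm_mult)
      \<comment> \<open>The derivative of the mollifier costs one more power of 1/\<epsilon>; the
        Lipschitz bound for \<open>a\<close> on the \<epsilon>-ball gains it back. This gain is the
        heart of Friedrichs' lemma.\<close>
      also have "\<dots> \<le> (L * \<epsilon>) * (A / \<epsilon> ^ Suc CARD('n)) + B * (A / \<epsilon> ^ CARD('n))"
      proof (intro add_mono mult_mono mollifierD(5)[OF \<rho>] mollifierD(6)[OF \<rho>] B)
        have "norm (a x - a y) \<le> L * norm (x - y)" by (rule L)
        also have "\<dots> \<le> L * \<epsilon>" using L True by (intro mult_left_mono) auto
        finally show "norm (a x - a y) \<le> L * \<epsilon>" .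
      qed (use L B \<epsilon> in auto)
      also have "\<dots> = (L + B) * A / \<epsilon> ^ CARD('n)" using \<epsilon> by (simp add: field_simps)
      finally show ?thesis .
    qed (use kz L B A \<epsilon> in \<open>auto simp: dist_norm\<close>)
    have "a x * conv (D j \<rho>) g x + (LINT y|lborel. g y * D j (\<lambda>y. a y * \<rho> (x - y)) y)
      = (LINT y|lborel. a x * (D j \<rho> (x - y) * g y)) + (LINT y|lborel. g y * D j (\<lambda>y. a y * \<rho> (x - y)) y)"
      unfolding conv_def by simp
    also have "\<dots> = (LINT y|lborel. a x * (D j \<rho> (x - y) * g y) + g y * D j (\<lambda>y. a y * \<rho> (x - y)) y)"
    proof (rule Bochner_Integration.integral_add[symmetric])
      show "integrable lborel (\<lambda>y. a x * (D j \<rho> (x - y) * g y))"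
        by (intro integrable_mult_right integrable_conv[OF test_D[OF mollifierD(1)[OF \<rho>]] g])
      have "(\<lambda>y. a y * \<rho> (x - y)) \<in> test_functions UNIV" by (rule test_mult(1)[OF \<eta> test_smooth[OF a]])
      from integrable_test_mult[OF test_D[OF this] g] show "integrable lborel (\<lambda>y. g y * D j (\<lambda>y. a y * \<rho> (x - y)) y)"
        by (simp add: mult.commute)
    qed
    also have "\<dots> = (LINT y|lborel. k y * g y)"
      unfolding Dprod k_def by (intro Bochner_Integration.integral_cong) (auto simp: algebra_simps)
    also have "\<dots> = (LINT y|lborel. k y * g y) - (LINT y|lborel. k y * g x)" using k0 by simp
    also have "\<dots> = (LINT y|lborel. k y * (g y - g x))"
      by (subst Bochner_Integration.integral_diff[symmetric])
        (use ki integrable_bounded_mult[OF g, of k, OF _ kb] km in \<open>auto simp: algebra_simps\<close>)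
    finally show "ennreal (norm (a x * conv (D j \<rho>) g x + (LINT y|lborel. g y * D j (\<lambda>y. a y * \<rho> (x - y)) y))) \<le> ennreal ((L + B) * A) * osc \<epsilon> g x"
      using kernel_osc_bound[OF gm km _ kb kz \<epsilon>] L B A by simp
  qed
qed

text \<open>No derivative falls on the mollifier, so the kernel (b(x) - b(y)) \<rho>(x - y) is
  already small; but its total mass need not vanish. Splitting off g(x) leaves a term with the mass,
  which is at most L \<epsilon>, in front of g(x).\<close>

lemma commutator1_bound:
  fixes b :: "real^'n::finite \<Rightarrow> complex"
  assumes b: "b \<in> test_functions UNIV" and A: "A > 0"
  obtains C where "C \<ge> 0" "\<And>\<epsilon> \<rho> g x. mollifier A \<epsilon> \<rho> \<Longrightarrow> \<epsilon> > 0 \<Longrightarrow> \<epsilon> \<le> 1 \<Longrightarrow> integrable lborel g \<Longrightarrow>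
    ennreal (norm (b x * conv \<rho> g x - (LINT y|lborel. b y * g y * \<rho> (x - y)))) \<le> ennreal C * (osc \<epsilon> g x + ennreal \<epsilon> * ennreal (norm (g x)))"
proof -
  obtain L where L: "L > 0" "\<And>x y. norm (b x - b y) \<le> L * norm (x - y)" by (rule test_lipschitz[OF b]) blast
  obtain B where B: "B > 0" "\<And>x. norm (b x) \<le> B" by (rule test_bounded[OF b]) blast
  show ?thesis
  proof (rule that[of "L * (A + 1)"])
    show "L * (A + 1) \<ge> 0" using L A by simp
    fix \<epsilon> :: real and \<rho> g :: "real^'n \<Rightarrow> complex" and x
    assume \<rho>: "mollifier A \<epsilon> \<rho>" and \<epsilon>: "\<epsilon> > 0" "\<epsilon> \<le> 1" and g: "integrable lborel g"
    have gm: "g \<in> borel_measurable borel" using g by auto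
    note m [measurable] = mollifierD(7)[OF \<rho>] test_borel[OF b] gm
    define k where "k y = (b x - b y) * \<rho> (x - y)" for y
    have km [measurable]: "k \<in> borel_measurable borel" unfolding k_def by measurable
    have kz: "k y = 0" if "y \<notin> ball x \<epsilon>" for y
      using that mollifierD(3)[OF \<rho>, of "x - y"] by (simp add: k_def dist_norm)
    have kr: "norm (k y) \<le> (L * \<epsilon>) * norm (\<rho> (x - y))" for y
    proof (cases "y \<in> ball x \<epsilon>")
      case True
      have "norm (b x - b y) \<le> L * norm (x - y)" by (rule L)
      also have "\<dots> \<le> L * \<epsilon>" using L True by (intro mult_left_mono) (auto simp: dist_norm)
      finally show ?thesis unfolding k_def norm_mult by (intro mult_right_mono) auto
    qed (use kz L \<epsilon> in auto)
    have kb: "norm (k y) \<le> (L * A) / \<epsilon> ^ CARD('n)" for y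
    proof -
      note kr[of y]
      also have "(L * \<epsilon>) * norm (\<rho> (x - y)) \<le> (L * 1) * (A / \<epsilon> ^ CARD('n))"
        using L \<epsilon> A by (intro mult_mono mollifierD(5)[OF \<rho>]) auto
      finally show ?thesis by simp
    qed
    have \<eta>: "(\<lambda>y. \<rho> (x - y)) \<in> test_functions UNIV" by (rule mollifier_reflect_test[OF \<rho>]) simp
    have i\<eta>: "integrable lborel (\<lambda>y. \<rho> (x - y))" by (rule integrable_test[OF \<eta>])
    have ki: "integrable lborel k"
      by (rule Bochner_Integration.integrable_bound[of _ "\<lambda>y. (L * \<epsilon>) * norm (\<rho> (x - y))"])
        (use i\<eta> kr L \<epsilon> in auto)
    have k1: "norm (LINT y|lborel. k y) \<le> L * \<epsilon>"
    proof -
      have "norm (LINT y|lborel. k y) \<le> (LINT y|lborel. (L * \<epsilon>) * norm (\<rho> (x - y)))"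
        by (rule Bochner_Integration.integral_norm_bound_integral[OF ki _ kr]) (use i\<eta> in auto)
      also have "\<dots> = L * \<epsilon> * (LINT y|lborel. norm (\<rho> (x - y)))" by simp
      also have "(LINT y|lborel. norm (\<rho> (x - y))) = 1"
        by (subst integral_eq_nn_integral)
          (use nn_integral_reflect[of "\<lambda>y. ennreal (norm (\<rho> y))" x] mollifierD(4)[OF \<rho>] in auto)
      finally show ?thesis by simp
    qed
    have kg: "integrable lborel (\<lambda>y. k y * g y)" by (rule integrable_bounded_mult[OF g _ kb]) simp
    have bg: "integrable lborel (\<lambda>y. b y * g y)" by (rule integrable_bounded_mult[OF g _ B(2)]) simp
    have "b x * conv \<rho> g x - (LINT y|lborel. b y * g y * \<rho> (x - y)) =
      (LINT y|lborel. b x * (\<rho> (x - y) * g y)) - (LINT y|lborel. \<rho> (x - y) * (b y * g y))"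
      unfolding conv_def by (simp add: mult_ac)
    also have "\<dots> = (LINT y|lborel. b x * (\<rho> (x - y) * g y) - \<rho> (x - y) * (b y * g y))"
      by (intro Bochner_Integration.integral_diff[symmetric] integrable_mult_right integrable_conv[OF mollifierD(1)[OF \<rho>]] g bg)
    also have "\<dots> = (LINT y|lborel. k y * g y)"
      unfolding k_def by (intro Bochner_Integration.integral_cong) (auto simp: algebra_simps)
    also have "\<dots> = (LINT y|lborel. k y * (g y - g x) + k y * g x)"
      by (intro Bochner_Integration.integral_cong) (auto simp: algebra_simps)
    also have "\<dots> = (LINT y|lborel. k y * (g y - g x)) + (LINT y|lborel. k y * g x)"
    proof (rule Bochner_Integration.integral_add)
      have "integrable lborel (\<lambda>y. k y * g y - k y * g x)" using kg ki by simp
      then show "integrable lborel (\<lambda>y. k y * (g y - g x))" by (simp add: algebra_simps)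
    qed (use ki in simp)
    also have "(LINT y|lborel. k y * g x) = (LINT y|lborel. k y) * g x" by simp
    finally have eq: "b x * conv \<rho> g x - (LINT y|lborel. b y * g y * \<rho> (x - y)) = (LINT y|lborel. k y * (g y - g x)) + (LINT y|lborel. k y) * g x" .
    have "norm ((LINT y|lborel. k y) * g x) \<le> L * \<epsilon> * norm (g x)"
      unfolding norm_mult by (intro mult_right_mono k1) auto
    then have "norm (b x * conv \<rho> g x - (LINT y|lborel. b y * g y * \<rho> (x - y))) \<le> norm (LINT y|lborel. k y * (g y - g x)) + L * \<epsilon> * norm (g x)"
      unfolding eq using norm_triangle_ineq order_trans add_left_mono by meson
    then have "ennreal (norm (b x * conv \<rho> g x - (LINT y|lborel. b y * g y * \<rho> (x - y)))) \<le> ennreal (norm (LINT y|lborel. k y * (g y - g x)) + L * \<epsilon> * norm (g x))"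
      by (rule ennreal_leI)
    also have "\<dots> = ennreal (norm (LINT y|lborel. k y * (g y - g x))) + ennreal L * (ennreal \<epsilon> * ennreal (norm (g x)))"
      using L \<epsilon> by (simp add: ennreal_mult[symmetric] mult.assoc)
    also have "\<dots> \<le> ennreal (L * A) * osc \<epsilon> g x + ennreal L * (ennreal \<epsilon> * ennreal (norm (g x)))"
      by (intro add_right_mono kernel_osc_bound[OF gm km _ kb kz \<epsilon>(1)]) (use L A in auto)
    also have "\<dots> \<le> ennreal (L * (A + 1)) * osc \<epsilon> g x + ennreal (L * (A + 1)) * (ennreal \<epsilon> * ennreal (norm (g x)))"
      using L A by (intro add_mono mult_right_mono ennreal_leI) (auto simp: algebra_simps)
    finally show "ennreal (norm (b x * conv \<rho> g x - (LINT y|lborel. b y * g y * \<rho> (x - y)))) \<le> ennreal (L * (A + 1)) * (osc \<epsilon> g x + ennreal \<epsilon> * ennreal (norm (g x)))"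
      by (simp add: distrib_left)
  qed
qed

section \<open>Extension of the Carleman estimate\<close>

text \<open>$P(x,D)w = f$ in the sense of distributions, with \<open>g k\<close> standing for $D_k w$, so that only one
  derivative falls on the test function.\<close>

definition weak_eq :: "'n::finite diffop2 \<Rightarrow> (real^'n) set \<Rightarrow> (real^'n \<Rightarrow> complex) \<Rightarrow> ('n \<Rightarrow> real^'n \<Rightarrow> complex) \<Rightarrow> (real^'n \<Rightarrow> complex) \<Rightarrow> bool" where
  "weak_eq P B w g f \<longleftrightarrow> (\<forall>\<eta>\<in>test_functions B.
     - (\<Sum>j\<in>UNIV. \<Sum>k\<in>UNIV. LINT y|lborel. g k y * D j (\<lambda>y. coeff2 P j k y * \<eta> y) y)
     + (\<Sum>j\<in>UNIV. LINT y|lborel. coeff1 P j y * g j y * \<eta> y) + (LINT y|lborel. coeff0 P y * w y * \<eta> y)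
     = (LINT y|lborel. f y * \<eta> y))"

text \<open>Met by coefficients multiplied by a cutoff function. They and all their derivatives are
  bounded on the whole space, so the commutator constants are global.\<close>

definition test_coeffs :: "'n::finite diffop2 \<Rightarrow> bool" where
  "test_coeffs P \<longleftrightarrow> (\<forall>j k. coeff2 P j k \<in> test_functions UNIV) \<and> (\<forall>j. coeff1 P j \<in> test_functions UNIV) \<and> coeff0 P \<in> test_functions UNIV"

text \<open>The weak equation tested with y -> \<rho>(x - y), admissible when the \<epsilon>-ball
  around \<open>x\<close> lies in \<open>B\<close>. Subtracted term by term from P applied to the
  convolution, it leaves one commutator for each coefficient; the plus sign at second order comes
  from the reflection.\<close>

lemma apply_op_conv:
  fixes \<rho> w :: "real^'n::finite \<Rightarrow> complex"
  assumes \<rho>: "mollifier A \<epsilon> \<rho>" and w: "integrable lborel w" and g: "\<And>k. integrable lborel (g k)"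
    and wk: "\<And>k. weak_D UNIV k w (g k)" and eq: "weak_eq P B w g f" and x: "cball x \<epsilon> \<subseteq> B"
  shows "apply_op P (conv \<rho> w) x - conv \<rho> f x =
    (\<Sum>j\<in>UNIV. \<Sum>k\<in>UNIV. coeff2 P j k x * conv (D j \<rho>) (g k) x + (LINT y|lborel. g k y * D j (\<lambda>y. coeff2 P j k y * \<rho> (x - y)) y))
    + (\<Sum>j\<in>UNIV. coeff1 P j x * conv \<rho> (g j) x - (LINT y|lborel. coeff1 P j y * g j y * \<rho> (x - y)))
    + (coeff0 P x * conv \<rho> w x - (LINT y|lborel. coeff0 P y * w y * \<rho> (x - y)))"
proof -
  have "conv \<rho> f x = (LINT y|lborel. f y * \<rho> (x - y))" unfolding conv_def by (simp add: mult.commute)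
  also have "\<dots> = - (\<Sum>j\<in>UNIV. \<Sum>k\<in>UNIV. LINT y|lborel. g k y * D j (\<lambda>y. coeff2 P j k y * \<rho> (x - y)) y)
     + (\<Sum>j\<in>UNIV. LINT y|lborel. coeff1 P j y * g j y * \<rho> (x - y)) + (LINT y|lborel. coeff0 P y * w y * \<rho> (x - y))"
    using bspec[OF eq[unfolded weak_eq_def] mollifier_reflect_test[OF \<rho> x]] by simp
  finally have f: "conv \<rho> f x = \<dots>" .
  show ?thesis unfolding f apply_op_def D_conv_weak[OF \<rho> w wk] D_conv[OF mollifierD(1)[OF \<rho>] g]
    by (simp add: sum.distrib sum_subtractf)
qed

section \<open>Null sequences in L^2 and Friedrichs' lemma\<close>

definition L2null :: "(nat \<Rightarrow> 'a::euclidean_space \<Rightarrow> ennreal) \<Rightarrow> bool" where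
  "L2null F \<longleftrightarrow> (\<forall>m. F m \<in> borel_measurable borel) \<and> (\<lambda>m. \<integral>\<^sup>+x. (F m x)\<^sup>2 \<partial>lborel) \<longlonglongrightarrow> 0"

lemma L2null_0: "L2null (\<lambda>m x. 0)"
  by (simp add: L2null_def)

lemma square_add_le_ennreal: "(a + b)\<^sup>2 \<le> 4 * (a\<^sup>2 + (b::ennreal)\<^sup>2)"
proof -
  have "(a + b)\<^sup>2 \<le> (2 * max a b)\<^sup>2"
    by (intro power_mono) (auto simp: mult_2 intro!: add_mono)
  also have "\<dots> = 4 * (max a b)\<^sup>2" by (simp add: power_mult_distrib)
  also have "(max a b)\<^sup>2 \<le> a\<^sup>2 + b\<^sup>2" by (simp add: max_def)
  finally show ?thesis by (simp add: mult_left_mono)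
qed

lemma L2null_add:
  assumes "L2null F" "L2null G"
  shows "L2null (\<lambda>m x. F m x + G m x)"
proof -
  have [measurable]: "F m \<in> borel_measurable borel" "G m \<in> borel_measurable borel" for m
    using assms by (auto simp: L2null_def)
  have "(\<lambda>m. 4 * ((\<integral>\<^sup>+x. (F m x)\<^sup>2 \<partial>lborel) + (\<integral>\<^sup>+x. (G m x)\<^sup>2 \<partial>lborel))) \<longlonglongrightarrow> 4 * (0 + 0)"
    using assms unfolding L2null_def by (intro ennreal_tendsto_cmult tendsto_add) auto
  then have l: "(\<lambda>m. 4 * ((\<integral>\<^sup>+x. (F m x)\<^sup>2 \<partial>lborel) + (\<integral>\<^sup>+x. (G m x)\<^sup>2 \<partial>lborel))) \<longlonglongrightarrow> 0" by simp
  have "(\<integral>\<^sup>+x. (F m x + G m x)\<^sup>2 \<partial>lborel) \<le> 4 * ((\<integral>\<^sup>+x. (F m x)\<^sup>2 \<partial>lborel) + (\<integral>\<^sup>+x. (G m x)\<^sup>2 \<partial>lborel))" for m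
  proof -
    have "(\<integral>\<^sup>+x. (F m x + G m x)\<^sup>2 \<partial>lborel) \<le> (\<integral>\<^sup>+x. 4 * ((F m x)\<^sup>2 + (G m x)\<^sup>2) \<partial>lborel)"
      by (intro nn_integral_mono square_add_le_ennreal)
    also have "\<dots> = 4 * ((\<integral>\<^sup>+x. (F m x)\<^sup>2 \<partial>lborel) + (\<integral>\<^sup>+x. (G m x)\<^sup>2 \<partial>lborel))"
      by (simp add: nn_integral_cmult nn_integral_add)
    finally show ?thesis .
  qed
  then have "(\<lambda>m. \<integral>\<^sup>+x. (F m x + G m x)\<^sup>2 \<partial>lborel) \<longlonglongrightarrow> 0"
    by (intro tendsto_sandwich[OF _ _ tendsto_const l]) auto
  then show ?thesis unfolding L2null_def by auto
qed

lemma L2null_sum: "finite I \<Longrightarrow> (\<And>i. i \<in> I \<Longrightarrow> L2null (F i)) \<Longrightarrow> L2null (\<lambda>m x. \<Sum>i\<in>I. F i m x)"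
  by (induction I rule: finite_induct) (auto intro: L2null_0 L2null_add)

lemma L2null_cmult:
  assumes "L2null F" "c < top"
  shows "L2null (\<lambda>m x. c * F m x)"
proof -
  have [measurable]: "F m \<in> borel_measurable borel" for m using assms by (auto simp: L2null_def)
  have "(\<integral>\<^sup>+x. (c * F m x)\<^sup>2 \<partial>lborel) = c\<^sup>2 * (\<integral>\<^sup>+x. (F m x)\<^sup>2 \<partial>lborel)" for m
    by (simp add: power_mult_distrib nn_integral_cmult)
  moreover have "(\<lambda>m. c\<^sup>2 * (\<integral>\<^sup>+x. (F m x)\<^sup>2 \<partial>lborel)) \<longlonglongrightarrow> c\<^sup>2 * 0"
    using assms by (intro ennreal_tendsto_cmult) (auto simp: L2null_def power_less_top_ennreal)
  ultimately show ?thesis unfolding L2null_def by simp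
qed

lemma L2null_osc:
  fixes g :: "real^'n::finite \<Rightarrow> complex"
  assumes "g \<in> borel_measurable borel" "Lpow 2 g < \<infinity>"
  shows "L2null (\<lambda>m. osc (1 / real (Suc m)) g)"
  unfolding L2null_def using osc_tendsto[OF assms] osc_measurable[OF assms(1)] by simp

lemma L2null_scale:
  fixes g :: "real^'n::finite \<Rightarrow> complex"
  assumes [measurable]: "g \<in> borel_measurable borel" and fin: "Lpow 2 g < \<infinity>"
  shows "L2null (\<lambda>m x. ennreal (1 / real (Suc m)) * ennreal (norm (g x)))"
proof -
  have "(\<integral>\<^sup>+x. (ennreal (1 / real (Suc m)) * ennreal (norm (g x)))\<^sup>2 \<partial>lborel) = Lpow 2 g * ennreal ((1 / real (Suc m))\<^sup>2)" for m
  proof -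
    have "(\<integral>\<^sup>+x. (ennreal (1 / real (Suc m)) * ennreal (norm (g x)))\<^sup>2 \<partial>lborel) = (\<integral>\<^sup>+x. ennreal (norm (g x) powr 2) * ennreal ((1 / real (Suc m))\<^sup>2) \<partial>lborel)"
      unfolding power_mult_distrib by (intro nn_integral_cong) (simp add: ennreal_power powr_numeral mult.commute)
    then show ?thesis by (simp add: nn_integral_multc Lpow_def)
  qed
  moreover have "(\<lambda>m. Lpow 2 g * ennreal ((1 / real (Suc m))\<^sup>2)) \<longlonglongrightarrow> Lpow 2 g * ennreal (0\<^sup>2)"
    using fin by (intro ennreal_tendsto_cmult tendsto_ennrealI tendsto_power LIMSEQ_Suc[OF lim_1_over_n]) auto
  ultimately show ?thesis unfolding L2null_def by simp
qed

text \<open>The majorant \<open>H\<close> is the sum of the commutator bounds for all coefficients.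
  The estimate is pointwise because the equation holds in \<open>B\<close> only, so that it can be
  claimed only where the mollification ball stays inside \<open>B\<close>.\<close>

lemma friedrichs:
  fixes w f :: "real^'n::finite \<Rightarrow> complex"
  assumes P: "test_coeffs P" and A: "A > 0" and \<rho>: "\<And>m. mollifier A (1 / real (Suc m)) (\<rho> m)"
    and w: "w \<in> borel_measurable borel" "Lpow 2 w < \<infinity>" "integrable lborel w"
    and g: "\<And>k. g k \<in> borel_measurable borel" "\<And>k. Lpow 2 (g k) < \<infinity>" "\<And>k. integrable lborel (g k)"
    and wk: "\<And>k. weak_D UNIV k w (g k)" and eq: "weak_eq P B w g f"
  obtains H where "L2null H" "\<And>m x. cball x (1 / real (Suc m)) \<subseteq> B \<Longrightarrow>
    ennreal (norm (apply_op P (conv (\<rho> m) w) x - conv (\<rho> m) f x)) \<le> H m x"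
proof -
  let ?e = "\<lambda>m. 1 / real (Suc m)"
  have "\<forall>j k. \<exists>C. C \<ge> 0 \<and> (\<forall>\<epsilon> \<rho> g x. mollifier A \<epsilon> \<rho> \<longrightarrow> \<epsilon> > 0 \<longrightarrow> integrable lborel g \<longrightarrow>
    ennreal (norm (coeff2 P j k x * conv (D j \<rho>) g x + (LINT y|lborel. g y * D j (\<lambda>y. coeff2 P j k y * \<rho> (x - y)) y))) \<le> ennreal C * osc \<epsilon> g x)"
  proof (intro allI)
    fix j k
    have a: "coeff2 P j k \<in> test_functions UNIV" using P by (simp add: test_coeffs_def)
    show "\<exists>C. C \<ge> 0 \<and> (\<forall>\<epsilon> \<rho> g x. mollifier A \<epsilon> \<rho> \<longrightarrow> \<epsilon> > 0 \<longrightarrow> integrable lborel g \<longrightarrow>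
      ennreal (norm (coeff2 P j k x * conv (D j \<rho>) g x + (LINT y|lborel. g y * D j (\<lambda>y. coeff2 P j k y * \<rho> (x - y)) y))) \<le> ennreal C * osc \<epsilon> g x)"
      by (rule commutator2_bound[OF a A, of j]) blast
  qed
  then obtain C2 where C2: "\<And>j k \<epsilon> \<rho> g x. mollifier A \<epsilon> \<rho> \<Longrightarrow> \<epsilon> > 0 \<Longrightarrow> integrable lborel g \<Longrightarrow>
    ennreal (norm (coeff2 P j k x * conv (D j \<rho>) g x + (LINT y|lborel. g y * D j (\<lambda>y. coeff2 P j k y * \<rho> (x - y)) y))) \<le> ennreal (C2 j k) * osc \<epsilon> g x"
    unfolding choice_iff by blast
  have "\<forall>j. \<exists>C. C \<ge> 0 \<and> (\<forall>\<epsilon> \<rho> g x. mollifier A \<epsilon> \<rho> \<longrightarrow> \<epsilon> > 0 \<longrightarrow> \<epsilon> \<le> 1 \<longrightarrow> integrable lborel g \<longrightarrow>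
    ennreal (norm (coeff1 P j x * conv \<rho> g x - (LINT y|lborel. coeff1 P j y * g y * \<rho> (x - y)))) \<le> ennreal C * (osc \<epsilon> g x + ennreal \<epsilon> * ennreal (norm (g x))))"
  proof
    fix j
    have a: "coeff1 P j \<in> test_functions UNIV" using P by (simp add: test_coeffs_def)
    show "\<exists>C. C \<ge> 0 \<and> (\<forall>\<epsilon> \<rho> g x. mollifier A \<epsilon> \<rho> \<longrightarrow> \<epsilon> > 0 \<longrightarrow> \<epsilon> \<le> 1 \<longrightarrow> integrable lborel g \<longrightarrow>
      ennreal (norm (coeff1 P j x * conv \<rho> g x - (LINT y|lborel. coeff1 P j y * g y * \<rho> (x - y)))) \<le> ennreal C * (osc \<epsilon> g x + ennreal \<epsilon> * ennreal (norm (g x))))"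
      by (rule commutator1_bound[OF a A]) blast
  qed
  then obtain C1 where C1: "\<And>j \<epsilon> \<rho> g x. mollifier A \<epsilon> \<rho> \<Longrightarrow> \<epsilon> > 0 \<Longrightarrow> \<epsilon> \<le> 1 \<Longrightarrow> integrable lborel g \<Longrightarrow>
    ennreal (norm (coeff1 P j x * conv \<rho> g x - (LINT y|lborel. coeff1 P j y * g y * \<rho> (x - y)))) \<le> ennreal (C1 j) * (osc \<epsilon> g x + ennreal \<epsilon> * ennreal (norm (g x)))"
    unfolding choice_iff by blast
  obtain C0 where C0: "\<And>\<epsilon> \<rho> g x. mollifier A \<epsilon> \<rho> \<Longrightarrow> \<epsilon> > 0 \<Longrightarrow> \<epsilon> \<le> 1 \<Longrightarrow> integrable lborel g \<Longrightarrow>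
    ennreal (norm (coeff0 P x * conv \<rho> g x - (LINT y|lborel. coeff0 P y * g y * \<rho> (x - y)))) \<le> ennreal C0 * (osc \<epsilon> g x + ennreal \<epsilon> * ennreal (norm (g x)))"
  proof -
    have a: "coeff0 P \<in> test_functions UNIV" using P by (simp add: test_coeffs_def)
    show thesis by (rule commutator1_bound[OF a A]) (rule that, blast)
  qed
  define H where "H m x = (\<Sum>j\<in>UNIV. \<Sum>k\<in>UNIV. ennreal (C2 j k) * osc (?e m) (g k) x)
    + (\<Sum>j\<in>UNIV. ennreal (C1 j) * (osc (?e m) (g j) x + ennreal (?e m) * ennreal (norm (g j x))))
    + ennreal C0 * (osc (?e m) w x + ennreal (?e m) * ennreal (norm (w x)))" for m x
  show ?thesis
  proof (rule that[of H])
    show "L2null H" unfolding H_def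
      by (intro L2null_add L2null_sum L2null_cmult L2null_osc L2null_scale w g) auto
    fix m x assume x: "cball x (?e m) \<subseteq> B"
    have en: "ennreal (norm (a + b)) \<le> ennreal (norm a) + ennreal (norm b)" for a b :: complex
      using norm_triangle_ineq[of a b] by (simp add: ennreal_plus[symmetric] ennreal_leI del: ennreal_plus)
    have es: "ennreal (norm (\<Sum>i\<in>I. h i)) \<le> (\<Sum>i\<in>I. ennreal (norm (h i)))" for h :: "'n \<Rightarrow> complex" and I
      by (subst sum_ennreal) (auto intro: ennreal_leI norm_sum)
    show "ennreal (norm (apply_op P (conv (\<rho> m) w) x - conv (\<rho> m) f x)) \<le> H m x"
      unfolding apply_op_conv[OF \<rho> w(3) g(3) wk eq x] H_def
    proof (rule order_trans[OF en add_mono[OF order_trans[OF en add_mono]]])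
      have e: "0 < ?e m" "?e m \<le> 1" by (auto simp: divide_le_eq)
      show "ennreal (norm (coeff0 P x * conv (\<rho> m) w x - (LINT y|lborel. coeff0 P y * w y * \<rho> m (x - y))))
        \<le> ennreal C0 * (osc (?e m) w x + ennreal (?e m) * ennreal (norm (w x)))"
        by (rule C0[OF \<rho> e w(3)])
      show "ennreal (norm (\<Sum>j\<in>UNIV. coeff1 P j x * conv (\<rho> m) (g j) x - (LINT y|lborel. coeff1 P j y * g j y * \<rho> m (x - y))))
        \<le> (\<Sum>j\<in>UNIV. ennreal (C1 j) * (osc (?e m) (g j) x + ennreal (?e m) * ennreal (norm (g j x))))"
        by (rule order_trans[OF es sum_mono]) (rule C1[OF \<rho> e g(3)])
      show "ennreal (norm (\<Sum>j\<in>UNIV. \<Sum>k\<in>UNIV. coeff2 P j k x * conv (D j (\<rho> m)) (g k) x + (LINT y|lborel. g k y * D j (\<lambda>y. coeff2 P j k y * \<rho> m (x - y)) y)))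
        \<le> (\<Sum>j\<in>UNIV. \<Sum>k\<in>UNIV. ennreal (C2 j k) * osc (?e m) (g k) x)"
        by (rule order_trans[OF es sum_mono], rule order_trans[OF es sum_mono], rule C2[OF \<rho> e(1) g(3)])
    qed
  qed
qed

lemma epowr_2: "epowr x 2 = x\<^sup>2"
  using epowr_add[of 1 1 x] by (simp add: power2_eq_square)

lemma apply_op_outside:
  assumes "open S" "x \<in> S" "\<And>y. y \<in> S \<Longrightarrow> u y = 0"
  shows "apply_op P u x = 0"
proof -
  have D0: "D k u y = 0" if "y \<in> S" for k y
    unfolding D_def using frechet_derivative_zero_on[OF assms(1) that assms(3)] by simp
  have "D j (D k u) x = 0" for j k
    unfolding D_def[of j] using frechet_derivative_zero_on[OF assms(1,2) D0] by simp
  then show ?thesis unfolding apply_op_def using D0[OF assms(2)] assms(3)[OF assms(2)] by simp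
qed

lemma apply_op_borel:
  assumes P: "test_coeffs P" and u: "u \<in> test_functions \<Omega>"
  shows "apply_op P u \<in> borel_measurable borel"
proof -
  have [measurable]: "coeff2 P j k \<in> borel_measurable borel" "coeff1 P j \<in> borel_measurable borel" "coeff0 P \<in> borel_measurable borel" for j k
    using P test_borel unfolding test_coeffs_def by blast+
  have [measurable]: "D j u \<in> borel_measurable borel" "D j (D k u) \<in> borel_measurable borel" "u \<in> borel_measurable borel" for j k
    using test_borel[OF u] test_borel[OF test_D[OF u]] test_borel[OF test_D[OF test_D[OF u]]] by blast+
  show ?thesis unfolding apply_op_def[abs_def] by measurable
qed

text \<open>On a compact ball the continuous function E^q has a positive minimum, and uniform
  continuity keeps its variation below this minimum at distance \<open>d\<close>. Only
  \<open>d\<close> depends on the weight, and the factor 2 does not: hence uniformity in \<tau> of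
  the extended estimate.\<close>

lemma weight_ratio:
  fixes E :: "real^'n::finite \<Rightarrow> real"
  assumes "continuous_on UNIV E" "\<And>x. E x > 0" "q \<ge> 0"
  obtains d where "d > 0" "\<And>x y. norm (x - y) < d \<Longrightarrow> y \<in> cball x0 r \<Longrightarrow> E x powr q \<le> 2 * E y powr q"
proof (cases "r \<ge> 0")
  case True
  define F where "F x = E x powr q" for x
  have Fc: "continuous_on UNIV F" unfolding F_def
    using assms(2) by (intro continuous_on_powr assms(1) continuous_on_const) (metis less_irrefl)
  have Fpos: "F x > 0" for x using assms(2)[of x] by (simp add: F_def)
  obtain z where z: "z \<in> cball x0 r" "\<And>y. y \<in> cball x0 r \<Longrightarrow> F z \<le> F y"
    using continuous_attains_inf[of "cball x0 r" F] continuous_on_subset[OF Fc] True by (metis compact_cball cball_eq_empty not_less subset_UNIV)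
  have "uniformly_continuous_on (cball x0 (r + 1)) F"
    by (rule compact_uniformly_continuous[OF continuous_on_subset[OF Fc]]) auto
  then obtain d where d: "d > 0" "\<And>x y. x \<in> cball x0 (r + 1) \<Longrightarrow> y \<in> cball x0 (r + 1) \<Longrightarrow> dist y x < d \<Longrightarrow> dist (F y) (F x) < F z"
    using Fpos[of z] unfolding uniformly_continuous_on_def by metis
  show ?thesis
  proof (rule that[of "min d 1"])
    fix x y assume xy: "norm (x - y) < min d 1" "y \<in> cball x0 r"
    have "dist x0 x \<le> dist x0 y + dist y x" by (rule dist_triangle)
    then have "x \<in> cball x0 (r + 1)" using xy by (auto simp: dist_norm norm_minus_commute)
    then have "dist (F x) (F y) < F z" using xy by (intro d(2)) (auto simp: dist_norm)
    then have "F x \<le> F y + F z" by (simp add: dist_real_def)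
    also have "\<dots> \<le> 2 * F y" using z(2)[OF xy(2)] by simp
    finally show "E x powr q \<le> 2 * E y powr q" by (simp add: F_def)
  qed (use d in auto)
next
  case False
  then show ?thesis using that[of 1] by auto
qed

text \<open>The estimate holds for the mollified \<open>w\<close>. There P w_m is the mollified
  \<open>f\<close>, bounded by weighted Young with factor 2, plus an error that is null in L^2 and,
  by Hoelder's inequality on the ball and q < 2, in L^q; it is absorbed in \<delta>. Fatou's lemma
  gives the estimate for \<open>w\<close>. The loss 2^q * 2 does not involve
  \<open>E\<close>.\<close>

lemma carleman_extend:
  fixes w f :: "real^'n::finite \<Rightarrow> complex" and E :: "real^'n \<Rightarrow> real"
  assumes E: "continuous_on UNIV E" "\<And>x. E x > 0" and q: "1 \<le> q" "q < 2" and s: "s > 0" and p: "p \<ge> 0" and K: "K \<ge> 0"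
    and carl: "\<And>v. v \<in> test_functions (ball x0 R) \<Longrightarrow>
      Lpow s (\<lambda>x. of_real (E x) * v x) \<le> epowr (ennreal K * Lpow q (\<lambda>x. of_real (E x) * apply_op P v x)) p"
    and P: "test_coeffs P"
    and w: "w \<in> borel_measurable borel" "Lpow 2 w < \<infinity>" and g: "\<And>k. g k \<in> borel_measurable borel" "\<And>k. Lpow 2 (g k) < \<infinity>"
    and f: "f \<in> borel_measurable borel" "Lpow q f < \<infinity>"
    and r: "r < R" and supp: "\<And>y. y \<notin> cball x0 r \<Longrightarrow> w y = 0" "\<And>k y. y \<notin> cball x0 r \<Longrightarrow> g k y = 0" "\<And>y. y \<notin> cball x0 r \<Longrightarrow> f y = 0"
    and wk: "\<And>k. weak_D UNIV k w (g k)" and eq: "weak_eq P (ball x0 R) w g f" and \<delta>: "\<delta> > 0"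
  shows "Lpow s (\<lambda>x. of_real (E x) * w x) \<le> epowr (ennreal (K * (2 powr q * 2)) * (Lpow q (\<lambda>x. of_real (E x) * f x) + ennreal \<delta>)) p"
proof -
  obtain A and \<rho> :: "nat \<Rightarrow> real^'n \<Rightarrow> complex" where A: "A > 0" and \<rho>: "\<And>m. mollifier A (1 / real (Suc m)) (\<rho> m)"
    by (rule mollifier_sequence) blast
  have iw: "integrable lborel w" by (rule integrable_bounded_support[OF w _ supp(1)]) simp
  have ig: "integrable lborel (g k)" for k by (rule integrable_bounded_support[OF g _ supp(2)]) simp
  have jf: "integrable lborel f" by (rule integrable_bounded_support[OF f q(1) supp(3)])
  have wm: "conv (\<rho> m) w \<in> borel_measurable borel" for m by (rule conv_borel[OF \<rho> iw])
  have fm: "conv (\<rho> m) f \<in> borel_measurable borel" for m by (rule conv_borel[OF \<rho> jf])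
  have Em [measurable]: "E \<in> borel_measurable borel" by (rule borel_measurable_continuous_onI[OF E(1)])
  obtain H where H: "L2null H" "\<And>m x. cball x (1 / real (Suc m)) \<subseteq> ball x0 R \<Longrightarrow>
    ennreal (norm (apply_op P (conv (\<rho> m) w) x - conv (\<rho> m) f x)) \<le> H m x"
    by (rule friedrichs[OF P A(1) \<rho> w iw g ig wk eq]) blast
  have Hm [measurable]: "H m \<in> borel_measurable borel" for m using H(1) by (simp add: L2null_def)
  obtain d where d: "d > 0" "\<And>x y. norm (x - y) < d \<Longrightarrow> y \<in> cball x0 r \<Longrightarrow> E x powr q \<le> 2 * E y powr q"
    by (rule weight_ratio[OF E, of q x0 r]) (use q in auto)
  have "bounded (E ` cball x0 R)"
    by (intro compact_imp_bounded compact_continuous_image continuous_on_subset[OF E(1)]) auto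
  then obtain Emax where Emax: "Emax > 0" "\<And>x. x \<in> cball x0 R \<Longrightarrow> E x \<le> Emax"
    unfolding bounded_pos by force
  define vol where "vol = epowr (emeasure lborel (cball x0 R)) (1 - q/2)"
  have vol: "vol < top"
    using emeasure_lborel_cball_finite[of x0 R] epowr_eq_top_iff[of "emeasure lborel (cball x0 R)"]
    unfolding vol_def by (metis infinity_ennreal_def less_top)
  define V where "V = enn2real vol"
  have V: "vol = ennreal V" "V \<ge> 0" using vol by (simp_all add: V_def)
  \<comment> \<open>The threshold for the squared L^2 norm of \<open>H m\<close>: weighted and
    converted to L^q, an error of this size contributes at most Emax^q h^(q/2) V, which is at most
    \<delta>. The added 1 keeps the denominator positive.\<close>
  define h where "h = (\<delta> / (Emax powr q * V + 1)) powr (2 / q)"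
  have den: "Emax powr q * V + 1 > 0" using V(2) by (simp add: add_nonneg_pos)
  have h: "h > 0" using \<delta> den by (simp add: h_def)
  have h2: "Emax powr q * (h powr (q/2) * V) \<le> \<delta>"
  proof -
    have "h powr (q/2) = \<delta> / (Emax powr q * V + 1)" unfolding h_def powr_powr using q \<delta> den by simp
    then have "Emax powr q * (h powr (q/2) * V) = \<delta> * ((Emax powr q * V) / (Emax powr q * V + 1))" by simp
    also have "\<dots> \<le> \<delta> * 1" using \<delta> den by (intro mult_left_mono) (auto simp: divide_le_eq)
    finally show ?thesis by simp
  qed
  obtain M1 where M1: "\<And>m. m \<ge> M1 \<Longrightarrow> (\<integral>\<^sup>+x. (H m x)\<^sup>2 \<partial>lborel) < ennreal h"
    using order_tendstoD(2)[of _ 0 sequentially "ennreal h"] H(1) h unfolding L2null_def eventually_sequentially by (metis ennreal_less_zero_iff)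
  \<comment> \<open>Half of R - r, because two radii must fit: one for the growth of the support
    under mollification, one for the ball around each point of it on which the equation is
    tested.\<close>
  obtain M2 where M2: "1 / real (Suc M2) < min d ((R - r) / 2)"
    using nat_approx_posE[of "min d ((R - r) / 2)"] d r by (auto simp del: of_nat_Suc)
  define M where "M = max M1 M2"
  have small: "1 / real (Suc m) < d" "r + 1 / real (Suc m) + 1 / real (Suc m) < R" if "m \<ge> M" for m
  proof -
    have "1 / real (Suc m) \<le> 1 / real (Suc M2)" using that by (simp add: frac_le M_def)
    with M2 show "1 / real (Suc m) < d" "r + 1 / real (Suc m) + 1 / real (Suc m) < R" by (auto simp del: of_nat_Suc)
  qed
  let ?B = "epowr (ennreal (K * (2 powr q * 2)) * (Lpow q (\<lambda>x. of_real (E x) * f x) + ennreal \<delta>)) p"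
  have main: "Lpow s (\<lambda>x. of_real (E x) * conv (\<rho> m) w x) \<le> ?B" if m: "m \<ge> M" for m
  proof -
    let ?e = "1 / real (Suc m)"
    have "?e > 0" by simp
    then have rR: "r + ?e < R" using small(2)[OF m] by linarith
    have t: "conv (\<rho> m) w \<in> test_functions (ball x0 R)"
      by (rule conv_test[OF \<rho> iw supp(1) rR])
    define Er where "Er x = apply_op P (conv (\<rho> m) w) x - conv (\<rho> m) f x" for x
    note [measurable] = apply_op_borel[OF P t] fm[of m]
    have Erm [measurable]: "Er \<in> borel_measurable borel" unfolding Er_def[abs_def] by measurable
    have Er0: "Er x = 0" if "x \<notin> cball x0 (r + ?e)" for x
    proof -
      have "apply_op P (conv (\<rho> m) w) x = 0"
        by (rule apply_op_outside[of "- cball x0 (r + ?e)"]) (use that conv_support[OF \<rho> supp(1)] in \<open>auto simp: open_Compl\<close>)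
      moreover have "conv (\<rho> m) f x = 0" by (rule conv_support[OF \<rho> supp(3) that])
      ultimately show ?thesis by (simp add: Er_def)
    qed
    have ErH: "ennreal (norm (Er x)) \<le> H m x" for x
    proof (cases "x \<in> cball x0 (r + ?e)")
      case True
      have "cball x ?e \<subseteq> ball x0 R"
      proof
        fix y assume y: "y \<in> cball x ?e"
        have "dist x0 y \<le> dist x0 x + dist x y" by (rule dist_triangle)
        then show "y \<in> ball x0 R" using True y small(2)[OF m] by (simp del: of_nat_Suc)
      qed
      from H(2)[OF this] show ?thesis by (simp add: Er_def)
    qed (simp add: Er0)
    have ErL: "Lpow q (\<lambda>x. of_real (E x) * Er x) \<le> ennreal \<delta>"
    proof -
      have "Lpow q (\<lambda>x. of_real (E x) * Er x) \<le> (\<integral>\<^sup>+x. ennreal (Emax powr q) * (epowr ((H m x)\<^sup>2) (q/2) * epowr (indicator (cball x0 R) x) (1 - q/2)) \<partial>lborel)"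
        unfolding Lpow_def
      proof (rule nn_integral_mono)
        fix x
        show "ennreal (norm (of_real (E x) * Er x) powr q) \<le> ennreal (Emax powr q) * (epowr ((H m x)\<^sup>2) (q/2) * epowr (indicator (cball x0 R) x) (1 - q/2))"
        proof (cases "x \<in> cball x0 (r + ?e)")
          case True
          then have xR: "x \<in> cball x0 R" using rR by (simp del: of_nat_Suc)
          have "norm (of_real (E x) * Er x) powr q = E x powr q * norm (Er x) powr q"
            using E(2)[of x] by (simp add: norm_mult powr_mult)
          also have "\<dots> \<le> Emax powr q * norm (Er x) powr q"
            using E(2)[of x] Emax(2)[OF xR] q by (intro mult_right_mono powr_mono2) auto
          finally have "ennreal (norm (of_real (E x) * Er x) powr q) \<le> ennreal (Emax powr q) * ennreal (norm (Er x) powr q)"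
            by (simp add: ennreal_mult[symmetric] ennreal_leI)
          also have "ennreal (norm (Er x) powr q) = epowr (ennreal (norm (Er x))) q"
            using q by (simp add: epowr_ennreal)
          also have "\<dots> \<le> epowr (H m x) q" using q by (intro epowr_mono ErH) auto
          also have "epowr (H m x) q = epowr ((H m x)\<^sup>2) (q/2)" unfolding epowr_2[symmetric] epowr_epowr by simp
          finally show ?thesis using xR by (simp add: mult_left_mono)
        qed (use q in \<open>simp add: Er0\<close>)
      qed
      also have "\<dots> = ennreal (Emax powr q) * (\<integral>\<^sup>+x. epowr ((H m x)\<^sup>2) (q/2) * epowr (indicator (cball x0 R) x) (1 - q/2) \<partial>lborel)"
        by (intro nn_integral_cmult borel_measurable_times_ennreal epowr_measurable borel_measurable_power_ennreal borel_measurable_indicator) auto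
      also have "\<dots> \<le> ennreal (Emax powr q) * (epowr (\<integral>\<^sup>+x. (H m x)\<^sup>2 \<partial>lborel) (q/2) * epowr (\<integral>\<^sup>+x. indicator (cball x0 R) x \<partial>lborel) (1 - q/2))"
        using q by (intro mult_left_mono Hoelder2 borel_measurable_power_ennreal borel_measurable_indicator) auto
      also have "\<dots> \<le> ennreal (Emax powr q) * (epowr (ennreal h) (q/2) * vol)"
        unfolding vol_def using M1[of m] m q
        by (intro mult_left_mono mult_mono epowr_mono) (auto simp: M_def)
      also have "\<dots> = ennreal (Emax powr q * (h powr (q/2) * V))"
        using h q V by (simp add: epowr_ennreal ennreal_mult)
      also have "\<dots> \<le> ennreal \<delta>" by (intro ennreal_leI h2)
      finally show ?thesis .
    qed
    have fL: "Lpow q (\<lambda>x. of_real (E x) * conv (\<rho> m) f x) \<le> 2 * Lpow q (\<lambda>x. of_real (E x) * f x)"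
    proof -
      have spl: "ennreal (norm (of_real (E x) * z) powr q) = ennreal (E x powr q) * ennreal (norm z powr q)" for x and z :: complex
        using E(2)[of x] by (simp add: norm_mult powr_mult ennreal_mult)
      have "(\<integral>\<^sup>+x. ennreal (E x powr q) * ennreal (norm (conv (\<rho> m) f x) powr q) \<partial>lborel) \<le> 2 * (\<integral>\<^sup>+y. ennreal (E y powr q) * ennreal (norm (f y) powr q) \<partial>lborel)"
      proof (rule conv_weighted_young[OF \<rho> jf q(1)])
        show "(\<lambda>x. ennreal (E x powr q)) \<in> borel_measurable borel" by measurable
        fix x y assume xy: "norm (x - y) < ?e" "f y \<noteq> 0"
        have "E x powr q \<le> 2 * E y powr q"
          using xy supp(3)[of y] small(1)[OF m] by (intro d(2)) (auto simp del: of_nat_Suc)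
        then have "ennreal (E x powr q) \<le> ennreal (2 * E y powr q)" by (rule ennreal_leI)
        then show "ennreal (E x powr q) \<le> 2 * ennreal (E y powr q)" by (simp add: ennreal_mult)
      qed
      then show ?thesis unfolding Lpow_def spl .
    qed
    have "Lpow q (\<lambda>x. of_real (E x) * apply_op P (conv (\<rho> m) w) x) = Lpow q (\<lambda>x. of_real (E x) * conv (\<rho> m) f x + of_real (E x) * Er x)"
      by (simp add: Er_def algebra_simps)
    also have "\<dots> \<le> ennreal (2 powr q) * (Lpow q (\<lambda>x. of_real (E x) * conv (\<rho> m) f x) + Lpow q (\<lambda>x. of_real (E x) * Er x))"
      using q by (intro Lpow_add_le) (auto intro!: borel_measurable_times borel_measurable_of_real fm Erm)
    also have "\<dots> \<le> ennreal (2 powr q) * (2 * Lpow q (\<lambda>x. of_real (E x) * f x) + 2 * ennreal \<delta>)"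
    proof (intro mult_left_mono add_mono fL)
      \<comment> \<open>Deliberately wasteful, so that the factor 2 from Young's inequality can be
        taken out of the whole bracket.\<close>
      have "ennreal \<delta> \<le> 2 * ennreal \<delta>" by (simp add: mult_2)
      with ErL show "Lpow q (\<lambda>x. of_real (E x) * Er x) \<le> 2 * ennreal \<delta>" by simp
    qed simp
    also have "\<dots> = ennreal (2 powr q * 2) * (Lpow q (\<lambda>x. of_real (E x) * f x) + ennreal \<delta>)"
      by (simp add: ennreal_mult distrib_left mult.assoc)
    finally have "ennreal K * Lpow q (\<lambda>x. of_real (E x) * apply_op P (conv (\<rho> m) w) x) \<le> ennreal K * (ennreal (2 powr q * 2) * (Lpow q (\<lambda>x. of_real (E x) * f x) + ennreal \<delta>))"
      by (rule mult_left_mono) simp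
    also have "\<dots> = ennreal (K * (2 powr q * 2)) * (Lpow q (\<lambda>x. of_real (E x) * f x) + ennreal \<delta>)"
      using K by (simp add: ennreal_mult mult.assoc)
    finally show ?thesis using order_trans[OF carl[OF t] epowr_mono[OF _ p]] by blast
  qed
  have lim: "(\<lambda>m. Lpow 2 (\<lambda>x. conv (\<rho> (m + M)) w x - w x)) \<longlonglongrightarrow> 0"
    using LIMSEQ_ignore_initial_segment[OF Lpow_conv_tendsto[OF \<rho> A(1) iw w(2)], of M] .
  obtain t :: "nat \<Rightarrow> nat" where t: "strict_mono t" "AE x in lborel. (\<lambda>m. conv (\<rho> (t m + M)) w x) \<longlonglongrightarrow> w x"
    by (rule L2_tendsto_AE_subseq[OF wm w(1) lim])
  show ?thesis unfolding Lpow_def[of s]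
  proof (rule nn_integral_fatou_bound)
    show "(\<lambda>x. ennreal (norm (of_real (E x) * conv (\<rho> (t m + M)) w x) powr s)) \<in> borel_measurable lborel" for m
    proof -
      note [measurable] = wm[of "t m + M"]
      show ?thesis by measurable
    qed
    show "(\<integral>\<^sup>+x. ennreal (norm (of_real (E x) * conv (\<rho> (t m + M)) w x) powr s) \<partial>lborel) \<le> ?B" for m
      using main[of "t m + M"] unfolding Lpow_def[of s] by simp
    show "AE x in lborel. (\<lambda>m. ennreal (norm (of_real (E x) * conv (\<rho> (t m + M)) w x) powr s)) \<longlonglongrightarrow> ennreal (norm (of_real (E x) * w x) powr s)"
      using t(2)
    proof eventually_elim
      case (elim x)
      then show ?case using s by (intro tendsto_ennrealI tendsto_powr2 tendsto_norm tendsto_mult tendsto_const) auto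
    qed
  qed
qed

section \<open>Localization\<close>

text \<open>The indicator of the ball of the mean radius, mollified at half the difference of the
  radii: the mollifier then sees only the value 1 from the inner ball and only 0 from outside the
  outer one.\<close>

lemma cutoff_exists:
  fixes x0 :: "real^'n::finite"
  assumes "r < r'"
  obtains \<xi> where "\<xi> \<in> test_functions UNIV" "\<And>x. x \<in> cball x0 r \<Longrightarrow> \<xi> x = 1" "\<And>x. x \<notin> cball x0 r' \<Longrightarrow> \<xi> x = 0"
proof -
  define \<epsilon> m where "\<epsilon> = (r' - r) / 2" and "m = (r + r') / 2"
  have \<epsilon>: "\<epsilon> > 0" "r + \<epsilon> = m" "m + \<epsilon> = r'" using assms by (auto simp: \<epsilon>_def m_def field_simps)
  obtain A where "\<exists>\<rho> :: real^'n \<Rightarrow> complex. mollifier A \<epsilon> \<rho>"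
    using mollifier_exists \<epsilon>(1) by metis
  then obtain \<rho> :: "real^'n \<Rightarrow> complex" where \<rho>: "mollifier A \<epsilon> \<rho>" by blast
  define f :: "real^'n \<Rightarrow> complex" where "f y = of_real (indicator (cball x0 m) y)" for y
  have f: "integrable lborel f" unfolding f_def
    using emeasure_lborel_cball_finite[of x0 m]
    by (intro integrable_of_real) (simp add: integrable_indicator_iff)
  have z: "conv \<rho> f x = 0" if "x \<notin> cball x0 r'" for x
    by (rule conv_support[OF \<rho>, of x0 m]) (use that \<epsilon> in \<open>auto simp: f_def\<close>)
  show ?thesis
  proof (rule that[of "conv \<rho> f"])
    show "conv \<rho> f \<in> test_functions UNIV"
      by (rule test_functionsI[OF conv_smooth[OF f mollifierD(1)[OF \<rho>]] compact_cball[of x0 r']]) (use z in auto)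
    show "conv \<rho> f x = 1" if x: "x \<in> cball x0 r" for x
    proof -
      have "\<rho> (x - y) * f y = \<rho> (x - y)" for y
      proof (cases "norm (x - y) < \<epsilon>")
        case True
        have "dist x0 y \<le> dist x0 x + dist x y" by (rule dist_triangle)
        then have "y \<in> cball x0 m" using x True \<epsilon>(2) by (simp add: dist_norm)
        then show ?thesis by (simp add: f_def)
      qed (use mollifierD(3)[OF \<rho>, of "x - y"] in simp)
      then show ?thesis unfolding conv_def using mollifier_integral[OF \<rho>, of x] by (simp only:)
    qed
  qed (rule z)
qed

text \<open>The reflected mollifiers y -> \<rho>(x - y) are test functions on \<open>X\<close> as
  soon as their radius is small, so the mollified \<open>g\<close> vanishes at \<open>x\<close>
  eventually; along a subsequence it converges to \<open>g\<close> almost everywhere.\<close>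

lemma fundamental_lemma:
  fixes g :: "real^'n::finite \<Rightarrow> complex"
  assumes g: "g \<in> borel_measurable borel" "Lpow 2 g < \<infinity>" "integrable lborel g" and X: "open X"
    and z: "\<And>\<eta>. \<eta> \<in> test_functions X \<Longrightarrow> (LINT x|lborel. g x * \<eta> x) = 0"
  shows "AE x in lborel. x \<in> X \<longrightarrow> g x = 0"
proof -
  obtain A and \<rho> :: "nat \<Rightarrow> real^'n \<Rightarrow> complex" where A: "A > 0" and \<rho>: "\<And>m. mollifier A (1 / real (Suc m)) (\<rho> m)"
    by (rule mollifier_sequence) blast
  obtain s :: "nat \<Rightarrow> nat" where s: "strict_mono s" "AE x in lborel. (\<lambda>m. conv (\<rho> (s m)) g x) \<longlonglongrightarrow> g x"
    by (rule L2_tendsto_AE_subseq[OF conv_borel[OF \<rho> g(3)] g(1) Lpow_conv_tendsto[OF \<rho> A(1) g(3) g(2)]])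
  show ?thesis using s(2)
  proof eventually_elim
    case (elim x)
    show ?case
    proof
      assume "x \<in> X"
      then obtain e where e: "e > 0" "cball x e \<subseteq> X" using X open_contains_cball by blast
      obtain M where M: "1 / real (Suc M) < e" using nat_approx_posE[OF e(1)] by blast
      have "conv (\<rho> (s m)) g x = 0" if "m \<ge> M" for m
      proof -
        have "m \<le> s m" using s(1) by (rule seq_suble)
        with that have "1 / real (Suc (s m)) \<le> 1 / real (Suc M)" by (simp add: frac_le)
        with M have "cball x (1 / real (Suc (s m))) \<subseteq> X" using e(2) by (auto simp del: of_nat_Suc)
        from z[OF mollifier_reflect_test[OF \<rho> this]] show ?thesis unfolding conv_def by (simp add: mult.commute)
      qed
      then have "(\<lambda>m. conv (\<rho> (s m)) g x) \<longlonglongrightarrow> 0"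
        by (intro tendsto_eventually) (auto simp: eventually_sequentially)
      with elim show "g x = 0" using LIMSEQ_unique by blast
    qed
  qed
qed

lemma Lpow_bounded_mult:
  fixes f h :: "real^'n::finite \<Rightarrow> complex"
  assumes p: "0 < p" and f: "f \<in> borel_measurable borel" and h: "\<And>x. norm (h x) \<le> B"
  shows "Lpow p (\<lambda>x. h x * f x) \<le> ennreal (B powr p) * Lpow p f"
proof -
  have "Lpow p (\<lambda>x. h x * f x) \<le> (\<integral>\<^sup>+x. ennreal (B powr p) * ennreal (norm (f x) powr p) \<partial>lborel)"
    unfolding Lpow_def
  proof (rule nn_integral_mono)
    fix x
    have "norm (h x * f x) powr p \<le> B powr p * norm (f x) powr p"
      using p h[of x] by (simp add: norm_mult powr_mult mult_right_mono powr_mono2)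
    then show "ennreal (norm (h x * f x) powr p) \<le> ennreal (B powr p) * ennreal (norm (f x) powr p)"
      by (simp add: ennreal_mult[symmetric] ennreal_leI)
  qed
  also have "\<dots> = ennreal (B powr p) * Lpow p f" unfolding Lpow_def
    by (intro nn_integral_cmult) (use f in measurable)
  finally show ?thesis .
qed

lemma Lpow_test_mult_finite:
  assumes "0 < p" "f \<in> borel_measurable borel" "Lpow p f < \<infinity>" "h \<in> test_functions \<Omega>"
  shows "Lpow p (\<lambda>x. h x * f x) < \<infinity>"
proof -
  obtain B where "\<And>x. norm (h x) \<le> B" using test_bounded[OF assms(4)] by blast
  from Lpow_bounded_mult[of p f h B, OF assms(1,2) this]
  show ?thesis using assms(3) by (auto simp: ennreal_mult_less_top intro: le_less_trans)
qed

lemma Lpow_add_finite: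
  assumes "0 < p" "f \<in> borel_measurable borel" "g \<in> borel_measurable borel" "Lpow p f < \<infinity>" "Lpow p g < \<infinity>"
  shows "Lpow p (\<lambda>x. f x + g x) < \<infinity>"
  using Lpow_add_le[OF assms(1-3)] assms(4,5) by (auto simp: ennreal_mult_less_top intro: le_less_trans)

lemma Lpow_sum_finite:
  assumes "finite I" "0 < p" "\<And>i. i \<in> I \<Longrightarrow> f i \<in> borel_measurable borel" "\<And>i. i \<in> I \<Longrightarrow> Lpow p (f i) < \<infinity>"
  shows "Lpow p (\<lambda>x. \<Sum>i\<in>I. f i x) < \<infinity>"
  using assms(1,3,4)
proof (induction I rule: finite_induct)
  case empty
  then show ?case using assms(2) by (simp add: Lpow_def)
next
  case (insert i I)
  have "Lpow p (\<lambda>x. f i x + (\<Sum>i\<in>I. f i x)) < \<infinity>"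
    by (rule Lpow_add_finite[OF assms(2)]) (use insert in \<open>auto intro!: borel_measurable_sum\<close>)
  then show ?case using insert.hyps by simp
qed

text \<open>On a bounded set |f|^q is at most 1 where |f| is at most 1, and at most |f|^p elsewhere.
  It turns L^2 bounds of commutator terms into L^q bounds.\<close>

lemma Lpow_mono_exponent:
  fixes f :: "real^'n::finite \<Rightarrow> complex"
  assumes [measurable]: "f \<in> borel_measurable borel" and fin: "Lpow p f < \<infinity>" and q: "0 < q" "q \<le> p"
    and supp: "\<And>y. y \<notin> cball x0 r \<Longrightarrow> f y = 0"
  shows "Lpow q f < \<infinity>"
proof -
  have "Lpow q f \<le> (\<integral>\<^sup>+x. indicator (cball x0 r) x + ennreal (norm (f x) powr p) \<partial>lborel)"
    unfolding Lpow_def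
  proof (rule nn_integral_mono)
    fix x
    have "norm (f x) powr q \<le> indicator (cball x0 r) x + norm (f x) powr p"
    proof (cases "norm (f x) \<le> 1")
      case True
      then have "norm (f x) powr q \<le> 1" using q powr_mono2[of q "norm (f x)" 1] by simp
      then show ?thesis using supp[of x] q by (cases "x \<in> cball x0 r") (auto intro: add_increasing2)
    next
      case False
      then have "norm (f x) powr q \<le> norm (f x) powr p" using q by (intro powr_mono) auto
      then show ?thesis by (simp add: indicator_def)
    qed
    then have "ennreal (norm (f x) powr q) \<le> ennreal (indicator (cball x0 r) x + norm (f x) powr p)" by (rule ennreal_leI)
    then show "ennreal (norm (f x) powr q) \<le> indicator (cball x0 r) x + ennreal (norm (f x) powr p)"
      by (simp add: ennreal_indicator)
  qed
  also have "\<dots> = emeasure lborel (cball x0 r) + Lpow p f"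
    unfolding Lpow_def by (subst nn_integral_add) (auto intro!: borel_measurable_indicator)
  also have "\<dots> < \<infinity>" using fin emeasure_lborel_cball_finite[of x0 r] by simp
  finally show ?thesis .
qed

lemma Lpow_Hoelder:
  fixes V w :: "real^'n::finite \<Rightarrow> complex"
  assumes p: "p > 0" and s: "s > 0" and q: "q > 0" and pqs: "1 / q = 1 / p + 1 / s"
    and [measurable]: "V \<in> borel_measurable borel" "w \<in> borel_measurable borel"
  shows "Lpow q (\<lambda>x. V x * w x) \<le> epowr (Lpow p V) (q / p) * epowr (Lpow s w) (q / s)"
proof -
  have "q / p + q / s = q * (1 / q)" unfolding pqs by (simp add: distrib_left)
  then have sum1: "q / p + q / s = 1" using q by simp
  have "Lpow q (\<lambda>x. V x * w x) = (\<integral>\<^sup>+x. epowr (ennreal (norm (V x) powr p)) (q / p) * epowr (ennreal (norm (w x) powr s)) (q / s) \<partial>lborel)"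
    unfolding Lpow_def using p q s
    by (intro nn_integral_cong) (simp add: epowr_ennreal powr_powr norm_mult powr_mult ennreal_mult)
  also have "\<dots> \<le> epowr (Lpow p V) (q / p) * epowr (Lpow s w) (q / s)"
    unfolding Lpow_def using p q s sum1 by (intro Hoelder2) auto
  finally show ?thesis .
qed

section \<open>Multiplication by a cutoff: weak derivatives and weak equations\<close>

lemma weak_D_localize:
  fixes u g :: "real^'n::finite \<Rightarrow> complex"
  assumes \<xi>: "\<xi> \<in> test_functions B" and u: "integrable lborel u" and g: "integrable lborel g" and wd: "weak_D B k u g"
  shows "weak_D UNIV k (\<lambda>x. \<xi> x * u x) (\<lambda>x. \<xi> x * g x + D k \<xi> x * u x)"
  unfolding weak_D_def
proof
  fix \<eta> :: "real^'n \<Rightarrow> complex" assume \<eta>: "\<eta> \<in> test_functions UNIV"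
  \<comment> \<open>The product is supported in \<open>B\<close> though \<eta> is not, so the weak
    derivative in \<open>B\<close> yields one on the whole space for the localized function.\<close>
  have \<zeta>: "(\<lambda>x. \<xi> x * \<eta> x) \<in> test_functions B" by (rule test_mult(2)[OF \<xi> test_smooth[OF \<eta>]])
  have D\<zeta>: "D k (\<lambda>x. \<xi> x * \<eta> x) x = D k \<xi> x * \<eta> x + \<xi> x * D k \<eta> x" for x
    by (rule D_mult[OF test_differentiable[OF \<xi>] test_differentiable[OF \<eta>]])
  have i1: "integrable lborel (\<lambda>x. u x * D k (\<lambda>x. \<xi> x * \<eta> x) x)"
    using integrable_test_mult[OF test_D[OF \<zeta>] u] by (simp add: mult.commute)
  have "(\<lambda>x. D k \<xi> x * \<eta> x) \<in> test_functions B" by (rule test_mult(2)[OF test_D[OF \<xi>] test_smooth[OF \<eta>]])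
  from integrable_test_mult[OF this u] have i2: "integrable lborel (\<lambda>x. D k \<xi> x * u x * \<eta> x)" by (simp add: mult_ac)
  from integrable_test_mult[OF \<zeta> g] have i3: "integrable lborel (\<lambda>x. \<xi> x * g x * \<eta> x)" by (simp add: mult_ac)
  have "(LINT x|lborel. \<xi> x * u x * D k \<eta> x) = (LINT x|lborel. u x * D k (\<lambda>x. \<xi> x * \<eta> x) x - D k \<xi> x * u x * \<eta> x)"
    unfolding D\<zeta> by (intro Bochner_Integration.integral_cong) (auto simp: algebra_simps)
  also have "\<dots> = (LINT x|lborel. u x * D k (\<lambda>x. \<xi> x * \<eta> x) x) - (LINT x|lborel. D k \<xi> x * u x * \<eta> x)"
    by (rule Bochner_Integration.integral_diff[OF i1 i2])
  also have "(LINT x|lborel. u x * D k (\<lambda>x. \<xi> x * \<eta> x) x) = - (LINT x|lborel. g x * (\<xi> x * \<eta> x))"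
    using bspec[OF wd[unfolded weak_D_def] \<zeta>] by (simp add: minus_equation_iff)
  finally have "- (LINT x|lborel. \<xi> x * u x * D k \<eta> x) = (LINT x|lborel. \<xi> x * g x * \<eta> x) + (LINT x|lborel. D k \<xi> x * u x * \<eta> x)"
    by (simp add: mult_ac)
  also have "\<dots> = (LINT x|lborel. (\<xi> x * g x + D k \<xi> x * u x) * \<eta> x)"
    using i2 i3 by (subst Bochner_Integration.integral_add[symmetric]) (auto simp: distrib_right)
  finally show "- (LINT x|lborel. \<xi> x * u x * D k \<eta> x) = (LINT x|lborel. (\<xi> x * g x + D k \<xi> x * u x) * \<eta> x)" .
qed

text \<open>$[P,\xi]u$, with \<open>g k\<close> in place of $D_k u$.\<close>

definition comm_term :: "'n::finite diffop2 \<Rightarrow> (real^'n \<Rightarrow> complex) \<Rightarrow> (real^'n \<Rightarrow> complex) \<Rightarrow> ('n \<Rightarrow> real^'n \<Rightarrow> complex) \<Rightarrow> real^'n \<Rightarrow> complex" where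
  "comm_term P \<xi> u g x =
     (\<Sum>j\<in>UNIV. \<Sum>k\<in>UNIV. coeff2 P j k x * (D j \<xi> x * g k x) + coeff2 P j k x * (D k \<xi> x * g j x) + coeff2 P j k x * (D j (D k \<xi>) x * u x))
     + (\<Sum>j\<in>UNIV. coeff1 P j x * (D j \<xi> x * u x))"

text \<open>Test the equation for \<open>u\<close> with \<xi> \<eta> and collect what the Leibniz
  rule leaves over. The only term not already in the required form contains u D_k \<xi> times a
  derivative of the test function; one integration by parts with the weak derivative of
  \<open>u\<close> removes it.\<close>

lemma weak_eq_localize:
  fixes u F :: "real^'n::finite \<Rightarrow> complex"
  assumes P: "test_coeffs P" and \<xi>: "\<xi> \<in> test_functions B" and u: "integrable lborel u" and g: "\<And>k. integrable lborel (g k)"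
    and F: "integrable lborel (\<lambda>x. \<xi> x * F x)" and wd: "\<And>k. weak_D B k u (g k)" and eq: "weak_eq P B u g F"
  shows "weak_eq P B (\<lambda>x. \<xi> x * u x) (\<lambda>k x. \<xi> x * g k x + D k \<xi> x * u x) (\<lambda>x. \<xi> x * F x + comm_term P \<xi> u g x)"
  unfolding weak_eq_def
proof
  fix \<eta> :: "real^'n \<Rightarrow> complex" assume \<eta>: "\<eta> \<in> test_functions B"
  define \<zeta> where "\<zeta> x = \<xi> x * \<eta> x" for x
  have \<zeta>: "\<zeta> \<in> test_functions B" unfolding \<zeta>_def[abs_def] by (rule test_mult(2)[OF \<xi> test_smooth[OF \<eta>]])
  have a: "coeff2 P j k \<in> test_functions UNIV" "coeff1 P j \<in> test_functions UNIV" "coeff0 P \<in> test_functions UNIV" for j k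
    using P by (auto simp: test_coeffs_def)
  have T: "(\<lambda>x. h x * f x) \<in> test_functions B" if "f \<in> test_functions B" "h \<in> test_functions \<Omega>" for f h \<Omega>
    by (rule test_mult(1)[OF that(1) test_smooth[OF that(2)]])
  have I: "integrable lborel (\<lambda>x. f x * h x)" if "integrable lborel f" "h \<in> test_functions \<Omega>" for f h :: "real^'n \<Rightarrow> complex" and \<Omega>
    using integrable_test_mult[OF that(2,1)] by (simp add: mult.commute)
  have P1: "(LINT y|lborel. (\<xi> y * g k y + D k \<xi> y * u y) * D j (\<lambda>y. coeff2 P j k y * \<eta> y) y) =
      (LINT y|lborel. g k y * D j (\<lambda>y. coeff2 P j k y * \<zeta> y) y)
      - (LINT y|lborel. (coeff2 P j k y * (D j \<xi> y * g k y) + coeff2 P j k y * (D k \<xi> y * g j y) + coeff2 P j k y * (D j (D k \<xi>) y * u y)) * \<eta> y)" for j k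
  proof -
    let ?a = "coeff2 P j k"
    define \<theta> where "\<theta> y = ?a y * \<eta> y" for y
    have \<theta>: "\<theta> \<in> test_functions B" unfolding \<theta>_def[abs_def] by (rule T[OF \<eta> a(1)])
    have e1: "D j (\<lambda>y. ?a y * \<zeta> y) y = D j \<xi> y * \<theta> y + \<xi> y * D j \<theta> y" for y
    proof -
      have "(\<lambda>y. ?a y * \<zeta> y) = (\<lambda>y. \<xi> y * \<theta> y)" by (auto simp: \<zeta>_def \<theta>_def)
      then show ?thesis by (simp add: D_mult[OF test_differentiable[OF \<xi>] test_differentiable[OF \<theta>]])
    qed
    \<comment> \<open>The test function for that integration by parts. It produces the term with
      \<open>g j\<close> and, through the derivative falling on D_k \<xi>, the one with second
      derivatives of \<xi>.\<close>
    define \<kappa> where "\<kappa> y = D k \<xi> y * \<theta> y" for y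
    have \<kappa>: "\<kappa> \<in> test_functions B" unfolding \<kappa>_def[abs_def] by (rule T[OF \<theta> test_D[OF \<xi>]])
    have e2: "D j \<kappa> y = D j (D k \<xi>) y * \<theta> y + D k \<xi> y * D j \<theta> y" for y
      unfolding \<kappa>_def by (rule D_mult[OF test_differentiable[OF test_D[OF \<xi>]] test_differentiable[OF \<theta>]])
    have t1: "(\<lambda>y. ?a y * \<zeta> y) \<in> test_functions B" by (rule T[OF \<zeta> a(1)])
    note i1 = I[OF g[of k] test_D[OF t1, of j]]
    note i2 = I[OF g[of k] T[OF \<theta> test_D[OF \<xi>, of j]]]
    note i3 = I[OF u test_D[OF \<kappa>, of j]]
    note i4 = I[OF u T[OF \<theta> test_D[OF test_D[OF \<xi>, of k], of j]]]
    note i5 = I[OF g[of j] T[OF \<theta> test_D[OF \<xi>, of k]]]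
    have "(LINT y|lborel. (\<xi> y * g k y + D k \<xi> y * u y) * D j \<theta> y) =
      (LINT y|lborel. g k y * D j (\<lambda>y. ?a y * \<zeta> y) y - g k y * (D j \<xi> y * \<theta> y) + (u y * D j \<kappa> y - u y * (D j (D k \<xi>) y * \<theta> y)))"
      unfolding e1 e2 by (intro Bochner_Integration.integral_cong) (auto simp: algebra_simps)
    also have "\<dots> = (LINT y|lborel. g k y * D j (\<lambda>y. ?a y * \<zeta> y) y) - (LINT y|lborel. g k y * (D j \<xi> y * \<theta> y))
      + ((LINT y|lborel. u y * D j \<kappa> y) - (LINT y|lborel. u y * (D j (D k \<xi>) y * \<theta> y)))"
      using i1 i2 i3 i4 by (simp add: Bochner_Integration.integral_add Bochner_Integration.integral_diff)
    also have "(LINT y|lborel. u y * D j \<kappa> y) = - (LINT y|lborel. g j y * \<kappa> y)"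
      using bspec[OF wd[of j, unfolded weak_D_def] \<kappa>] by (simp add: minus_equation_iff)
    finally have "(LINT y|lborel. (\<xi> y * g k y + D k \<xi> y * u y) * D j \<theta> y) =
      (LINT y|lborel. g k y * D j (\<lambda>y. ?a y * \<zeta> y) y) - ((LINT y|lborel. g k y * (D j \<xi> y * \<theta> y)) + (LINT y|lborel. g j y * (D k \<xi> y * \<theta> y)) + (LINT y|lborel. u y * (D j (D k \<xi>) y * \<theta> y)))"
      by (simp add: \<kappa>_def)
    also have "(LINT y|lborel. g k y * (D j \<xi> y * \<theta> y)) + (LINT y|lborel. g j y * (D k \<xi> y * \<theta> y)) + (LINT y|lborel. u y * (D j (D k \<xi>) y * \<theta> y))
      = (LINT y|lborel. g k y * (D j \<xi> y * \<theta> y) + g j y * (D k \<xi> y * \<theta> y) + u y * (D j (D k \<xi>) y * \<theta> y))"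
      using i2 i4 i5 by (simp add: Bochner_Integration.integral_add)
    also have "\<dots> = (LINT y|lborel. (?a y * (D j \<xi> y * g k y) + ?a y * (D k \<xi> y * g j y) + ?a y * (D j (D k \<xi>) y * u y)) * \<eta> y)"
      unfolding \<theta>_def by (intro Bochner_Integration.integral_cong) (auto simp: algebra_simps)
    finally show ?thesis unfolding \<theta>_def .
  qed
  have P2: "(LINT y|lborel. coeff1 P j y * (\<xi> y * g j y + D j \<xi> y * u y) * \<eta> y) =
      (LINT y|lborel. coeff1 P j y * g j y * \<zeta> y) + (LINT y|lborel. coeff1 P j y * (D j \<xi> y * u y) * \<eta> y)" for j
  proof -
    have "integrable lborel (\<lambda>y. coeff1 P j y * g j y * \<zeta> y)" "integrable lborel (\<lambda>y. coeff1 P j y * (D j \<xi> y * u y) * \<eta> y)"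
      using I[OF g[of j] T[OF \<zeta> a(2)[of j]]] I[OF u T[OF T[OF \<eta> test_D[OF \<xi>, of j]] a(2)[of j]]] by (simp_all add: mult_ac)
    then show ?thesis
      by (subst Bochner_Integration.integral_add[symmetric]) (auto simp: \<zeta>_def algebra_simps)
  qed
  have P3: "(LINT y|lborel. coeff0 P y * (\<xi> y * u y) * \<eta> y) = (LINT y|lborel. coeff0 P y * u y * \<zeta> y)"
    by (simp add: \<zeta>_def mult_ac)
  define q2 where "q2 j k y = coeff2 P j k y * (D j \<xi> y * g k y) + coeff2 P j k y * (D k \<xi> y * g j y) + coeff2 P j k y * (D j (D k \<xi>) y * u y)" for j k y
  define q1 where "q1 j y = coeff1 P j y * (D j \<xi> y * u y)" for j y
  have iq: "integrable lborel (\<lambda>y. q2 j k y * \<eta> y)" "integrable lborel (\<lambda>y. q1 j y * \<eta> y)" for j k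
  proof -
    have "integrable lborel (\<lambda>y. g k y * (coeff2 P j k y * (D j \<xi> y * \<eta> y)) + g j y * (coeff2 P j k y * (D k \<xi> y * \<eta> y)) + u y * (coeff2 P j k y * (D j (D k \<xi>) y * \<eta> y)))"
      by (intro Bochner_Integration.integrable_add I[OF g T[OF T[OF \<eta> test_D[OF \<xi>]] a(1)]] I[OF u T[OF T[OF \<eta> test_D[OF test_D[OF \<xi>]]] a(1)]])
    then show "integrable lborel (\<lambda>y. q2 j k y * \<eta> y)" unfolding q2_def by (simp add: algebra_simps)
    show "integrable lborel (\<lambda>y. q1 j y * \<eta> y)" unfolding q1_def
      using I[OF u T[OF T[OF \<eta> test_D[OF \<xi>, of j]] a(2)[of j]]] by (simp add: mult_ac)
  qed
  have "(LINT y|lborel. (\<xi> y * F y + comm_term P \<xi> u g y) * \<eta> y) =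
    (LINT y|lborel. \<xi> y * F y * \<eta> y + ((\<Sum>j\<in>UNIV. \<Sum>k\<in>UNIV. q2 j k y * \<eta> y) + (\<Sum>j\<in>UNIV. q1 j y * \<eta> y)))"
    unfolding comm_term_def q2_def[symmetric] q1_def[symmetric]
    by (intro Bochner_Integration.integral_cong) (auto simp: distrib_right sum_distrib_right)
  also have "\<dots> = (LINT y|lborel. \<xi> y * F y * \<eta> y) + ((\<Sum>j\<in>UNIV. \<Sum>k\<in>UNIV. LINT y|lborel. q2 j k y * \<eta> y) + (\<Sum>j\<in>UNIV. LINT y|lborel. q1 j y * \<eta> y))"
    using I[OF F \<eta>] iq by (simp add: Bochner_Integration.integral_add Bochner_Integration.integral_sum)
  also have "(LINT y|lborel. \<xi> y * F y * \<eta> y) = (LINT y|lborel. F y * \<zeta> y)" by (simp add: \<zeta>_def mult_ac)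
  also have "\<dots> = - (\<Sum>j\<in>UNIV. \<Sum>k\<in>UNIV. LINT y|lborel. g k y * D j (\<lambda>y. coeff2 P j k y * \<zeta> y) y)
     + (\<Sum>j\<in>UNIV. LINT y|lborel. coeff1 P j y * g j y * \<zeta> y) + (LINT y|lborel. coeff0 P y * u y * \<zeta> y)"
    using bspec[OF eq[unfolded weak_eq_def] \<zeta>] by simp
  finally show "- (\<Sum>j\<in>UNIV. \<Sum>k\<in>UNIV. LINT y|lborel. (\<xi> y * g k y + D k \<xi> y * u y) * D j (\<lambda>y. coeff2 P j k y * \<eta> y) y)
     + (\<Sum>j\<in>UNIV. LINT y|lborel. coeff1 P j y * (\<xi> y * g j y + D j \<xi> y * u y) * \<eta> y) + (LINT y|lborel. coeff0 P y * (\<xi> y * u y) * \<eta> y)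
     = (LINT y|lborel. (\<xi> y * F y + comm_term P \<xi> u g y) * \<eta> y)"
    unfolding P1 P2 P3 q2_def[symmetric] q1_def[symmetric] by (simp add: sum_subtractf sum.distrib)
qed


text \<open>The functions live on the whole space, but the weak derivative is asserted in
  \<open>B\<close> only: extension by zero of an H^1 function need not be in H^1. Integrability is
  included for the sake of convolutions and products with test functions.\<close>

definition H1_data :: "(real^'n::finite) set \<Rightarrow> (real^'n \<Rightarrow> complex) \<Rightarrow> ('n \<Rightarrow> real^'n \<Rightarrow> complex) \<Rightarrow> bool" where
  "H1_data B u g \<longleftrightarrow> u \<in> borel_measurable borel \<and> Lpow 2 u < \<infinity> \<and> integrable lborel u \<and>
     (\<forall>k. g k \<in> borel_measurable borel \<and> Lpow 2 (g k) < \<infinity> \<and> integrable lborel (g k) \<and> weak_D B k u (g k))"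

lemma H1_dataD:
  assumes "H1_data B u g"
  shows "u \<in> borel_measurable borel" "Lpow 2 u < \<infinity>" "integrable lborel u"
    "\<And>k. g k \<in> borel_measurable borel" "\<And>k. Lpow 2 (g k) < \<infinity>" "\<And>k. integrable lborel (g k)" "\<And>k. weak_D B k u (g k)"
  using assms by (auto simp: H1_data_def)

text \<open>The largest distance from the centre is attained on the compact support. The strictly
  smaller radius leaves the room in which mollified functions remain supported.\<close>

lemma test_ball_support:
  fixes x0 :: "real^'n::finite"
  assumes "\<xi> \<in> test_functions (ball x0 R)"
  obtains r where "r < R" "\<And>x. x \<notin> cball x0 r \<Longrightarrow> \<xi> x = 0"
proof -
  from assms obtain K where K: "compact K" "K \<subseteq> ball x0 R" "\<And>x. x \<notin> K \<Longrightarrow> \<xi> x = 0" by (rule test_functionsE) auto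
  show ?thesis
  proof (cases "K = {}")
    case True
    then show ?thesis using that[of "R - 1"] K(3) by auto
  next
    case False
    have "continuous_on K (dist x0)" by (intro continuous_intros)
    then obtain z where z: "z \<in> K" "\<And>y. y \<in> K \<Longrightarrow> dist x0 y \<le> dist x0 z"
      using continuous_attains_sup[OF K(1) False] by metis
    show ?thesis
    proof (rule that[of "dist x0 z"])
      show "dist x0 z < R" using z(1) K(2) by auto
      show "\<xi> x = 0" if "x \<notin> cball x0 (dist x0 z)" for x
        using that z(2)[of x] K(3)[of x] by auto
    qed
  qed
qed

lemma D_zero_outside_cball:
  assumes "\<And>x. x \<notin> cball x0 r \<Longrightarrow> \<xi> x = 0" "x \<notin> cball x0 r"
  shows "D k \<xi> x = 0"
  unfolding D_def using frechet_derivative_zero_on[of "- cball x0 r" x \<xi>] assms by (simp add: open_Compl)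

lemma H1_data_localize:
  fixes u :: "real^'n::finite \<Rightarrow> complex"
  assumes H: "H1_data B u g" and \<xi>: "\<xi> \<in> test_functions B"
  shows "(\<lambda>x. \<xi> x * u x) \<in> borel_measurable borel" "Lpow 2 (\<lambda>x. \<xi> x * u x) < \<infinity>"
    "(\<lambda>x. \<xi> x * g k x + D k \<xi> x * u x) \<in> borel_measurable borel" "Lpow 2 (\<lambda>x. \<xi> x * g k x + D k \<xi> x * u x) < \<infinity>"
    "weak_D UNIV k (\<lambda>x. \<xi> x * u x) (\<lambda>x. \<xi> x * g k x + D k \<xi> x * u x)"
proof -
  note h = H1_dataD[OF H]
  note [measurable] = h(1) h(4) test_borel[OF \<xi>] test_borel[OF test_D[OF \<xi>]]
  show m: "(\<lambda>x. \<xi> x * u x) \<in> borel_measurable borel" by measurable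
  show m2: "(\<lambda>x. \<xi> x * g k x + D k \<xi> x * u x) \<in> borel_measurable borel" by measurable
  show "Lpow 2 (\<lambda>x. \<xi> x * u x) < \<infinity>" by (rule Lpow_test_mult_finite[OF _ h(1,2) \<xi>]) simp
  show "Lpow 2 (\<lambda>x. \<xi> x * g k x + D k \<xi> x * u x) < \<infinity>"
  proof (rule Lpow_add_finite)
    show "Lpow 2 (\<lambda>x. \<xi> x * g k x) < \<infinity>" by (rule Lpow_test_mult_finite[OF _ h(4,5) \<xi>]) simp
    show "Lpow 2 (\<lambda>x. D k \<xi> x * u x) < \<infinity>" by (rule Lpow_test_mult_finite[OF _ h(1,2) test_D[OF \<xi>]]) simp
  qed (simp, measurable)
  show "weak_D UNIV k (\<lambda>x. \<xi> x * u x) (\<lambda>x. \<xi> x * g k x + D k \<xi> x * u x)"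
    by (rule weak_D_localize[OF \<xi> h(3,6,7)])
qed

lemma local_sobolev:
  fixes u :: "real^'n::finite \<Rightarrow> complex"
  assumes dim: "CARD('n) > 2" and H: "H1_data (ball x0 R) u g" and \<xi>: "\<xi> \<in> test_functions (ball x0 R)"
  shows "Lpow (2 * real CARD('n) / (real CARD('n) - 2)) (\<lambda>x. \<xi> x * u x) < \<infinity>"
proof -
  obtain r where r: "r < R" "\<And>x. x \<notin> cball x0 r \<Longrightarrow> \<xi> x = 0" by (rule test_ball_support[OF \<xi>]) blast
  show ?thesis
  proof (rule sobolev_H1[OF dim H1_data_localize(1,2)[OF H \<xi>] H1_data_localize(3,4)[OF H \<xi>] _ _ H1_data_localize(5)[OF H \<xi>]])
    fix y assume y: "y \<notin> cball x0 r"
    show "\<xi> y * u y = 0" using r(2)[OF y] by simp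
    show "\<xi> y * g k y + D k \<xi> y * u y = 0" for k using r(2)[OF y] D_zero_outside_cball[OF r(2) y] by simp
  qed
qed

lemma epowr_less_top: "x < top \<Longrightarrow> epowr x p < top"
  using epowr_eq_top_iff[of x p] by (auto simp: less_top)

section \<open>Potential terms and the weighted inequality for one equation\<close>

definition weak_sol where
  "weak_sol P B u g V W v \<longleftrightarrow> (\<forall>\<eta>\<in>test_functions B.
     - (\<Sum>j\<in>UNIV. \<Sum>k\<in>UNIV. LINT y|lborel. g k y * D j (\<lambda>y. coeff2 P j k y * \<eta> y) y)
     + (\<Sum>j\<in>UNIV. LINT y|lborel. coeff1 P j y * g j y * \<eta> y) + (LINT y|lborel. coeff0 P y * u y * \<eta> y)
     + (LINT y|lborel. V y * u y * \<eta> y) = (LINT y|lborel. W y * v y * \<eta> y))"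

text \<open>Hoelder's inequality with (d+2)/(2d) = 2/d + (d-2)/(2d): multiplication by an L^{d/2}
  function maps the Sobolev space exponent exactly to the exponent on the right of the Carleman
  estimate.\<close>

lemma potential_term_finite:
  fixes V w :: "real^'n::finite \<Rightarrow> complex"
  assumes dim: "CARD('n) > 2" and V: "V \<in> borel_measurable borel" "Lpow (real CARD('n) / 2) V < \<infinity>"
    and w: "w \<in> borel_measurable borel" "Lpow (2 * real CARD('n) / (real CARD('n) - 2)) w < \<infinity>"
    and supp: "\<And>y. y \<notin> cball x0 r \<Longrightarrow> w y = 0"
  shows "Lpow (2 * real CARD('n) / (real CARD('n) + 2)) (\<lambda>x. V x * w x) < \<infinity>" "integrable lborel (\<lambda>x. V x * w x)"
proof -
  define d where "d = real CARD('n)"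
  have d: "d > 2" using dim by (simp add: d_def)
  have "Lpow (2 * d / (d + 2)) (\<lambda>x. V x * w x) \<le> epowr (Lpow (d / 2) V) ((2 * d / (d + 2)) / (d / 2)) * epowr (Lpow (2 * d / (d - 2)) w) ((2 * d / (d + 2)) / (2 * d / (d - 2)))"
    by (rule Lpow_Hoelder) (use d V w in \<open>auto simp: field_simps\<close>)
  also have "\<dots> < \<infinity>"
    using V(2) w(2) epowr_less_top unfolding d_def by (simp add: ennreal_mult_less_top)
  finally show *: "Lpow (2 * real CARD('n) / (real CARD('n) + 2)) (\<lambda>x. V x * w x) < \<infinity>" unfolding d_def .
  show "integrable lborel (\<lambda>x. V x * w x)"
  proof (rule integrable_bounded_support[OF _ *])
    show "V y * w y = 0" if "y \<notin> cball x0 r" for y using supp[OF that] by simp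
  qed (use V w dim in \<open>auto intro!: borel_measurable_times simp: le_divide_eq\<close>)
qed

text \<open>The two potential terms are given as separate integrals. Combining them into one
  inhomogeneity needs each to be integrable, and this follows because \<eta> times the solution is
  in L^{2d/(d-2)}.\<close>

lemma weak_eq_of_sol:
  fixes u v :: "real^'n::finite \<Rightarrow> complex"
  assumes dim: "CARD('n) > 2" and u: "H1_data (ball x0 R) u g" and v: "H1_data (ball x0 R) v h"
    and V: "V \<in> borel_measurable borel" "Lpow (real CARD('n) / 2) V < \<infinity>"
    and W: "W \<in> borel_measurable borel" "Lpow (real CARD('n) / 2) W < \<infinity>"
    and sol: "weak_sol P (ball x0 R) u g V W v"
  shows "weak_eq P (ball x0 R) u g (\<lambda>x. W x * v x - V x * u x)"
  unfolding weak_eq_def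
proof
  fix \<eta> :: "real^'n \<Rightarrow> complex" assume \<eta>: "\<eta> \<in> test_functions (ball x0 R)"
  have i: "integrable lborel (\<lambda>y. V y * u y * \<eta> y)"
    if V: "V \<in> borel_measurable borel" "Lpow (real CARD('n) / 2) V < \<infinity>" and u: "H1_data (ball x0 R) u g" for V u g
  proof -
    have "integrable lborel (\<lambda>y. V y * (\<eta> y * u y))"
      by (rule potential_term_finite(2)[OF dim V H1_data_localize(1)[OF u \<eta>] local_sobolev[OF dim u \<eta>], of x0 R])
        (use test_outside[OF \<eta>] in auto)
    then show ?thesis by (simp add: mult_ac)
  qed
  have "(LINT y|lborel. (W y * v y - V y * u y) * \<eta> y) = (LINT y|lborel. W y * v y * \<eta> y) - (LINT y|lborel. V y * u y * \<eta> y)"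
    using i[OF W v] i[OF V u] by (subst Bochner_Integration.integral_diff[symmetric]) (auto simp: algebra_simps)
  also have "(LINT y|lborel. W y * v y * \<eta> y) = - (\<Sum>j\<in>UNIV. \<Sum>k\<in>UNIV. LINT y|lborel. g k y * D j (\<lambda>y. coeff2 P j k y * \<eta> y) y)
     + (\<Sum>j\<in>UNIV. LINT y|lborel. coeff1 P j y * g j y * \<eta> y) + (LINT y|lborel. coeff0 P y * u y * \<eta> y)
     + (LINT y|lborel. V y * u y * \<eta> y)"
    using bspec[OF sol[unfolded weak_sol_def] \<eta>] by simp
  finally show "- (\<Sum>j\<in>UNIV. \<Sum>k\<in>UNIV. LINT y|lborel. g k y * D j (\<lambda>y. coeff2 P j k y * \<eta> y) y)
     + (\<Sum>j\<in>UNIV. LINT y|lborel. coeff1 P j y * g j y * \<eta> y) + (LINT y|lborel. coeff0 P y * u y * \<eta> y)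
     = (LINT y|lborel. (W y * v y - V y * u y) * \<eta> y)" by simp
qed

lemma comm_term_props:
  fixes u :: "real^'n::finite \<Rightarrow> complex"
  assumes P: "test_coeffs P" and H: "H1_data B u g" and \<xi>: "\<xi> \<in> test_functions B"
  shows "comm_term P \<xi> u g \<in> borel_measurable borel" "Lpow 2 (comm_term P \<xi> u g) < \<infinity>"
proof -
  note h = H1_dataD[OF H]
  have a: "coeff2 P j k \<in> test_functions UNIV" "coeff1 P j \<in> test_functions UNIV" for j k
    using P by (auto simp: test_coeffs_def)
  note [measurable] = h(1) h(4) test_borel[OF test_D[OF \<xi>]] test_borel[OF test_D[OF test_D[OF \<xi>]]] test_borel[OF a(1)] test_borel[OF a(2)]
  show "comm_term P \<xi> u g \<in> borel_measurable borel" unfolding comm_term_def[abs_def] by measurable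
  have f: "Lpow 2 (\<lambda>x. c x * (e x * f x)) < \<infinity>" "(\<lambda>x. c x * (e x * f x)) \<in> borel_measurable borel"
    if "c \<in> test_functions UNIV" "e \<in> test_functions B" "f \<in> borel_measurable borel" "Lpow 2 f < \<infinity>" for c e f
  proof -
    note [measurable] = test_borel[OF that(1)] test_borel[OF that(2)] that(3)
    show "(\<lambda>x. c x * (e x * f x)) \<in> borel_measurable borel" by measurable
    have "Lpow 2 (\<lambda>x. e x * f x) < \<infinity>" by (rule Lpow_test_mult_finite[OF _ that(3,4,2)]) simp
    then show "Lpow 2 (\<lambda>x. c x * (e x * f x)) < \<infinity>"
      by (intro Lpow_test_mult_finite[OF _ _ _ that(1)]) (simp, measurable)
  qed
  show "Lpow 2 (comm_term P \<xi> u g) < \<infinity>" unfolding comm_term_def[abs_def]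
    by (intro Lpow_add_finite Lpow_sum_finite borel_measurable_sum borel_measurable_add f a test_D \<xi> h) auto
qed

lemma comm_term_outside:
  assumes "\<And>x. x \<notin> cball x0 r \<Longrightarrow> \<xi> x = 0" "x \<notin> cball x0 r"
  shows "comm_term P \<xi> u g x = 0"
proof -
  have 1: "D k \<xi> y = 0" if "y \<notin> cball x0 r" for k y by (rule D_zero_outside_cball[OF assms(1) that])
  have "D j (D k \<xi>) x = 0" for j k by (rule D_zero_outside_cball[OF 1 assms(2)])
  then show ?thesis unfolding comm_term_def using 1[OF assms(2)] by simp
qed

text \<open>The localized function solves an equation with right-hand side W \<xi> v - V \<xi> u
  plus the commutator. The extended Carleman estimate is raised to the power q/s, the triangle
  inequality is used twice (the two nested factors 2^q), and Hoelder's inequality turns the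
  potential terms into \<sigma> times the very quantities that stand on the left. The weight
  \<open>E\<close> passes through the product unchanged.\<close>

lemma one_equation:
  fixes u v :: "real^'n::finite \<Rightarrow> complex" and E :: "real^'n \<Rightarrow> real"
  assumes dim: "CARD('n) > 2"
  defines "d \<equiv> real CARD('n)"
  defines "q \<equiv> 2 * d / (d + 2)"
  defines "s \<equiv> 2 * d / (d - 2)"
  assumes E: "continuous_on UNIV E" "\<And>x. E x > 0" and K: "K \<ge> 0"
    and carl: "\<And>w. w \<in> test_functions (ball x0 R) \<Longrightarrow>
      Lpow s (\<lambda>x. of_real (E x) * w x) \<le> epowr (ennreal K * Lpow q (\<lambda>x. of_real (E x) * apply_op P w x)) (s / q)"
    and P: "test_coeffs P" and u: "H1_data (ball x0 R) u g" and v: "H1_data (ball x0 R) v h"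
    and V: "V \<in> borel_measurable borel" "Lpow (d / 2) V < \<infinity>" "epowr (Lpow (d / 2) V) (q / (d / 2)) \<le> ennreal \<sigma>"
    and W: "W \<in> borel_measurable borel" "Lpow (d / 2) W < \<infinity>" "epowr (Lpow (d / 2) W) (q / (d / 2)) \<le> ennreal \<sigma>"
    and sol: "weak_sol P (ball x0 R) u g V W v" and \<xi>: "\<xi> \<in> test_functions (ball x0 R)" and \<delta>: "\<delta> > 0"
  shows "epowr (Lpow s (\<lambda>x. of_real (E x) * (\<xi> x * u x))) (q / s) \<le> ennreal (K * (2 powr q * 2)) *
    (ennreal (2 powr q) * (ennreal (2 powr q) * (ennreal \<sigma> * epowr (Lpow s (\<lambda>x. of_real (E x) * (\<xi> x * v x))) (q / s)
       + ennreal \<sigma> * epowr (Lpow s (\<lambda>x. of_real (E x) * (\<xi> x * u x))) (q / s))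
       + Lpow q (\<lambda>x. of_real (E x) * comm_term P \<xi> u g x)) + ennreal \<delta>)"
proof -
  have d: "d > 2" using dim by (simp add: d_def)
  have q: "1 \<le> q" "q < 2" and s: "s > 0" and sq: "s / q \<ge> 0" "(s / q) * (q / s) = 1" and pqs: "1 / q = 1 / (d / 2) + 1 / s"
  proof -
    show "1 \<le> q" "q < 2" "s > 0" "s / q \<ge> 0" "1 / q = 1 / (d / 2) + 1 / s"
      using d by (auto simp: q_def s_def field_simps)
    have "q \<noteq> 0" "s \<noteq> 0" using d by (auto simp: q_def s_def)
    then show "(s / q) * (q / s) = 1" by simp
  qed
  note hu = H1_dataD[OF u] and hv = H1_dataD[OF v]
  have [measurable]: "E \<in> borel_measurable borel" by (rule borel_measurable_continuous_onI[OF E(1)])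
  note cp = comm_term_props[OF P u \<xi>]
  note [measurable] = hu(1) hv(1) V(1) W(1) test_borel[OF \<xi>] cp(1)
  obtain r where r: "r < R" "\<And>x. x \<notin> cball x0 r \<Longrightarrow> \<xi> x = 0" by (rule test_ball_support[OF \<xi>]) blast
  let ?X = "Lpow s (\<lambda>x. of_real (E x) * (\<xi> x * u x))"
  let ?Y = "Lpow s (\<lambda>x. of_real (E x) * (\<xi> x * v x))"
  define f where "f x = \<xi> x * (W x * v x - V x * u x) + comm_term P \<xi> u g x" for x
  have WL: "Lpow q (\<lambda>x. W x * (\<xi> x * v x)) < \<infinity>" "integrable lborel (\<lambda>x. W x * (\<xi> x * v x))"
    using potential_term_finite[OF dim W(1,2)[unfolded d_def] H1_data_localize(1)[OF v \<xi>] local_sobolev[OF dim v \<xi>], of x0 r]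
      r(2) unfolding q_def d_def by auto
  have VL: "Lpow q (\<lambda>x. V x * (\<xi> x * u x)) < \<infinity>" "integrable lborel (\<lambda>x. V x * (\<xi> x * u x))"
    using potential_term_finite[OF dim V(1,2)[unfolded d_def] H1_data_localize(1)[OF u \<xi>] local_sobolev[OF dim u \<xi>], of x0 r]
      r(2) unfolding q_def d_def by auto
  have iF: "integrable lborel (\<lambda>x. \<xi> x * (W x * v x - V x * u x))"
    using Bochner_Integration.integrable_diff[OF WL(2) VL(2)] by (simp add: algebra_simps)
  have eq: "weak_eq P (ball x0 R) (\<lambda>x. \<xi> x * u x) (\<lambda>k x. \<xi> x * g k x + D k \<xi> x * u x) f"
    unfolding f_def[abs_def]
    by (rule weak_eq_localize[OF P \<xi> hu(3) hu(6) iF hu(7) weak_eq_of_sol[OF dim u v V(1,2)[unfolded d_def] W(1,2)[unfolded d_def] sol]])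
  have fm [measurable]: "f \<in> borel_measurable borel" unfolding f_def[abs_def] by measurable
  have m1: "Lpow q (\<lambda>x. - (V x * (\<xi> x * u x))) = Lpow q (\<lambda>x. V x * (\<xi> x * u x))" by (simp add: Lpow_def)
  have fL: "Lpow q f < \<infinity>"
  proof -
    have "Lpow q (\<lambda>x. (W x * (\<xi> x * v x) + - (V x * (\<xi> x * u x))) + comm_term P \<xi> u g x) < \<infinity>"
    proof (intro Lpow_add_finite)
      show "Lpow q (comm_term P \<xi> u g) < \<infinity>"
        by (rule Lpow_mono_exponent[OF cp, of _ x0 r]) (use q comm_term_outside[OF r(2)] in auto)
    qed (use q WL m1 VL in \<open>auto intro!: borel_measurable_times borel_measurable_add borel_measurable_uminus hu hv V W test_borel[OF \<xi>] cp\<close>)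
    then show ?thesis by (simp add: f_def[abs_def] algebra_simps)
  qed
  have "?X \<le> epowr (ennreal (K * (2 powr q * 2)) * (Lpow q (\<lambda>x. of_real (E x) * f x) + ennreal \<delta>)) (s / q)"
  proof (rule carleman_extend[OF E q s sq(1) K carl P H1_data_localize(1,2)[OF u \<xi>] H1_data_localize(3,4)[OF u \<xi>] fm fL r(1) _ _ _ H1_data_localize(5)[OF u \<xi>] eq \<delta>])
    fix y assume y: "y \<notin> cball x0 r"
    show "\<xi> y * u y = 0" using r(2)[OF y] by simp
    show "\<xi> y * g k y + D k \<xi> y * u y = 0" for k using r(2)[OF y] D_zero_outside_cball[OF r(2) y] by simp
    show "f y = 0" using r(2)[OF y] comm_term_outside[OF r(2) y] by (simp add: f_def)
  qed
  then have "epowr ?X (q / s) \<le> epowr (epowr (ennreal (K * (2 powr q * 2)) * (Lpow q (\<lambda>x. of_real (E x) * f x) + ennreal \<delta>)) (s / q)) (q / s)"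
    using q s by (intro epowr_mono) auto
  also have "\<dots> = ennreal (K * (2 powr q * 2)) * (Lpow q (\<lambda>x. of_real (E x) * f x) + ennreal \<delta>)"
    unfolding epowr_epowr sq(2) by simp
  also have "\<dots> \<le> ennreal (K * (2 powr q * 2)) * (ennreal (2 powr q) * (ennreal (2 powr q) * (ennreal \<sigma> * epowr ?Y (q / s) + ennreal \<sigma> * epowr ?X (q / s))
       + Lpow q (\<lambda>x. of_real (E x) * comm_term P \<xi> u g x)) + ennreal \<delta>)"
  proof (intro mult_left_mono add_right_mono)
    have "Lpow q (\<lambda>x. of_real (E x) * f x) = Lpow q (\<lambda>x. (W x * (of_real (E x) * (\<xi> x * v x)) + - (V x * (of_real (E x) * (\<xi> x * u x)))) + of_real (E x) * comm_term P \<xi> u g x)"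
      by (simp add: f_def algebra_simps)
    also have "\<dots> \<le> ennreal (2 powr q) * (Lpow q (\<lambda>x. W x * (of_real (E x) * (\<xi> x * v x)) + - (V x * (of_real (E x) * (\<xi> x * u x)))) + Lpow q (\<lambda>x. of_real (E x) * comm_term P \<xi> u g x))"
      using q by (intro Lpow_add_le) (simp, measurable)
    also have "\<dots> \<le> ennreal (2 powr q) * (ennreal (2 powr q) * (ennreal \<sigma> * epowr ?Y (q / s) + ennreal \<sigma> * epowr ?X (q / s)) + Lpow q (\<lambda>x. of_real (E x) * comm_term P \<xi> u g x))"
    proof (intro mult_left_mono add_right_mono)
      have "Lpow q (\<lambda>x. W x * (of_real (E x) * (\<xi> x * v x)) + - (V x * (of_real (E x) * (\<xi> x * u x)))) \<le>
        ennreal (2 powr q) * (Lpow q (\<lambda>x. W x * (of_real (E x) * (\<xi> x * v x))) + Lpow q (\<lambda>x. - (V x * (of_real (E x) * (\<xi> x * u x)))))"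
        using q by (intro Lpow_add_le) (simp, measurable)
      also have "Lpow q (\<lambda>x. - (V x * (of_real (E x) * (\<xi> x * u x)))) = Lpow q (\<lambda>x. V x * (of_real (E x) * (\<xi> x * u x)))"
        by (simp add: Lpow_def)
      also have "ennreal (2 powr q) * (Lpow q (\<lambda>x. W x * (of_real (E x) * (\<xi> x * v x))) + Lpow q (\<lambda>x. V x * (of_real (E x) * (\<xi> x * u x))))
        \<le> ennreal (2 powr q) * (ennreal \<sigma> * epowr ?Y (q / s) + ennreal \<sigma> * epowr ?X (q / s))"
      proof (intro mult_left_mono add_mono)
        have "Lpow q (\<lambda>x. W x * (of_real (E x) * (\<xi> x * v x))) \<le> epowr (Lpow (d/2) W) (q / (d/2)) * epowr ?Y (q / s)"
          using d q s by (intro Lpow_Hoelder[OF _ _ _ pqs]) (auto intro!: borel_measurable_times borel_measurable_of_real hv W test_borel[OF \<xi>])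
        also have "\<dots> \<le> ennreal \<sigma> * epowr ?Y (q / s)" by (intro mult_right_mono W) simp
        finally show "Lpow q (\<lambda>x. W x * (of_real (E x) * (\<xi> x * v x))) \<le> ennreal \<sigma> * epowr ?Y (q / s)" .
        have "Lpow q (\<lambda>x. V x * (of_real (E x) * (\<xi> x * u x))) \<le> epowr (Lpow (d/2) V) (q / (d/2)) * epowr ?X (q / s)"
          using d q s by (intro Lpow_Hoelder[OF _ _ _ pqs]) (auto intro!: borel_measurable_times borel_measurable_of_real hu V test_borel[OF \<xi>])
        also have "\<dots> \<le> ennreal \<sigma> * epowr ?X (q / s)" by (intro mult_right_mono V) simp
        finally show "Lpow q (\<lambda>x. V x * (of_real (E x) * (\<xi> x * u x))) \<le> ennreal \<sigma> * epowr ?X (q / s)" .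
      qed simp
      finally show "Lpow q (\<lambda>x. W x * (of_real (E x) * (\<xi> x * v x)) + - (V x * (of_real (E x) * (\<xi> x * u x)))) \<le>
        ennreal (2 powr q) * (ennreal \<sigma> * epowr ?Y (q / s) + ennreal \<sigma> * epowr ?X (q / s))" .
    qed simp
    finally show "Lpow q (\<lambda>x. of_real (E x) * f x) \<le> ennreal (2 powr q) * (ennreal (2 powr q) * (ennreal \<sigma> * epowr ?Y (q / s) + ennreal \<sigma> * epowr ?X (q / s)) + Lpow q (\<lambda>x. of_real (E x) * comm_term P \<xi> u g x))" .
  qed simp
  finally show ?thesis .
qed

section \<open>Absorption and decay\<close>

text \<open>On the set in question the weight is at least e^{-\<tau>(c-\<kappa>)}. Hence the
  integral of |u|^s over it is at most C e^{-\<tau>\<kappa>s}, and \<tau> may tend to infinity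
  through the integers.\<close>

lemma weighted_decay_vanish:
  fixes u :: "real^'n::finite \<Rightarrow> complex"
  assumes \<phi>: "continuous_on UNIV \<phi>" and u: "u \<in> borel_measurable borel" and s: "s > 0" and \<kappa>: "\<kappa> > 0" and C: "C \<ge> 0"
    and \<xi>: "\<And>x. x \<in> ball x0 \<rho> \<Longrightarrow> \<xi> x = 1"
    and decay: "\<And>\<tau>. \<tau> \<ge> M \<Longrightarrow> Lpow s (\<lambda>x. of_real (exp (- \<tau> * \<phi> x)) * (\<xi> x * u x)) \<le> ennreal (exp (- \<tau> * c * s) * C)"
  shows "AE x in lborel. x \<in> {x \<in> ball x0 \<rho>. \<phi> x < c - \<kappa>} \<longrightarrow> u x = 0"
proof -
  have [measurable]: "\<phi> \<in> borel_measurable borel" by (rule borel_measurable_continuous_onI[OF \<phi>])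
  define W where "W = {x \<in> ball x0 \<rho>. \<phi> x < c - \<kappa>}"
  have "W = ball x0 \<rho> \<inter> {x \<in> space borel. \<phi> x < c - \<kappa>}" by (auto simp: W_def)
  then have W: "W \<in> sets borel" by (auto intro!: sets.Int)
  define I where "I = (\<integral>\<^sup>+x. indicator W x * ennreal (norm (u x) powr s) \<partial>lborel)"
  have Im: "(\<lambda>x. indicator W x * ennreal (norm (u x) powr s)) \<in> borel_measurable lborel"
    by (intro borel_measurable_times_ennreal borel_measurable_indicator) (use W u in auto)
  have bound: "I \<le> ennreal (exp (- \<tau> * \<kappa> * s) * C)" if \<tau>: "\<tau> \<ge> M" "\<tau> \<ge> 0" for \<tau>
  proof -
    have "ennreal (exp (- \<tau> * (c - \<kappa>) * s)) * I = (\<integral>\<^sup>+x. ennreal (exp (- \<tau> * (c - \<kappa>) * s)) * (indicator W x * ennreal (norm (u x) powr s)) \<partial>lborel)"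
      unfolding I_def by (rule nn_integral_cmult[symmetric, OF Im])
    also have "\<dots> \<le> Lpow s (\<lambda>x. of_real (exp (- \<tau> * \<phi> x)) * (\<xi> x * u x))"
      unfolding Lpow_def
    proof (rule nn_integral_mono)
      fix x
      show "ennreal (exp (- \<tau> * (c - \<kappa>) * s)) * (indicator W x * ennreal (norm (u x) powr s)) \<le> ennreal (norm (of_real (exp (- \<tau> * \<phi> x)) * (\<xi> x * u x)) powr s)"
      proof (cases "x \<in> W")
        case True
        then have x: "\<xi> x = 1" "\<phi> x \<le> c - \<kappa>" using \<xi> by (auto simp: W_def)
        have "\<tau> * \<phi> x * s \<le> \<tau> * (c - \<kappa>) * s" using x(2) \<tau>(2) s by (intro mult_right_mono mult_left_mono) auto
        then have "exp (- \<tau> * (c - \<kappa>) * s) \<le> exp (- \<tau> * \<phi> x * s)" by simp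
        then have "exp (- \<tau> * (c - \<kappa>) * s) * norm (u x) powr s \<le> exp (- \<tau> * \<phi> x) powr s * norm (u x) powr s"
          by (intro mult_right_mono) (auto simp: exp_powr_real)
        also have "\<dots> = norm (of_real (exp (- \<tau> * \<phi> x)) * (\<xi> x * u x)) powr s"
          by (simp add: x(1) norm_mult powr_mult)
        finally show ?thesis using True by (simp add: ennreal_mult[symmetric] ennreal_leI)
      qed simp
    qed
    also have "\<dots> \<le> ennreal (exp (- \<tau> * c * s) * C)" by (rule decay[OF \<tau>(1)])
    finally have "ennreal (exp (\<tau> * (c - \<kappa>) * s)) * (ennreal (exp (- \<tau> * (c - \<kappa>) * s)) * I) \<le> ennreal (exp (\<tau> * (c - \<kappa>) * s)) * ennreal (exp (- \<tau> * c * s) * C)"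
      by (rule mult_left_mono) simp
    moreover have "ennreal (exp (\<tau> * (c - \<kappa>) * s)) * (ennreal (exp (- \<tau> * (c - \<kappa>) * s)) * I) = I"
    proof -
      have "ennreal (exp (\<tau> * (c - \<kappa>) * s)) * ennreal (exp (- \<tau> * (c - \<kappa>) * s)) = ennreal (exp (\<tau> * (c - \<kappa>) * s) * exp (- \<tau> * (c - \<kappa>) * s))"
        by (rule ennreal_mult[symmetric]) auto
      also have "exp (\<tau> * (c - \<kappa>) * s) * exp (- \<tau> * (c - \<kappa>) * s) = 1" by (simp add: mult_exp_exp)
      finally show ?thesis by (simp only: mult.assoc[symmetric] ennreal_1 mult_1)
    qed
    moreover have "ennreal (exp (\<tau> * (c - \<kappa>) * s)) * ennreal (exp (- \<tau> * c * s) * C) = ennreal (exp (- \<tau> * \<kappa> * s) * C)"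
    proof -
      have "exp (\<tau> * (c - \<kappa>) * s) * exp (- \<tau> * c * s) = exp (- \<tau> * \<kappa> * s)"
        unfolding mult_exp_exp by (simp add: algebra_simps)
      then have "exp (\<tau> * (c - \<kappa>) * s) * (exp (- \<tau> * c * s) * C) = exp (- \<tau> * \<kappa> * s) * C"
        by (simp only: mult.assoc[symmetric])
      moreover have "ennreal (exp (\<tau> * (c - \<kappa>) * s)) * ennreal (exp (- \<tau> * c * s) * C) = ennreal (exp (\<tau> * (c - \<kappa>) * s) * (exp (- \<tau> * c * s) * C))"
        using C by (intro ennreal_mult[symmetric]) auto
      ultimately show ?thesis by (simp only:)
    qed
    ultimately show ?thesis by simp
  qed
  have "I \<le> 0"
  proof (rule tendsto_lowerbound)
    have "(\<lambda>n. exp (- (\<kappa> * s)) ^ n * C) \<longlonglongrightarrow> 0 * C"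
      using \<kappa> s by (intro tendsto_mult LIMSEQ_power_zero tendsto_const) auto
    then have "(\<lambda>n. ennreal (exp (- (\<kappa> * s)) ^ n * C)) \<longlonglongrightarrow> ennreal 0" by (intro tendsto_ennrealI) simp
    then show "(\<lambda>n. ennreal (exp (- (\<kappa> * s)) ^ n * C)) \<longlonglongrightarrow> 0" by simp
    obtain N :: nat where N: "M \<le> real N" using real_arch_simple by blast
    have "I \<le> ennreal (exp (- (\<kappa> * s)) ^ n * C)" if "n \<ge> N" for n
    proof -
      have "M \<le> real n" using N that by simp
      moreover have "exp (- (\<kappa> * s)) ^ n = exp (- real n * \<kappa> * s)" by (simp add: exp_of_nat_mult[symmetric] mult.assoc)
      ultimately show ?thesis using bound[of "real n"] by simp
    qed
    then show "\<forall>\<^sub>F n in sequentially. I \<le> ennreal (exp (- (\<kappa> * s)) ^ n * C)" by (auto simp: eventually_sequentially)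
  qed simp
  then have "AE x in lborel. indicator W x * ennreal (norm (u x) powr s) = 0"
    unfolding I_def using nn_integral_0_iff_AE[OF Im] by simp
  then show ?thesis unfolding W_def[symmetric]
  proof eventually_elim
    case (elim x)
    then show ?case using s by (auto simp: indicator_def powr_eq_0_iff)
  qed
qed

lemma Lpow_weight_finite:
  fixes f :: "real^'n::finite \<Rightarrow> complex" and E :: "real^'n \<Rightarrow> real"
  assumes p: "p > 0" and E: "continuous_on UNIV E" and f: "f \<in> borel_measurable borel" "Lpow p f < top"
    and supp: "\<And>y. y \<notin> cball x0 r \<Longrightarrow> f y = 0"
  shows "Lpow p (\<lambda>x. of_real (E x) * f x) < top"
proof -
  have "bounded (E ` cball x0 r)"
    by (intro compact_imp_bounded compact_continuous_image continuous_on_subset[OF E]) auto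
  then obtain B where B: "B > 0" "\<And>x. x \<in> cball x0 r \<Longrightarrow> \<bar>E x\<bar> \<le> B" unfolding bounded_pos by auto
  define k :: "real^'n \<Rightarrow> complex" where "k x = (if x \<in> cball x0 r then of_real (E x) else 0)" for x
  have "(\<lambda>x. of_real (E x) * f x) = (\<lambda>x. k x * f x)" using supp by (auto simp: k_def)
  moreover have "Lpow p (\<lambda>x. k x * f x) \<le> ennreal (B powr p) * Lpow p f"
    by (rule Lpow_bounded_mult[OF p f(1)]) (use B in \<open>auto simp: k_def\<close>)
  ultimately show ?thesis using f(2) by (auto simp: ennreal_mult_less_top intro: le_less_trans)
qed

text \<open>Add the two inequalities: the coefficient of x + y on the right is 2 K t^2 \<sigma>, at
  most 1/2. Since both quantities are finite, half of the sum can be subtracted. Adding is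
  essential, as either inequality alone contains the other unknown.\<close>

lemma carleman_absorb:
  fixes x y :: ennreal
  assumes fin: "x < top" "y < top" and nn: "K \<ge> 0" "t \<ge> 0" "\<sigma> \<ge> 0" "e \<ge> 0" "a \<ge> 0" "b \<ge> 0" and small: "K * (t * (t * \<sigma>)) \<le> 1/4"
    and x: "x \<le> ennreal K * (ennreal t * (ennreal t * (ennreal \<sigma> * y + ennreal \<sigma> * x) + ennreal (e * a)) + ennreal e)"
    and y: "y \<le> ennreal K * (ennreal t * (ennreal t * (ennreal \<sigma> * x + ennreal \<sigma> * y) + ennreal (e * b)) + ennreal e)"
  shows "x \<le> ennreal (e * (2 * K * (t * (a + b) + 2)))"
proof -
  obtain r where r: "x = ennreal r" "r \<ge> 0" using fin(1) by (cases x) auto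
  obtain z where z: "y = ennreal z" "z \<ge> 0" using fin(2) by (cases y) auto
  have conv: "ennreal K * (ennreal t * (ennreal t * (ennreal \<sigma> * ennreal p + ennreal \<sigma> * ennreal p') + ennreal (e * a')) + ennreal e)
    = ennreal (K * (t * (t * (\<sigma> * p + \<sigma> * p') + e * a') + e))" if "p \<ge> 0" "p' \<ge> 0" "a' \<ge> 0" for p p' a'
    using that nn by (simp add: ennreal_mult'[symmetric] ennreal_plus[symmetric] ennreal_mult[symmetric] del: ennreal_plus)
  have r1: "r \<le> K * (t * (t * (\<sigma> * z + \<sigma> * r) + e * a) + e)"
    using x unfolding r(1) z(1) conv[OF z(2) r(2) nn(5)] using nn r z by (subst (asm) ennreal_le_iff) (auto intro!: mult_nonneg_nonneg add_nonneg_nonneg)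
  have z1: "z \<le> K * (t * (t * (\<sigma> * r + \<sigma> * z) + e * b) + e)"
    using y unfolding r(1) z(1) conv[OF r(2) z(2) nn(6)] using nn r z by (subst (asm) ennreal_le_iff) (auto intro!: mult_nonneg_nonneg add_nonneg_nonneg)
  have "K * (t * (t * \<sigma>)) * (r + z) \<le> 1/4 * (r + z)" using small r z by (intro mult_right_mono) auto
  moreover have "r + z \<le> 2 * (K * (t * (t * \<sigma>)) * (r + z)) + e * K * (t * (a + b) + 2)"
    using r1 z1 by (simp add: algebra_simps)
  ultimately have "r \<le> e * (2 * K * (t * (a + b) + 2))" using z(2) by (simp add: algebra_simps)
  then show ?thesis unfolding r(1) by (rule ennreal_leI)
qed

text \<open>Where the commutator terms do not vanish, \<phi> is at least \<open>c\<close>, so their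
  weighted q-th powers are at most e^{-\<tau>cq} times constants. Taking the regularization error
  \<delta> to be the same exponential, every inhomogeneous term has this factor and absorption gives
  a bound e^{-\<tau>cq} \<open>C1\<close> with \<open>C1\<close> independent of \<tau>; undoing the
  power q/s gives the decay hypothesis of \<open>weighted_decay_vanish\<close>.\<close>

lemma carleman_uniqueness:
  fixes u v :: "real^'n::finite \<Rightarrow> complex" and \<phi> :: "real^'n \<Rightarrow> real"
  assumes dim: "CARD('n) > 2"
  defines "d \<equiv> real CARD('n)"
  defines "q \<equiv> 2 * d / (d + 2)"
  defines "s \<equiv> 2 * d / (d - 2)"
  assumes \<phi>: "continuous_on UNIV \<phi>" and K: "K \<ge> 0"
    and carl1: "\<And>w \<tau>. w \<in> test_functions (ball x0 R) \<Longrightarrow> \<tau> \<ge> M \<Longrightarrow>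
      Lpow s (\<lambda>x. of_real (exp (- \<tau> * \<phi> x)) * w x) \<le> epowr (ennreal K * Lpow q (\<lambda>x. of_real (exp (- \<tau> * \<phi> x)) * apply_op P1 w x)) (s / q)"
    and carl2: "\<And>w \<tau>. w \<in> test_functions (ball x0 R) \<Longrightarrow> \<tau> \<ge> M \<Longrightarrow>
      Lpow s (\<lambda>x. of_real (exp (- \<tau> * \<phi> x)) * w x) \<le> epowr (ennreal K * Lpow q (\<lambda>x. of_real (exp (- \<tau> * \<phi> x)) * apply_op P2 w x)) (s / q)"
    and P: "test_coeffs P1" "test_coeffs P2" and u: "H1_data (ball x0 R) u g" and v: "H1_data (ball x0 R) v h"
    and V1: "V1 \<in> borel_measurable borel" "Lpow (d / 2) V1 < \<infinity>" "epowr (Lpow (d / 2) V1) (q / (d / 2)) \<le> ennreal \<sigma>"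
    and V2: "V2 \<in> borel_measurable borel" "Lpow (d / 2) V2 < \<infinity>" "epowr (Lpow (d / 2) V2) (q / (d / 2)) \<le> ennreal \<sigma>"
    and V3: "V3 \<in> borel_measurable borel" "Lpow (d / 2) V3 < \<infinity>" "epowr (Lpow (d / 2) V3) (q / (d / 2)) \<le> ennreal \<sigma>"
    and \<sigma>: "\<sigma> \<ge> 0" "K * (2 powr q * 2) * (2 powr q * (2 powr q * \<sigma>)) \<le> 1/4"
    and sol1: "weak_sol P1 (ball x0 R) u g V1 V3 v" and sol2: "weak_sol P2 (ball x0 R) v h V2 V3 u"
    and \<xi>: "\<xi> \<in> test_functions (ball x0 R)" "\<And>x. x \<in> ball x0 \<rho> \<Longrightarrow> \<xi> x = 1" and \<rho>: "\<rho> > 0" and c: "c > \<phi> x0"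
    and z1: "AE x in lborel. \<phi> x < c \<longrightarrow> comm_term P1 \<xi> u g x = 0"
    and z2: "AE x in lborel. \<phi> x < c \<longrightarrow> comm_term P2 \<xi> v h x = 0"
  obtains W where "open W" "x0 \<in> W" "W \<subseteq> ball x0 \<rho>" "AE x in lborel. x \<in> W \<longrightarrow> u x = 0" "AE x in lborel. x \<in> W \<longrightarrow> v x = 0"
proof -
  have d: "d > 2" using dim by (simp add: d_def)
  have q: "1 \<le> q" "q < 2" and s: "s > 0" and qs: "q / s * (s / q) = 1"
  proof -
    show "1 \<le> q" "q < 2" "s > 0"
      using d by (auto simp: q_def s_def field_simps)
    have "q \<noteq> 0" "s \<noteq> 0" using d by (auto simp: q_def s_def)
    then show "q / s * (s / q) = 1" by simp
  qed
  obtain r where r: "r < R" "\<And>x. x \<notin> cball x0 r \<Longrightarrow> \<xi> x = 0" by (rule test_ball_support[OF \<xi>(1)]) blast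
  define lu where "lu = enn2real (Lpow q (comm_term P1 \<xi> u g))"
  define lv where "lv = enn2real (Lpow q (comm_term P2 \<xi> v h))"
  have "Lpow q (comm_term P1 \<xi> u g) < \<infinity>"
    by (rule Lpow_mono_exponent[OF comm_term_props[OF P(1) u \<xi>(1)], of _ x0 r]) (use q comm_term_outside[OF r(2)] in auto)
  then have lu: "Lpow q (comm_term P1 \<xi> u g) = ennreal lu" "lu \<ge> 0" by (auto simp: lu_def)
  have "Lpow q (comm_term P2 \<xi> v h) < \<infinity>"
    by (rule Lpow_mono_exponent[OF comm_term_props[OF P(2) v \<xi>(1)], of _ x0 r]) (use q comm_term_outside[OF r(2)] in auto)
  then have lv: "Lpow q (comm_term P2 \<xi> v h) = ennreal lv" "lv \<ge> 0" by (auto simp: lv_def)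
  have weight: "Lpow q (\<lambda>x. of_real (exp (- \<tau> * \<phi> x)) * f x) \<le> ennreal (exp (- \<tau> * c * q) * l)"
    if \<tau>: "\<tau> \<ge> 0" and z: "AE x in lborel. \<phi> x < c \<longrightarrow> f x = 0" and l: "Lpow q f = ennreal l" "l \<ge> 0" and f: "f \<in> borel_measurable borel" for \<tau> f l
  proof -
    have "Lpow q (\<lambda>x. of_real (exp (- \<tau> * \<phi> x)) * f x) \<le> (\<integral>\<^sup>+x. ennreal (exp (- \<tau> * c * q)) * ennreal (norm (f x) powr q) \<partial>lborel)"
      unfolding Lpow_def
    proof (rule nn_integral_mono_AE, use z in eventually_elim)
      fix x assume x: "\<phi> x < c \<longrightarrow> f x = 0"
      show "ennreal (norm (of_real (exp (- \<tau> * \<phi> x)) * f x) powr q) \<le> ennreal (exp (- \<tau> * c * q)) * ennreal (norm (f x) powr q)"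
      proof (cases "\<phi> x < c")
        case False
        have "\<tau> * c * q \<le> \<tau> * \<phi> x * q" using False \<tau> q by (intro mult_right_mono mult_left_mono) auto
        then have "exp (- \<tau> * \<phi> x) powr q \<le> exp (- \<tau> * c * q)" by (simp add: exp_powr_real)
        then have "exp (- \<tau> * \<phi> x) powr q * norm (f x) powr q \<le> exp (- \<tau> * c * q) * norm (f x) powr q" by (rule mult_right_mono) simp
        then have "norm (of_real (exp (- \<tau> * \<phi> x)) * f x) powr q \<le> exp (- \<tau> * c * q) * norm (f x) powr q"
          by (simp add: norm_mult powr_mult)
        then show ?thesis by (simp add: ennreal_mult[symmetric] ennreal_leI)
      qed (use x in simp)
    qed
    also have "\<dots> = ennreal (exp (- \<tau> * c * q)) * Lpow q f" unfolding Lpow_def by (rule nn_integral_cmult) (use f in measurable)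
    finally show ?thesis unfolding l(1) using l(2) by (simp add: ennreal_mult)
  qed
  have fin: "epowr (Lpow s (\<lambda>x. of_real (exp (- \<tau> * \<phi> x)) * (\<xi> x * u x))) (q / s) < top" if u: "H1_data (ball x0 R) u g" for \<tau> u g
  proof (rule epowr_less_top, rule Lpow_weight_finite[OF s])
    show "continuous_on UNIV (\<lambda>x. exp (- \<tau> * \<phi> x))" by (intro continuous_intros \<phi>)
    show "Lpow s (\<lambda>x. \<xi> x * u x) < top" using local_sobolev[OF dim u \<xi>(1)] by (simp add: s_def d_def)
    show "\<xi> y * u y = 0" if "y \<notin> cball x0 r" for y using r(2)[OF that] by simp
  qed (rule H1_data_localize(1)[OF u \<xi>(1)])
  define K2 where "K2 = K * (2 powr q * 2)"
  define C1 where "C1 = 2 * K2 * (2 powr q * (lu + lv) + 2)"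
  have K2: "K2 \<ge> 0" using K by (simp add: K2_def)
  have C1: "C1 \<ge> 0" using K2 lu lv by (simp add: C1_def)
  have decay: "Lpow s (\<lambda>x. of_real (exp (- \<tau> * \<phi> x)) * (\<xi> x * u x)) \<le> ennreal (exp (- \<tau> * c * s) * C1 powr (s / q)) \<and>
     Lpow s (\<lambda>x. of_real (exp (- \<tau> * \<phi> x)) * (\<xi> x * v x)) \<le> ennreal (exp (- \<tau> * c * s) * C1 powr (s / q))" if "\<tau> \<ge> max M 0" for \<tau>
  proof -
    have \<tau>: "\<tau> \<ge> M" "\<tau> \<ge> 0" using that by auto
    let ?E = "\<lambda>x. exp (- \<tau> * \<phi> x)"
    let ?x = "epowr (Lpow s (\<lambda>x. of_real (?E x) * (\<xi> x * u x))) (q / s)"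
    let ?y = "epowr (Lpow s (\<lambda>x. of_real (?E x) * (\<xi> x * v x))) (q / s)"
    define e where "e = exp (- \<tau> * c * q)"
    have e: "e > 0" by (simp add: e_def)
    have Ec: "continuous_on UNIV ?E" by (intro continuous_intros \<phi>)
    have x1: "?x \<le> ennreal K2 * (ennreal (2 powr q) * (ennreal (2 powr q) * (ennreal \<sigma> * ?y + ennreal \<sigma> * ?x) + ennreal (e * lu)) + ennreal e)"
      unfolding K2_def
      by (rule order_trans[OF one_equation[OF dim Ec _ K _ P(1) u v V1[unfolded d_def q_def] V3[unfolded d_def q_def] sol1 \<xi>(1) e, folded d_def, folded q_def s_def]])
        (use carl1 \<tau> weight[OF \<tau>(2) z1 lu comm_term_props(1)[OF P(1) u \<xi>(1)]] in \<open>auto simp: e_def intro!: mult_left_mono add_mono add_left_mono\<close>)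
    have y1: "?y \<le> ennreal K2 * (ennreal (2 powr q) * (ennreal (2 powr q) * (ennreal \<sigma> * ?x + ennreal \<sigma> * ?y) + ennreal (e * lv)) + ennreal e)"
      unfolding K2_def
      by (rule order_trans[OF one_equation[OF dim Ec _ K _ P(2) v u V2[unfolded d_def q_def] V3[unfolded d_def q_def] sol2 \<xi>(1) e, folded d_def, folded q_def s_def]])
        (use carl2 \<tau> weight[OF \<tau>(2) z2 lv comm_term_props(1)[OF P(2) v \<xi>(1)]] in \<open>auto simp: e_def intro!: mult_left_mono add_mono add_left_mono\<close>)
    have small: "K2 * (2 powr q * (2 powr q * \<sigma>)) \<le> 1/4" using \<sigma>(2) by (simp add: K2_def)
    have xb: "?x \<le> ennreal (e * C1)" unfolding C1_def
      by (rule carleman_absorb[OF fin[OF u] fin[OF v] K2 _ \<sigma>(1) _ lu(2) lv(2) small x1 y1]) (use e in auto)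
    have yb: "?y \<le> ennreal (e * C1)" unfolding C1_def add.commute[of lu lv]
      by (rule carleman_absorb[OF fin[OF v] fin[OF u] K2 _ \<sigma>(1) _ lv(2) lu(2) small y1 x1]) (use e in auto)
    have unpow: "z \<le> ennreal (exp (- \<tau> * c * s) * C1 powr (s / q))" if "epowr z (q / s) \<le> ennreal (e * C1)" for z
    proof -
      have "epowr (epowr z (q / s)) (s / q) \<le> epowr (ennreal (e * C1)) (s / q)"
        using that q s by (intro epowr_mono) auto
      then have "z \<le> epowr (ennreal (e * C1)) (s / q)" unfolding epowr_epowr qs by simp
      also have "\<dots> = ennreal ((e * C1) powr (s / q))" using e C1 q s by (intro epowr_ennreal) auto
      also have "(e * C1) powr (s / q) = e powr (s / q) * C1 powr (s / q)" using e C1 by (simp add: powr_mult)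
      also have "e powr (s / q) = exp (- \<tau> * c * s)" using q by (simp add: e_def exp_powr_real)
      finally show ?thesis .
    qed
    show ?thesis using unpow[OF xb] unpow[OF yb] by blast
  qed
  \<comment> \<open>Half the gap: c - \<kappa> is the midpoint of \<phi>(x0) and \<open>c\<close>,
    so the sublevel set \<open>W\<close> contains \<open>x0\<close> and there is still exponential
    decay left on it.\<close>
  define \<kappa> where "\<kappa> = (c - \<phi> x0) / 2"
  have \<kappa>: "\<kappa> > 0" using c by (simp add: \<kappa>_def)
  define W where "W = {x \<in> ball x0 \<rho>. \<phi> x < c - \<kappa>}"
  show ?thesis
  proof (rule that[of W])
    have "W = ball x0 \<rho> \<inter> \<phi> -` {..<c - \<kappa>}" by (auto simp: W_def)
    then show "open W" using \<phi> by (simp add: open_Int open_vimage)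
    show "x0 \<in> W" using \<rho> c by (simp add: W_def \<kappa>_def field_simps)
    show "W \<subseteq> ball x0 \<rho>" by (auto simp: W_def)
    show "AE x in lborel. x \<in> W \<longrightarrow> u x = 0" unfolding W_def
      by (rule weighted_decay_vanish[OF \<phi> H1_dataD(1)[OF u] s \<kappa> powr_ge_zero \<xi>(2) decay[THEN conjunct1]])
    show "AE x in lborel. x \<in> W \<longrightarrow> v x = 0" unfolding W_def
      by (rule weighted_decay_vanish[OF \<phi> H1_dataD(1)[OF v] s \<kappa> powr_ge_zero \<xi>(2) decay[THEN conjunct2]])
  qed
qed

section \<open>Representatives on a ball\<close>

text \<open>The data are Lebesgue measurable and arbitrary off \<Omega>, while the estimates use
  Borel functions and \<open>lborel\<close>. The last conjunct retains the measurability of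
  \<open>f\<close> on \<open>B\<close>, which is needed to replace \<open>f\<close> by
  \<open>g\<close> under an integral.\<close>

definition rep :: "(real^'n::finite) set \<Rightarrow> (real^'n \<Rightarrow> complex) \<Rightarrow> (real^'n \<Rightarrow> complex) \<Rightarrow> bool" where
  "rep B f g \<longleftrightarrow> g \<in> borel_measurable borel \<and> (\<forall>x. x \<notin> B \<longrightarrow> g x = 0) \<and> (AE x in lborel. x \<in> B \<longrightarrow> g x = f x) \<and>
     set_borel_measurable lebesgue B f"

lemma repD:
  assumes "rep B f g"
  shows "g \<in> borel_measurable borel" "\<And>x. x \<notin> B \<Longrightarrow> g x = 0" "AE x in lborel. x \<in> B \<longrightarrow> g x = f x" "set_borel_measurable lebesgue B f"
  using assms by (auto simp: rep_def)

lemma rep_exists: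
  fixes f :: "real^'n::finite \<Rightarrow> complex"
  assumes f: "set_borel_measurable lebesgue \<Omega> f" and B: "B \<in> sets borel" "B \<subseteq> \<Omega>"
  obtains g where "rep B f g"
proof -
  have BL: "B \<in> sets lebesgue" using B(1) by (simp add: sets_completionI_sets)
  have mF: "set_borel_measurable lebesgue B f" by (rule set_borel_measurable_subset[OF f BL B(2)])
  define F where "F x = indicat_real B x *\<^sub>R f x" for x
  have [measurable]: "F \<in> borel_measurable lebesgue"
    using mF unfolding F_def set_borel_measurable_def .
  obtain a where a: "a \<in> borel_measurable lborel" "AE x in lborel. Re (F x) = a x"
    using completion_ex_borel_measurable_real[of "\<lambda>x. Re (F x)" lborel] by auto
  obtain b where b: "b \<in> borel_measurable lborel" "AE x in lborel. Im (F x) = b x"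
    using completion_ex_borel_measurable_real[of "\<lambda>x. Im (F x)" lborel] by auto
  define g where "g x = indicat_real B x *\<^sub>R (complex_of_real (a x) + \<i> * complex_of_real (b x))" for x
  have "rep B f g" unfolding rep_def
  proof (intro conjI allI impI mF)
    have "indicat_real B \<in> borel_measurable borel" using B(1) by (rule borel_measurable_indicator)
    then show "g \<in> borel_measurable borel" unfolding g_def using a(1) b(1)
      by (intro borel_measurable_scaleR borel_measurable_add borel_measurable_times borel_measurable_of_real borel_measurable_const) auto
    show "g x = 0" if "x \<notin> B" for x using that by (simp add: g_def)
    show "AE x in lborel. x \<in> B \<longrightarrow> g x = f x" using a(2) b(2)
    proof eventually_elim
      case (elim x)
      then show ?case by (auto simp: g_def F_def complex_eq_iff)
    qed
  qed
  then show ?thesis by (rule that)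
qed

lemma rep_mult:
  fixes f f' :: "real^'n::finite \<Rightarrow> complex"
  assumes "rep B f g" "rep B f' g'"
  shows "rep B (\<lambda>x. f x * f' x) (\<lambda>x. g x * g' x)"
  unfolding rep_def
proof (intro conjI allI impI)
  show "(\<lambda>x. g x * g' x) \<in> borel_measurable borel"
    using repD(1)[OF assms(1)] repD(1)[OF assms(2)] by (rule borel_measurable_times)
  show "g x * g' x = 0" if "x \<notin> B" for x using repD(2)[OF assms(1) that] by simp
  show "AE x in lborel. x \<in> B \<longrightarrow> g x * g' x = f x * f' x"
    using repD(3)[OF assms(1)] repD(3)[OF assms(2)] by eventually_elim auto
  have "(\<lambda>x. (indicat_real B x *\<^sub>R f x) * (indicat_real B x *\<^sub>R f' x)) \<in> borel_measurable lebesgue"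
    using repD(4)[OF assms(1)] repD(4)[OF assms(2)] unfolding set_borel_measurable_def by (rule borel_measurable_times)
  moreover have "(\<lambda>x. (indicat_real B x *\<^sub>R f x) * (indicat_real B x *\<^sub>R f' x)) = (\<lambda>x. indicat_real B x *\<^sub>R (f x * f' x))"
    by (auto simp: indicator_def)
  ultimately show "set_borel_measurable lebesgue B (\<lambda>x. f x * f' x)" unfolding set_borel_measurable_def by simp
qed

lemma rep_subset:
  fixes f :: "real^'n::finite \<Rightarrow> complex"
  assumes r: "rep B f g" and B: "B' \<subseteq> B" "B' \<in> sets borel"
  shows "rep B' f (\<lambda>x. indicat_real B' x *\<^sub>R g x)"
  unfolding rep_def
proof (intro conjI allI impI)
  show "(\<lambda>x. indicat_real B' x *\<^sub>R g x) \<in> borel_measurable borel"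
    using repD(1)[OF r] B(2) by (intro borel_measurable_scaleR borel_measurable_indicator)
  show "AE x in lborel. x \<in> B' \<longrightarrow> indicat_real B' x *\<^sub>R g x = f x"
    using repD(3)[OF r] by eventually_elim (use B in auto)
  show "set_borel_measurable lebesgue B' f"
    by (rule set_borel_measurable_subset[OF repD(4)[OF r] _ B(1)]) (use B(2) in \<open>simp add: sets_completionI_sets\<close>)
qed simp

text \<open>Off \<open>B\<close> the test function is 0 and in \<open>B\<close> the functions agree
  almost everywhere. Both integrands are measurable, so the Bochner integrals agree whether or not
  they are integrable.\<close>

lemma rep_distr:
  fixes f :: "real^'n::finite \<Rightarrow> complex"
  assumes r: "rep B f g" and B: "B \<subseteq> \<Omega>" and \<eta>: "\<eta> \<in> test_functions B"
  shows "distr_of \<Omega> f \<eta> = (LINT x|lborel. g x * \<eta> x)"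
proof -
  have gm: "(\<lambda>x. g x * \<eta> x) \<in> borel_measurable lborel"
    using repD(1)[OF r] test_borel[OF \<eta>] by (simp add: borel_measurable_times)
  have eq: "indicat_real \<Omega> x *\<^sub>R (f x * \<eta> x) = (indicat_real B x *\<^sub>R f x) * \<eta> x" for x
    using test_outside[OF \<eta>, of x] B by (cases "x \<in> B") auto
  have "distr_of \<Omega> f \<eta> = (LINT x|lebesgue. (indicat_real B x *\<^sub>R f x) * \<eta> x)"
    unfolding distr_of_def set_lebesgue_integral_def eq ..
  also have "\<dots> = (LINT x|lebesgue. g x * \<eta> x)"
  proof (rule integral_cong_AE)
    show "(\<lambda>x. (indicat_real B x *\<^sub>R f x) * \<eta> x) \<in> borel_measurable lebesgue"
      by (rule borel_measurable_times[OF repD(4)[OF r, unfolded set_borel_measurable_def]])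
        (use test_borel[OF \<eta>] in \<open>simp add: measurable_completion\<close>)
    show "(\<lambda>x. g x * \<eta> x) \<in> borel_measurable lebesgue" by (rule measurable_completion[OF gm])
    show "AE x in lebesgue. (indicat_real B x *\<^sub>R f x) * \<eta> x = g x * \<eta> x"
      unfolding AE_completion_iff using repD(3)[OF r]
    proof eventually_elim
      case (elim x)
      then show ?case using repD(2)[OF r, of x] by (cases "x \<in> B") auto
    qed
  qed
  also have "\<dots> = (LINT x|lborel. g x * \<eta> x)" by (rule integral_completion[OF gm])
  finally show ?thesis .
qed

lemma rep_Lpow_finite:
  fixes f :: "real^'n::finite \<Rightarrow> complex"
  assumes r: "rep B f g" and B: "B \<subseteq> \<Omega>" and p: "p > 0" and f: "mem_Lp p \<Omega> f"
  shows "Lpow p g < \<infinity>"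
proof -
  have "integrable lebesgue (\<lambda>x. indicat_real \<Omega> x *\<^sub>R (norm (f x) powr p))"
    using f unfolding mem_Lp_def set_integrable_def by blast
  then have "(\<integral>\<^sup>+x. ennreal (norm (indicat_real \<Omega> x *\<^sub>R (norm (f x) powr p))) \<partial>lebesgue) < \<infinity>"
    by (simp add: integrable_iff_bounded)
  then have fin: "(\<integral>\<^sup>+x. ennreal (norm (indicat_real \<Omega> x *\<^sub>R (norm (f x) powr p))) \<partial>lborel) < \<infinity>"
    by (simp only: nn_integral_completion)
  have "Lpow p g \<le> (\<integral>\<^sup>+x. ennreal (norm (indicat_real \<Omega> x *\<^sub>R (norm (f x) powr p))) \<partial>lborel)"
    unfolding Lpow_def
  proof (rule nn_integral_mono_AE, use repD(3)[OF r] in eventually_elim)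
    fix x assume x: "x \<in> B \<longrightarrow> g x = f x"
    show "ennreal (norm (g x) powr p) \<le> ennreal (norm (indicat_real \<Omega> x *\<^sub>R (norm (f x) powr p)))"
      using x repD(2)[OF r, of x] B p by (cases "x \<in> B") auto
  qed
  with fin show ?thesis by (rule le_less_trans[rotated])
qed

text \<open>The last conclusion is kept beside the weak derivative because second-order terms are
  evaluated on the distribution D_k u as it stands in the equation, which must be replaced by a
  function on every test function of the ball.\<close>

lemma H1_extract:
  fixes u :: "real^'n::finite \<Rightarrow> complex"
  assumes u: "mem_H1 \<Omega> u" and B: "ball x0 R \<subseteq> \<Omega>"
  obtains u0 g0 where "rep (ball x0 R) u u0" "H1_data (ball x0 R) u0 g0"
    "\<And>\<eta> k. \<eta> \<in> test_functions (ball x0 R) \<Longrightarrow> distr_D k (distr_of \<Omega> u) \<eta> = (LINT x|lborel. g0 k x * \<eta> x)"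
proof -
  have uL: "mem_Lp 2 \<Omega> u" using u by (simp add: mem_H1_def)
  then have "set_borel_measurable lebesgue \<Omega> u" by (simp add: mem_Lp_def)
  then obtain u0 where u0: "rep (ball x0 R) u u0" by (rule rep_exists[OF _ _ B]) auto
  have "\<forall>k. \<exists>g. mem_Lp 2 \<Omega> g \<and> (\<forall>\<eta>\<in>test_functions \<Omega>. distr_D k (distr_of \<Omega> u) \<eta> = distr_of \<Omega> g \<eta>)"
    using u by (simp add: mem_H1_def)
  then obtain g where g: "\<And>k. mem_Lp 2 \<Omega> (g k)" "\<And>k \<eta>. \<eta> \<in> test_functions \<Omega> \<Longrightarrow> distr_D k (distr_of \<Omega> u) \<eta> = distr_of \<Omega> (g k) \<eta>"
    unfolding choice_iff by blast
  have "\<forall>k. \<exists>h. rep (ball x0 R) (g k) h"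
  proof
    fix k
    have "set_borel_measurable lebesgue \<Omega> (g k)" using g(1) by (simp add: mem_Lp_def)
    then show "\<exists>h. rep (ball x0 R) (g k) h" by (rule rep_exists[OF _ _ B]) auto
  qed
  then obtain g0 where g0: "\<And>k. rep (ball x0 R) (g k) (g0 k)" by metis
  have L: "Lpow 2 u0 < \<infinity>" "Lpow 2 (g0 k) < \<infinity>" for k
    by (rule rep_Lpow_finite[OF u0 B _ uL], simp, rule rep_Lpow_finite[OF g0 B _ g(1)], simp)
  have I: "integrable lborel f" if "rep (ball x0 R) h f" "Lpow 2 f < \<infinity>" for f h
    by (rule integrable_bounded_support[OF repD(1)[OF that(1)] that(2), of x0 R]) (use repD(2)[OF that(1)] in auto)
  have D: "distr_D k (distr_of \<Omega> u) \<eta> = (LINT x|lborel. g0 k x * \<eta> x)" if "\<eta> \<in> test_functions (ball x0 R)" for \<eta> k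
    using g(2)[OF test_mono[OF that B]] rep_distr[OF g0 B that] by simp
  show ?thesis
  proof (rule that[OF u0 _ D])
    show "H1_data (ball x0 R) u0 g0" unfolding H1_data_def
    proof (intro conjI allI repD(1)[OF u0] repD(1)[OF g0] L I[OF u0] I[OF g0])
      fix k
      show "weak_D (ball x0 R) k u0 (g0 k)" unfolding weak_D_def
      proof
        fix \<eta> :: "real^'n \<Rightarrow> complex" assume \<eta>: "\<eta> \<in> test_functions (ball x0 R)"
        show "- (LINT x|lborel. u0 x * D k \<eta> x) = (LINT x|lborel. g0 k x * \<eta> x)"
          using D[OF \<eta>, of k] rep_distr[OF u0 B test_D[OF \<eta>], of k] by (simp add: distr_D_def)
      qed
    qed
  qed
qed

text \<open>Unfolding the distributional operator moves the coefficient and one derivative to the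
  test function, while the derivative acting first is represented by \<open>g0\<close>. The single
  transfer accounts for the minus sign in front of the second-order sum. \<open>Q\<close> may
  replace \<open>P\<close> because the test function is supported where the coefficients
  agree.\<close>

lemma weak_sol_extract:
  fixes u v :: "real^'n::finite \<Rightarrow> complex"
  assumes sol: "solves_on \<Omega> P V u W v" and B: "open B" "B \<subseteq> \<Omega>"
    and P: "\<And>j k x. x \<in> B \<Longrightarrow> coeff2 Q j k x = coeff2 P j k x" "\<And>j x. x \<in> B \<Longrightarrow> coeff1 Q j x = coeff1 P j x" "\<And>x. x \<in> B \<Longrightarrow> coeff0 Q x = coeff0 P x"
    and Q: "test_coeffs Q"
    and u: "rep B u u0" and v: "rep B v v0" and V: "rep B V V0" and W: "rep B W W0"
    and D: "\<And>\<eta> k. \<eta> \<in> test_functions B \<Longrightarrow> distr_D k (distr_of \<Omega> u) \<eta> = (LINT x|lborel. g0 k x * \<eta> x)"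
  shows "weak_sol Q B u0 g0 V0 W0 v0"
  unfolding weak_sol_def
proof
  fix \<eta> :: "real^'n \<Rightarrow> complex" assume \<eta>: "\<eta> \<in> test_functions B"
  let ?T = "distr_of \<Omega> u"
  have e2: "(\<lambda>x. coeff2 P j k x * \<eta> x) = (\<lambda>x. coeff2 Q j k x * \<eta> x)"
    and e1: "(\<lambda>x. coeff1 P j x * \<eta> x) = (\<lambda>x. coeff1 Q j x * \<eta> x)"
    and e0: "(\<lambda>x. coeff0 P x * \<eta> x) = (\<lambda>x. coeff0 Q x * \<eta> x)" for j k
    using P test_outside[OF \<eta>] by (metis mult_zero_right)+
  have t: "(\<lambda>x. coeff2 Q j k x * \<eta> x) \<in> test_functions B" "(\<lambda>x. coeff1 Q j x * \<eta> x) \<in> test_functions B" "(\<lambda>x. coeff0 Q x * \<eta> x) \<in> test_functions B" for j k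
    using Q by (auto simp: test_coeffs_def intro!: test_mult(1)[OF \<eta>] test_smooth[of _ UNIV])
  have "distr_apply_op P ?T \<eta> = (\<Sum>j\<in>UNIV. \<Sum>k\<in>UNIV. - (LINT y|lborel. g0 k y * D j (\<lambda>y. coeff2 Q j k y * \<eta> y) y))
     + (\<Sum>j\<in>UNIV. LINT y|lborel. g0 j y * (coeff1 Q j y * \<eta> y)) + (LINT y|lborel. u0 y * (coeff0 Q y * \<eta> y))"
  proof -
    have "distr_mult (coeff2 P j k) (distr_D j (distr_D k ?T)) \<eta> = - (LINT y|lborel. g0 k y * D j (\<lambda>y. coeff2 Q j k y * \<eta> y) y)" for j k
      unfolding distr_mult_def e2 by (subst distr_D_def) (simp only: D[OF test_D[OF t(1)]])
    moreover have "distr_mult (coeff1 P j) (distr_D j ?T) \<eta> = (LINT y|lborel. g0 j y * (coeff1 Q j y * \<eta> y))" for j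
      unfolding distr_mult_def e1 by (rule D[OF t(2)])
    moreover have "distr_mult (coeff0 P) ?T \<eta> = (LINT y|lborel. u0 y * (coeff0 Q y * \<eta> y))"
      unfolding distr_mult_def e0 by (rule rep_distr[OF u B(2) t(3)])
    ultimately show ?thesis unfolding distr_apply_op_def by simp
  qed
  moreover have "distr_apply_op P ?T \<eta> + distr_of \<Omega> (\<lambda>x. V x * u x) \<eta> = distr_of \<Omega> (\<lambda>x. W x * v x) \<eta>"
    using sol test_mono[OF \<eta> B(2)] unfolding solves_on_def by blast
  moreover have "distr_of \<Omega> (\<lambda>x. V x * u x) \<eta> = (LINT y|lborel. V0 y * u0 y * \<eta> y)"
    by (rule rep_distr[OF rep_mult[OF V u] B(2) \<eta>])
  moreover have "distr_of \<Omega> (\<lambda>x. W x * v x) \<eta> = (LINT y|lborel. W0 y * v0 y * \<eta> y)"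
    by (rule rep_distr[OF rep_mult[OF W v] B(2) \<eta>])
  ultimately show "- (\<Sum>j\<in>UNIV. \<Sum>k\<in>UNIV. LINT y|lborel. g0 k y * D j (\<lambda>y. coeff2 Q j k y * \<eta> y) y)
     + (\<Sum>j\<in>UNIV. LINT y|lborel. coeff1 Q j y * g0 j y * \<eta> y) + (LINT y|lborel. coeff0 Q y * u0 y * \<eta> y)
     + (LINT y|lborel. V0 y * u0 y * \<eta> y) = (LINT y|lborel. W0 y * v0 y * \<eta> y)"
    by (simp add: sum_negf mult_ac)
qed

section \<open>Transfer of the Carleman hypothesis to cut-off operators and extended weights\<close>

lemma test_zero: "(\<lambda>x. 0) \<in> test_functions \<Omega>"
  by (rule test_functionsI[OF smooth_on_const compact_empty]) auto

lemma test_sum: "finite I \<Longrightarrow> (\<And>i. i \<in> I \<Longrightarrow> f i \<in> test_functions \<Omega>) \<Longrightarrow> (\<lambda>x. \<Sum>i\<in>I. f i x) \<in> test_functions \<Omega>"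
  by (induction I rule: finite_induct) (auto intro: test_zero test_add)

lemma apply_op_test:
  assumes Q: "test_coeffs Q" and w: "w \<in> test_functions B"
  shows "apply_op Q w \<in> test_functions B"
proof -
  have c: "smooth_on UNIV (coeff2 Q j k)" "smooth_on UNIV (coeff1 Q j)" "smooth_on UNIV (coeff0 Q)" for j k
    using Q test_smooth[of _ UNIV] unfolding test_coeffs_def by blast+
  show ?thesis unfolding apply_op_def[abs_def]
    by (intro test_add test_sum test_mult(1) test_D w c) auto
qed

text \<open>For a test function the integral inside \<open>Lp_norm\<close> converges, so its default
  value for divergent integrals does not interfere. The weight matters only on the ball, where
  \<phi>' and \<phi> coincide.\<close>

lemma Lp_norm_eq_Lpow:
  fixes f :: "real^'n::finite \<Rightarrow> complex"
  assumes f: "f \<in> test_functions (ball x0 R)" and B: "ball x0 R \<subseteq> \<Omega>" and p: "p > 0"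
    and \<phi>: "continuous_on UNIV \<phi>'" "\<And>x. x \<in> ball x0 R \<Longrightarrow> \<phi>' x = \<phi> x"
  shows "Lpow p (\<lambda>x. of_real (exp (- \<tau> * \<phi>' x)) * f x) < top"
    "Lp_norm p \<Omega> (\<lambda>x. of_real (exp (- \<tau> * \<phi> x)) * f x) = enn2real (Lpow p (\<lambda>x. of_real (exp (- \<tau> * \<phi>' x)) * f x)) powr (1 / p)"
proof -
  have E: "continuous_on UNIV (\<lambda>x. exp (- \<tau> * \<phi>' x))" by (intro continuous_intros \<phi>)
  show "Lpow p (\<lambda>x. of_real (exp (- \<tau> * \<phi>' x)) * f x) < top"
  proof (rule Lpow_weight_finite[OF p E test_borel[OF f]])
    show "Lpow p f < top" using nn_integral_test_powr_finite[OF f p] by (simp add: Lpow_def)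
    show "f y = 0" if "y \<notin> cball x0 R" for y using that test_outside[OF f, of y] by auto
  qed
  have [measurable]: "(\<lambda>x. exp (- \<tau> * \<phi>' x)) \<in> borel_measurable borel" "f \<in> borel_measurable borel"
    using borel_measurable_continuous_onI[OF E] test_borel[OF f] by auto
  have m: "(\<lambda>x. norm (of_real (exp (- \<tau> * \<phi>' x)) * f x) powr p) \<in> borel_measurable lborel" by measurable
  have "indicat_real \<Omega> x *\<^sub>R (norm (of_real (exp (- \<tau> * \<phi> x)) * f x) powr p) = norm (of_real (exp (- \<tau> * \<phi>' x)) * f x) powr p" for x
    using test_outside[OF f, of x] B \<phi>(2)[of x] p by (cases "x \<in> ball x0 R") auto
  then have "(LINT x:\<Omega>|lebesgue. norm (of_real (exp (- \<tau> * \<phi> x)) * f x) powr p) = (LINT x|lebesgue. norm (of_real (exp (- \<tau> * \<phi>' x)) * f x) powr p)"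
    unfolding set_lebesgue_integral_def by (simp only:)
  also have "\<dots> = (LINT x|lborel. norm (of_real (exp (- \<tau> * \<phi>' x)) * f x) powr p)" by (rule integral_completion[OF m])
  also have "\<dots> = enn2real (Lpow p (\<lambda>x. of_real (exp (- \<tau> * \<phi>' x)) * f x))"
    unfolding Lpow_def by (rule integral_eq_nn_integral[OF m]) simp
  finally show "Lp_norm p \<Omega> (\<lambda>x. of_real (exp (- \<tau> * \<phi> x)) * f x) = enn2real (Lpow p (\<lambda>x. of_real (exp (- \<tau> * \<phi>' x)) * f x)) powr (1 / p)"
    unfolding Lp_norm_def by simp
qed

text \<open>The s-th power of the given inequality, by (C Y^(1/q))^s = (C^q Y)^(s/q). Hence the
  constant C^q and the outer exponent s/q.\<close>

lemma carleman_extract: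
  fixes P Q :: "'n::finite diffop2"
  assumes dim: "CARD('n) > 2"
  defines "d \<equiv> real CARD('n)"
  defines "q \<equiv> 2 * d / (d + 2)"
  defines "s \<equiv> 2 * d / (d - 2)"
  assumes carl: "carleman_estimate P \<Omega> \<phi> M C" and C: "C > 0" and B: "ball x0 R \<subseteq> \<Omega>"
    and \<phi>: "continuous_on UNIV \<phi>'" "\<And>x. x \<in> ball x0 R \<Longrightarrow> \<phi>' x = \<phi> x"
    and P: "\<And>j k x. x \<in> ball x0 R \<Longrightarrow> coeff2 Q j k x = coeff2 P j k x" "\<And>j x. x \<in> ball x0 R \<Longrightarrow> coeff1 Q j x = coeff1 P j x" "\<And>x. x \<in> ball x0 R \<Longrightarrow> coeff0 Q x = coeff0 P x"
    and Q: "test_coeffs Q" and w: "w \<in> test_functions (ball x0 R)" and \<tau>: "\<tau> \<ge> M"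
  shows "Lpow s (\<lambda>x. of_real (exp (- \<tau> * \<phi>' x)) * w x) \<le> epowr (ennreal (C powr q) * Lpow q (\<lambda>x. of_real (exp (- \<tau> * \<phi>' x)) * apply_op Q w x)) (s / q)"
proof -
  have d: "d > 2" using dim by (simp add: d_def)
  have q: "q > 0" and s: "s > 0" using d by (auto simp: q_def s_def)
  have opeq: "apply_op P w = apply_op Q w"
  proof
    fix x
    show "apply_op P w x = apply_op Q w x"
    proof (cases "x \<in> ball x0 R")
      case True
      then show ?thesis unfolding apply_op_def using P by simp
    next
      case False
      then show ?thesis unfolding apply_op_def
        using test_outside[OF w False] test_outside[OF test_D[OF w] False] test_outside[OF test_D[OF test_D[OF w]] False] by simp
    qed
  qed
  have Qw: "apply_op Q w \<in> test_functions (ball x0 R)" by (rule apply_op_test[OF Q w])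
  define X where "X = enn2real (Lpow s (\<lambda>x. of_real (exp (- \<tau> * \<phi>' x)) * w x))"
  define Y where "Y = enn2real (Lpow q (\<lambda>x. of_real (exp (- \<tau> * \<phi>' x)) * apply_op Q w x))"
  have X: "Lpow s (\<lambda>x. of_real (exp (- \<tau> * \<phi>' x)) * w x) = ennreal X"
    using Lp_norm_eq_Lpow(1)[OF w B s \<phi>, of \<tau>] by (simp add: X_def)
  have Y: "Lpow q (\<lambda>x. of_real (exp (- \<tau> * \<phi>' x)) * apply_op Q w x) = ennreal Y"
    using Lp_norm_eq_Lpow(1)[OF Qw B q \<phi>, of \<tau>] by (simp add: Y_def)
  have nn: "X \<ge> 0" "Y \<ge> 0" by (auto simp: X_def Y_def)
  have "Lp_norm s \<Omega> (\<lambda>x. of_real (exp (- \<tau> * \<phi> x)) * w x) \<le> C * Lp_norm q \<Omega> (\<lambda>x. of_real (exp (- \<tau> * \<phi> x)) * apply_op P w x)"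
    using carl test_mono[OF w B] \<tau> unfolding carleman_estimate_def Let_def s_def q_def d_def by blast
  then have "X powr (1 / s) \<le> C * Y powr (1 / q)"
    using Lp_norm_eq_Lpow(2)[OF w B s \<phi>, of \<tau>] Lp_norm_eq_Lpow(2)[OF Qw B q \<phi>, of \<tau>]
    by (simp add: opeq X_def Y_def)
  then have "(X powr (1 / s)) powr s \<le> (C * Y powr (1 / q)) powr s" using s by (intro powr_mono2) auto
  then have "X \<le> (C * Y powr (1 / q)) powr s" using s nn by (simp add: powr_powr)
  also have "\<dots> = (C powr q * Y) powr (s / q)"
    using C nn q by (simp add: powr_mult powr_powr)
  finally have "ennreal X \<le> ennreal ((C powr q * Y) powr (s / q))" by (rule ennreal_leI)
  also have "\<dots> = epowr (ennreal (C powr q) * ennreal Y) (s / q)"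
    using nn s q by (simp add: ennreal_mult[symmetric] epowr_ennreal)
  finally show ?thesis unfolding X Y .
qed

section \<open>Smallness of the potentials and the region of the commutators\<close>

lemma Lpow_small_ball:
  fixes g :: "real^'n::finite \<Rightarrow> complex"
  assumes g: "g \<in> borel_measurable borel" "Lpow p g < \<infinity>" and p: "p > 0" and e: "e > (0::real)"
  obtains R' where "R' > 0" "\<And>R. R \<le> R' \<Longrightarrow> Lpow p (\<lambda>x. indicat_real (ball x0 R) x *\<^sub>R g x) \<le> ennreal e"
proof -
  have m: "(\<lambda>x. ennreal (norm (indicat_real (ball x0 R) x *\<^sub>R g x) powr p)) \<in> borel_measurable lborel" for R
  proof -
    have [measurable]: "(\<lambda>x. indicat_real (ball x0 R) x *\<^sub>R g x) \<in> borel_measurable borel"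
      using g(1) by (intro borel_measurable_scaleR borel_measurable_indicator) auto
    show ?thesis by measurable
  qed
  have "(\<lambda>m. \<integral>\<^sup>+x. ennreal (norm (indicat_real (ball x0 (1 / real (Suc m))) x *\<^sub>R g x) powr p) \<partial>lborel) \<longlonglongrightarrow> (\<integral>\<^sup>+(x::real^'n). 0 \<partial>lborel)"
  proof (rule nn_integral_dominated_convergence[OF m])
    show "(\<lambda>x. ennreal (norm (g x) powr p)) \<in> borel_measurable lborel" using g(1) by measurable
    show "(\<integral>\<^sup>+x. ennreal (norm (g x) powr p) \<partial>lborel) < \<infinity>" using g(2) by (simp add: Lpow_def)
    show "AE x in lborel. ennreal (norm (indicat_real (ball x0 (1 / real (Suc m))) x *\<^sub>R g x) powr p) \<le> ennreal (norm (g x) powr p)" for m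
      using p by (intro AE_I2 ennreal_leI powr_mono2) (auto simp: indicator_def)
    \<comment> \<open>The indicators of the shrinking balls tend to 0 everywhere except at the
      centre, which is a null set; |g|^p is the majorant.\<close>
    have "AE x in lborel. x \<noteq> x0" by (rule AE_lborel_singleton)
    then show "AE x in lborel. (\<lambda>m. ennreal (norm (indicat_real (ball x0 (1 / real (Suc m))) x *\<^sub>R g x) powr p)) \<longlonglongrightarrow> 0"
    proof eventually_elim
      case (elim x)
      then have "dist x0 x > 0" by simp
      then obtain N where N: "1 / real (Suc N) < dist x0 x" using nat_approx_posE by blast
      have "ennreal (norm (indicat_real (ball x0 (1 / real (Suc m))) x *\<^sub>R g x) powr p) = 0" if "m \<ge> N" for m
      proof -
        have "1 / real (Suc m) \<le> 1 / real (Suc N)" using that by (simp add: frac_le)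
        then have "x \<notin> ball x0 (1 / real (Suc m))" using N by (simp del: of_nat_Suc)
        then show ?thesis by simp
      qed
      then show ?case by (intro tendsto_eventually) (auto simp: eventually_sequentially)
    qed
  qed simp
  then have "(\<lambda>m. Lpow p (\<lambda>x. indicat_real (ball x0 (1 / real (Suc m))) x *\<^sub>R g x)) \<longlonglongrightarrow> 0" by (simp add: Lpow_def)
  from order_tendstoD(2)[OF this, of "ennreal e"] e
  obtain N where N: "Lpow p (\<lambda>x. indicat_real (ball x0 (1 / real (Suc N))) x *\<^sub>R g x) < ennreal e"
    by (auto simp: eventually_sequentially)
  show ?thesis
  proof (rule that[of "1 / real (Suc N)"])
    fix R assume R: "R \<le> 1 / real (Suc N)"
    have "Lpow p (\<lambda>x. indicat_real (ball x0 R) x *\<^sub>R g x) \<le> Lpow p (\<lambda>x. indicat_real (ball x0 (1 / real (Suc N))) x *\<^sub>R g x)"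
      using R by (intro Lpow_mono[OF p]) (auto simp: indicator_def simp del: of_nat_Suc)
    with N show "Lpow p (\<lambda>x. indicat_real (ball x0 R) x *\<^sub>R g x) \<le> ennreal e" by simp
  qed simp
qed

text \<open>For test functions on the open set \<open>X\<close> the defining identity has left side
  0, so the fundamental lemma applies to \<open>g k\<close>.\<close>

lemma weak_grad_vanishes:
  fixes u :: "real^'n::finite \<Rightarrow> complex"
  assumes H: "H1_data B u g" and X: "open X" "X \<subseteq> B" and z: "AE x in lborel. x \<in> X \<longrightarrow> u x = 0"
  shows "AE x in lborel. x \<in> X \<longrightarrow> g k x = 0"
proof (rule fundamental_lemma[OF H1_dataD(4,5,6)[OF H] X(1)])
  fix \<eta> :: "real^'n \<Rightarrow> complex" assume \<eta>: "\<eta> \<in> test_functions X"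
  note [measurable] = H1_dataD(1)[OF H] test_borel[OF test_D[OF \<eta>]]
  have "(LINT x|lborel. u x * D k \<eta> x) = (LINT x|(lborel :: (real^'n) measure). 0)"
  proof (rule integral_cong_AE)
    show "AE x in lborel. u x * D k \<eta> x = 0" using z
    proof eventually_elim
      case (elim x)
      then show ?case using test_outside[OF test_D[OF \<eta>], of x] by (cases "x \<in> X") auto
    qed
  qed measurable
  then show "(LINT x|lborel. g k x * \<eta> x) = 0"
    using H1_dataD(7)[OF H, of k] test_mono[OF \<eta> X(2)] unfolding weak_D_def by fastforce
qed

text \<open>Off the support ball of \<xi> and on the ball where it is 1, all derivatives of \<xi>
  are 0. In the shell between, a point satisfying \<open>A\<close> lies in \<open>X\<close>, where
  \<open>u\<close> and its weak gradient vanish almost everywhere. \<open>A\<close> will be the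
  condition that the weight function is below the level \<open>c\<close>.\<close>

lemma comm_term_vanishes:
  fixes u :: "real^'n::finite \<Rightarrow> complex"
  assumes H: "H1_data B u g" and X: "open X" "X \<subseteq> B" and z: "AE x in lborel. x \<in> X \<longrightarrow> u x = 0"
    and \<xi>: "\<And>x. x \<in> ball x0 \<rho> \<Longrightarrow> \<xi> x = 1" "\<And>x. x \<notin> cball x0 r \<Longrightarrow> \<xi> x = 0"
    and sub: "{x \<in> cball x0 r. x \<notin> ball x0 \<rho> \<and> A x} \<subseteq> X"
  shows "AE x in lborel. A x \<longrightarrow> comm_term P \<xi> u g x = 0"
proof -
  have "AE x in lborel. \<forall>k\<in>UNIV. x \<in> X \<longrightarrow> g k x = 0"
    by (subst AE_finite_all) (auto intro: weak_grad_vanishes[OF H X z])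
  with z show ?thesis
  proof eventually_elim
    case (elim x)
    have D1: "D k \<xi> y = 0" if "y \<in> ball x0 \<rho>" for k y
    proof -
      have "D k \<xi> y = D k (\<lambda>_. 1) y" by (rule D_cong[OF open_ball that]) (use \<xi>(1) in auto)
      then show ?thesis by (simp add: D_def)
    qed
    have D2: "D j (D k \<xi>) y = 0" if "y \<in> ball x0 \<rho>" for j k y
    proof -
      have "D j (D k \<xi>) y = D j (\<lambda>_. 0) y" by (rule D_cong[OF open_ball that]) (use D1 in auto)
      then show ?thesis by (simp add: D_def)
    qed
    show ?case
    proof
      assume A: "A x"
      consider "x \<notin> cball x0 r" | "x \<in> ball x0 \<rho>" | "x \<in> X" using sub A by blast
      then show "comm_term P \<xi> u g x = 0"
      proof cases
        case 1
        show ?thesis by (rule comm_term_outside[OF \<xi>(2) 1])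
      next
        case 2
        then show ?thesis by (simp add: comm_term_def D1 D2)
      next
        case 3
        then show ?thesis using elim by (simp add: comm_term_def)
      qed
    qed
  qed
qed

text \<open>Unchanged where \<theta> is 1, and with test functions as coefficients if \<theta> is a
  test function on a set where the coefficients are smooth.\<close>

definition cut_op :: "(real^'n \<Rightarrow> complex) \<Rightarrow> 'n::finite diffop2 \<Rightarrow> 'n diffop2" where
  "cut_op \<theta> P = \<lparr>coeff2 = \<lambda>j k x. coeff2 P j k x * \<theta> x, coeff1 = \<lambda>j x. coeff1 P j x * \<theta> x, coeff0 = \<lambda>x. coeff0 P x * \<theta> x\<rparr>"

lemma test_coeffs_cut_op:
  assumes "open \<Omega>" "smooth_coeffs \<Omega> P" "\<theta> \<in> test_functions \<Omega>"
  shows "test_coeffs (cut_op \<theta> P)"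
  using assms(2) unfolding test_coeffs_def cut_op_def smooth_coeffs_def
  by (auto intro!: test_UNIV test_mult_smooth[OF assms(1) _ assms(3)])

section \<open>Choice of radii, level and cutoffs near \<open>x0\<close>\<close>

theorem proposition2p2:
  fixes \<Omega> \<Omega>\<^sub>0 S S_minus :: "(real ^ 'n::finite) set"
    and P1 P2 :: "'n diffop2"
    and x0 :: "real ^ 'n"
    and \<psi> \<phi> :: "real ^ 'n \<Rightarrow> real"
    and M C :: real
    and V1 V2 V3 :: "real ^ 'n \<Rightarrow> complex"
  assumes dim: "CARD('n) > 2"
    and \<Omega>: "open \<Omega>" "x0 \<in> \<Omega>"
    and P: "smooth_coeffs \<Omega> P1" "smooth_coeffs \<Omega> P2"
    and S: "hypersurface_near \<Omega> x0 S \<psi>"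
    and S_minus: "S_minus = {x \<in> \<Omega>. \<psi> x < \<psi> x0}"
    and M: "M \<ge> 1" and C: "C > 0"
    and \<Omega>\<^sub>0: "open \<Omega>\<^sub>0" "x0 \<in> \<Omega>\<^sub>0" "\<Omega>\<^sub>0 \<subseteq> \<Omega>"
    and \<phi>: "smooth_on \<Omega>\<^sub>0 \<phi>"
    and convexity: "{x \<in> \<Omega>\<^sub>0. x \<noteq> x0 \<and> \<phi> x \<le> \<phi> x0} \<subseteq> S_minus"
    and carleman: "carleman_estimate P1 \<Omega>\<^sub>0 \<phi> M C" "carleman_estimate P2 \<Omega>\<^sub>0 \<phi> M C"
    and V: "mem_Lp_loc (real CARD('n) / 2) \<Omega> V1"
      "mem_Lp_loc (real CARD('n) / 2) \<Omega> V2"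
      "mem_Lp_loc (real CARD('n) / 2) \<Omega> V3"
  shows "\<forall>u v. mem_H1 \<Omega> u \<longrightarrow> mem_H1 \<Omega> v \<longrightarrow>
    solves_on \<Omega> P1 V1 u V3 v \<longrightarrow> solves_on \<Omega> P2 V2 v V3 u \<longrightarrow>
    vanishes_on S_minus u \<longrightarrow> vanishes_on S_minus v \<longrightarrow>
    (\<exists>W. open W \<and> x0 \<in> W \<and> W \<subseteq> \<Omega> \<and> vanishes_on W u \<and> vanishes_on W v)"
proof (intro allI impI)
  fix u v
  assume uH: "mem_H1 \<Omega> u" and vH: "mem_H1 \<Omega> v" and su: "solves_on \<Omega> P1 V1 u V3 v" and sv: "solves_on \<Omega> P2 V2 v V3 u"
    and zu: "vanishes_on S_minus u" and zv: "vanishes_on S_minus v"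
  define d where "d = real CARD('n)"
  define q where "q = 2 * d / (d + 2)"
  have d: "d > 2" using dim by (simp add: d_def)
  have q: "q > 0" using d by (simp add: q_def)
  from S obtain U where U: "open U" "x0 \<in> U" "U \<subseteq> \<Omega>" "smooth_on U \<psi>" unfolding hypersurface_near_def by blast
  have "open (\<Omega>\<^sub>0 \<inter> U)" "x0 \<in> \<Omega>\<^sub>0 \<inter> U" using \<Omega>\<^sub>0 U by auto
  \<comment> \<open>A closed ball: its compactness gives L^{d/2} bounds for the potentials from the
    local hypothesis and allows \<phi> to be extended from it.\<close>
  then obtain R1 where R1: "R1 > 0" "cball x0 R1 \<subseteq> \<Omega>\<^sub>0 \<inter> U" using open_contains_cball by blast
  have cR1: "cball x0 R1 \<subseteq> \<Omega>" "ball x0 R1 \<subseteq> cball x0 R1" using R1 \<Omega>\<^sub>0 by auto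
  define K where "K = C powr q"
  have K: "K > 0" using C by (simp add: K_def)
  \<comment> \<open>The value for which the absorption coefficient of \<open>carleman_absorb\<close>
    equals 1/4. It depends on \<open>C\<close> and the dimension only, so the ball can be fixed
    before \<tau>.\<close>
  define \<sigma> where "\<sigma> = 1 / (4 * (K * (2 powr q * 2) * (2 powr q * 2 powr q)))"
  have \<sigma>: "\<sigma> > 0" "K * (2 powr q * 2) * (2 powr q * (2 powr q * \<sigma>)) \<le> 1/4" using K by (auto simp: \<sigma>_def field_simps)
  \<comment> \<open>Inverse to the power q/(d/2) with which Hoelder's inequality raises the
    integrals of the potentials.\<close>
  define e where "e = \<sigma> powr ((d / 2) / q)"
  have e: "e > 0" using \<sigma> by (simp add: e_def)
  have eb: "epowr X (q / (d / 2)) \<le> ennreal \<sigma>" if "X \<le> ennreal e" for X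
  proof -
    have "epowr X (q / (d / 2)) \<le> epowr (ennreal e) (q / (d / 2))" using that q d by (intro epowr_mono) auto
    also have "\<dots> = ennreal (e powr (q / (d / 2)))" using e q d by (intro epowr_ennreal) auto
    also have "e powr (q / (d / 2)) = \<sigma>"
    proof -
      have "(d / 2) / q * (q / (d / 2)) = 1" using q d by simp
      then show ?thesis unfolding e_def powr_powr using \<sigma> by simp
    qed
    finally show ?thesis .
  qed
  have pot: "\<exists>V0 R'. rep (ball x0 R1) V V0 \<and> Lpow (d / 2) V0 < \<infinity> \<and> R' > 0 \<and>
      (\<forall>R\<le>R'. Lpow (d / 2) (\<lambda>x. indicat_real (ball x0 R) x *\<^sub>R V0 x) \<le> ennreal e)" if "mem_Lp_loc (d / 2) \<Omega> V" for V
  proof -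
    have L: "mem_Lp (d / 2) (cball x0 R1) V" using that cR1 unfolding mem_Lp_loc_def by auto
    then have "set_borel_measurable lebesgue (cball x0 R1) V" by (simp add: mem_Lp_def)
    then obtain V0 where V0: "rep (ball x0 R1) V V0" by (rule rep_exists[OF _ _ cR1(2)]) auto
    have fin: "Lpow (d / 2) V0 < \<infinity>" by (rule rep_Lpow_finite[OF V0 cR1(2) _ L]) (use d in simp)
    obtain R' where "R' > 0" "\<And>R. R \<le> R' \<Longrightarrow> Lpow (d / 2) (\<lambda>x. indicat_real (ball x0 R) x *\<^sub>R V0 x) \<le> ennreal e"
      by (rule Lpow_small_ball[OF repD(1)[OF V0] fin _ e]) (use d in auto)
    with V0 fin show ?thesis by blast
  qed
  obtain W1 R2 where W1: "rep (ball x0 R1) V1 W1" "R2 > 0" "\<And>R. R \<le> R2 \<Longrightarrow> Lpow (d / 2) (\<lambda>x. indicat_real (ball x0 R) x *\<^sub>R W1 x) \<le> ennreal e"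
    using pot[OF V(1)[folded d_def]] by blast
  obtain W2 R3 where W2: "rep (ball x0 R1) V2 W2" "R3 > 0" "\<And>R. R \<le> R3 \<Longrightarrow> Lpow (d / 2) (\<lambda>x. indicat_real (ball x0 R) x *\<^sub>R W2 x) \<le> ennreal e"
    using pot[OF V(2)[folded d_def]] by blast
  obtain W3 R4 where W3: "rep (ball x0 R1) V3 W3" "R4 > 0" "\<And>R. R \<le> R4 \<Longrightarrow> Lpow (d / 2) (\<lambda>x. indicat_real (ball x0 R) x *\<^sub>R W3 x) \<le> ennreal e"
    using pot[OF V(3)[folded d_def]] by blast
  \<comment> \<open>One radius for all three potentials; the half makes it strictly smaller than
    \<open>R1\<close>, which leaves room for the cutoff of the coefficients.\<close>
  define R where "R = min (R1 / 2) (min R2 (min R3 R4))"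
  have R: "R > 0" "R < R1" "R \<le> R2" "R \<le> R3" "R \<le> R4" using R1 W1 W2 W3 by (auto simp: R_def)
  let ?B = "ball x0 R"
  have B: "?B \<subseteq> \<Omega>" "?B \<subseteq> \<Omega>\<^sub>0" "?B \<subseteq> U" "?B \<subseteq> ball x0 R1" "cball x0 R \<subseteq> \<Omega>\<^sub>0 \<inter> U"
  proof -
    have "cball x0 R \<subseteq> cball x0 R1" "?B \<subseteq> ball x0 R1" using R(2) by auto
    then show "?B \<subseteq> \<Omega>" "?B \<subseteq> \<Omega>\<^sub>0" "?B \<subseteq> U" "?B \<subseteq> ball x0 R1" "cball x0 R \<subseteq> \<Omega>\<^sub>0 \<inter> U"
      using R1(2) \<Omega>\<^sub>0(3) ball_subset_cball[of x0 R] by blast+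
  qed
  define Z where "Z W x = indicat_real ?B x *\<^sub>R (W x :: complex)" for W x
  have Z: "rep ?B V1 (Z W1)" "rep ?B V2 (Z W2)" "rep ?B V3 (Z W3)"
    unfolding Z_def[abs_def] by (rule rep_subset[OF W1(1) B(4)], simp, rule rep_subset[OF W2(1) B(4)], simp, rule rep_subset[OF W3(1) B(4)], simp)
  have ZL: "Lpow (d / 2) (Z W1) \<le> ennreal e" "Lpow (d / 2) (Z W2) \<le> ennreal e" "Lpow (d / 2) (Z W3) \<le> ennreal e"
    unfolding Z_def[abs_def] using W1(3)[OF R(3)] W2(3)[OF R(4)] W3(3)[OF R(5)] by auto
  have ZF: "Lpow (d / 2) (Z W1) < \<infinity>" "Lpow (d / 2) (Z W2) < \<infinity>" "Lpow (d / 2) (Z W3) < \<infinity>"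
    using ZL by (auto intro: le_less_trans)
  obtain \<theta> where \<theta>: "\<theta> \<in> test_functions UNIV" "\<And>x. x \<in> cball x0 R \<Longrightarrow> \<theta> x = 1" "\<And>x. x \<notin> cball x0 R1 \<Longrightarrow> \<theta> x = 0"
    by (rule cutoff_exists[OF R(2), of x0]) blast
  have \<theta>\<Omega>: "\<theta> \<in> test_functions \<Omega>" by (rule test_functionsI[OF test_smooth[OF \<theta>(1)] compact_cball cR1(1) \<theta>(3)])
  let ?Q1 = "cut_op \<theta> P1" and ?Q2 = "cut_op \<theta> P2"
  have Q: "test_coeffs ?Q1" "test_coeffs ?Q2" by (rule test_coeffs_cut_op[OF \<Omega>(1) P(1) \<theta>\<Omega>], rule test_coeffs_cut_op[OF \<Omega>(1) P(2) \<theta>\<Omega>])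
  have Qeq: "coeff2 (cut_op \<theta> P) j k x = coeff2 P j k x" "coeff1 (cut_op \<theta> P) j x = coeff1 P j x" "coeff0 (cut_op \<theta> P) x = coeff0 P x"
    if "x \<in> ?B" for P :: "'n diffop2" and j k x
    using that \<theta>(2)[of x] by (auto simp: cut_op_def)
  \<comment> \<open>Composition with the projection onto the closed ball extends \<phi> continuously
    to the whole space. Smoothness of the extension is not at stake: the weight is only ever
    multiplied, never differentiated.\<close>
  define \<Phi> where "\<Phi> x = \<phi> (closest_point (cball x0 R1) x)" for x
  have \<Phi>: "continuous_on UNIV \<Phi>" unfolding \<Phi>_def
  proof (rule continuous_on_compose2[of "cball x0 R1" \<phi>])
    show "continuous_on (cball x0 R1) \<phi>" using smooth_on_continuous[OF \<phi>] R1(2) by (auto intro: continuous_on_subset)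
    show "continuous_on UNIV (closest_point (cball x0 R1))" using R1 by (intro continuous_on_closest_point) auto
    show "closest_point (cball x0 R1) ` UNIV \<subseteq> cball x0 R1" using R1 closest_point_in_set[of "cball x0 R1"] by auto
  qed
  have \<Phi>eq: "\<Phi> x = \<phi> x" if "x \<in> cball x0 R1" for x unfolding \<Phi>_def using closest_point_self[OF that] by simp
  have \<Phi>B: "\<Phi> x = \<phi> x" if "x \<in> ?B" for x using that R by (intro \<Phi>eq) auto
  obtain u0 g0 where u0: "rep ?B u u0" "H1_data ?B u0 g0" "\<And>\<eta> k. \<eta> \<in> test_functions ?B \<Longrightarrow> distr_D k (distr_of \<Omega> u) \<eta> = (LINT x|lborel. g0 k x * \<eta> x)"
    by (rule H1_extract[OF uH B(1)]) blast
  obtain v0 h0 where v0: "rep ?B v v0" "H1_data ?B v0 h0" "\<And>\<eta> k. \<eta> \<in> test_functions ?B \<Longrightarrow> distr_D k (distr_of \<Omega> v) \<eta> = (LINT x|lborel. h0 k x * \<eta> x)"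
    by (rule H1_extract[OF vH B(1)]) blast
  have sol1: "weak_sol ?Q1 ?B u0 g0 (Z W1) (Z W3) v0"
    by (rule weak_sol_extract[OF su open_ball B(1) Qeq Q(1) u0(1) v0(1) Z(1) Z(3) u0(3)])
  have sol2: "weak_sol ?Q2 ?B v0 h0 (Z W2) (Z W3) u0"
    by (rule weak_sol_extract[OF sv open_ball B(1) Qeq Q(2) v0(1) u0(1) Z(2) Z(3) v0(3)])
  \<comment> \<open>Derivatives of \<xi> live in the shell between R/3 and 2R/3, away from
    \<open>x0\<close> and inside the ball.\<close>
  obtain \<xi> where \<xi>: "\<xi> \<in> test_functions UNIV" "\<And>x. x \<in> cball x0 (R/3) \<Longrightarrow> \<xi> x = 1" "\<And>x. x \<notin> cball x0 (2*R/3) \<Longrightarrow> \<xi> x = 0"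
    by (rule cutoff_exists[of "R/3" "2*R/3" x0]) (use R in auto)
  have \<xi>B: "\<xi> \<in> test_functions ?B"
    by (rule test_functionsI[OF test_smooth[OF \<xi>(1)] compact_cball[of x0 "2*R/3"]]) (use R \<xi>(3) in auto)
  define X where "X = {x \<in> ?B. \<psi> x < \<psi> x0}"
  have \<psi>c: "continuous_on U \<psi>" by (rule smooth_on_continuous[OF U(4)])
  have X: "open X" "X \<subseteq> ?B"
  proof -
    have "open (?B \<inter> \<psi> -` {..<\<psi> x0})"
      by (rule continuous_open_preimage[OF continuous_on_subset[OF \<psi>c B(3)]]) auto
    moreover have "X = ?B \<inter> \<psi> -` {..<\<psi> x0}" by (auto simp: X_def)
    ultimately show "open X" by simp
  qed (auto simp: X_def)
  have XS: "X \<subseteq> S_minus" using B(1) unfolding X_def S_minus by auto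
  have zX: "AE x in lborel. x \<in> X \<longrightarrow> f0 x = 0" if "vanishes_on S_minus f" "rep ?B f f0" for f f0
  proof -
    have "AE x in lborel. x \<in> S_minus \<longrightarrow> f x = 0" using that(1) unfolding vanishes_on_def AE_completion_iff .
    then show ?thesis using repD(3)[OF that(2)] by eventually_elim (use X(2) XS in auto)
  qed
  \<comment> \<open>The part of the ball away from \<open>x0\<close> that is not in S_-. It is
    compact, being defined by closed conditions, and outside it in the shell the solutions
    vanish.\<close>
  define K0 where "K0 = {x \<in> cball x0 R. R/3 \<le> dist x0 x \<and> \<psi> x0 \<le> \<psi> x}"
  have "compact K0"
  proof -
    have c: "continuous_on (cball x0 R) \<psi>" using continuous_on_subset[OF \<psi>c] B(5) by blast
    have "closed (cball x0 R \<inter> \<psi> -` {\<psi> x0..})" by (rule continuous_closed_preimage[OF c]) auto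
    moreover have "closed (- ball x0 (R/3))" by (simp add: closed_Compl)
    moreover have "K0 = cball x0 R \<inter> (- ball x0 (R/3) \<inter> (cball x0 R \<inter> \<psi> -` {\<psi> x0..}))" by (auto simp: K0_def)
    ultimately show ?thesis by (simp add: compact_Int_closed closed_Int)
  qed
  \<comment> \<open>The convexity hypothesis in contrapositive form: a point other than
    \<open>x0\<close> with \<phi> at most \<phi>(x0) would lie in S_-, where \<psi> <
    \<psi>(x0).\<close>
  have K0pos: "\<Phi> x > \<Phi> x0" if "x \<in> K0" for x
  proof (rule ccontr)
    assume "\<not> \<Phi> x > \<Phi> x0"
    moreover have "\<Phi> x = \<phi> x" "\<Phi> x0 = \<phi> x0" using that R R1 by (auto intro!: \<Phi>eq simp: K0_def)
    moreover have "x \<noteq> x0" "x \<in> \<Omega>\<^sub>0" using that R B(5) by (auto simp: K0_def)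
    ultimately have "x \<in> S_minus" using convexity by auto
    then show False using that by (simp add: S_minus K0_def)
  qed
  \<comment> \<open>The minimum of the weight function on the compact set \<open>K0\<close>; if
    \<open>K0\<close> is empty, any level above \<Phi>(x0) serves.\<close>
  obtain c where c: "c > \<Phi> x0" "\<And>x. x \<in> K0 \<Longrightarrow> c \<le> \<Phi> x"
  proof (cases "K0 = {}")
    case True
    then show ?thesis using that[of "\<Phi> x0 + 1"] by simp
  next
    case False
    obtain z where "z \<in> K0" "\<And>y. y \<in> K0 \<Longrightarrow> \<Phi> z \<le> \<Phi> y"
      using continuous_attains_inf[OF \<open>compact K0\<close> False continuous_on_subset[OF \<Phi> subset_UNIV]] by blast
    then show ?thesis using that[of "\<Phi> z"] K0pos by blast
  qed
  have sub: "{x \<in> cball x0 (2*R/3). x \<notin> ball x0 (R/3) \<and> \<Phi> x < c} \<subseteq> X"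
  proof
    fix x assume x: "x \<in> {x \<in> cball x0 (2*R/3). x \<notin> ball x0 (R/3) \<and> \<Phi> x < c}"
    then have "x \<notin> K0" using c(2) by force
    then show "x \<in> X" using x R by (auto simp: K0_def X_def)
  qed
  obtain W where W: "open W" "x0 \<in> W" "W \<subseteq> ball x0 (R/3)" "AE x in lborel. x \<in> W \<longrightarrow> u0 x = 0" "AE x in lborel. x \<in> W \<longrightarrow> v0 x = 0"
  proof (rule carleman_uniqueness[OF dim \<Phi> _ _ _ Q u0(2) v0(2), folded d_def, folded q_def])
    show "0 \<le> K" using K by simp
    show "\<xi> x = 1" if "x \<in> ball x0 (R/3)" for x using that by (intro \<xi>(2)) auto
    show "Lpow (2 * d / (d - 2)) (\<lambda>x. of_real (exp (- \<tau> * \<Phi> x)) * w x) \<le> epowr (ennreal K * Lpow q (\<lambda>x. of_real (exp (- \<tau> * \<Phi> x)) * apply_op ?Q1 w x)) (2 * d / (d - 2) / q)"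
      if "w \<in> test_functions ?B" "M \<le> \<tau>" for w \<tau>
      unfolding K_def using carleman_extract[OF dim carleman(1) C B(2) \<Phi> \<Phi>B Qeq Q(1) that, folded d_def, folded q_def] .
    show "Lpow (2 * d / (d - 2)) (\<lambda>x. of_real (exp (- \<tau> * \<Phi> x)) * w x) \<le> epowr (ennreal K * Lpow q (\<lambda>x. of_real (exp (- \<tau> * \<Phi> x)) * apply_op ?Q2 w x)) (2 * d / (d - 2) / q)"
      if "w \<in> test_functions ?B" "M \<le> \<tau>" for w \<tau>
      unfolding K_def using carleman_extract[OF dim carleman(2) C B(2) \<Phi> \<Phi>B Qeq Q(2) that, folded d_def, folded q_def] .
    show "AE x in lborel. \<Phi> x < c \<longrightarrow> comm_term ?Q1 \<xi> u0 g0 x = 0"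
      by (rule comm_term_vanishes[OF u0(2) X zX[OF zu u0(1)] _ \<xi>(3) sub]) (use \<xi>(2) in auto)
    show "AE x in lborel. \<Phi> x < c \<longrightarrow> comm_term ?Q2 \<xi> v0 h0 x = 0"
      by (rule comm_term_vanishes[OF v0(2) X zX[OF zv v0(1)] _ \<xi>(3) sub]) (use \<xi>(2) in auto)
  qed (use repD(1)[OF Z(1)] repD(1)[OF Z(2)] repD(1)[OF Z(3)] ZF eb[OF ZL(1)] eb[OF ZL(2)] eb[OF ZL(3)] \<sigma> sol1 sol2 \<xi>B R c(1) that in auto)
  have WB: "W \<subseteq> ?B" using W(3) R by auto
  have fin: "vanishes_on W f" if "AE x in lborel. x \<in> W \<longrightarrow> f0 x = 0" "rep ?B f f0" for f f0
    unfolding vanishes_on_def AE_completion_iff using that(1) repD(3)[OF that(2)]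
    by eventually_elim (use WB in auto)
  show "\<exists>W. open W \<and> x0 \<in> W \<and> W \<subseteq> \<Omega> \<and> vanishes_on W u \<and> vanishes_on W v"
    using W(1,2) WB B(1) fin[OF W(4) u0(1)] fin[OF W(5) v0(1)] by blast
qed

end
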